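(* Let $1\le p\le 2$, $1/p+1/q=1$, let $\sigma_1,\sigma_2\in L^p[0,1]$ be complex-valued, fix $r\ge 0$, and take $R_r>0$ so large that $\gamma_{1,q}(\mu)\le 1/(2a)$ for all $\mu\in\Sigma_r(R_r)$, where $a=2e^{4r}\|\sigma_0\|_{L^p}^3$. Then for $\mu\in\Sigma_r(R_r)$ there exists the solution $W=[w_1,w_2]^T$ of the Dirac system $$y_1'+\sigma_1y_2=i\mu y_1,\qquad y_2'+\sigma_2y_1=-i\mu y_2\qquad\text{on }[0,1]$$ satisfying $w_1(0)=1$, $w_2(1)=0$, which is analytic with respect to $\mu$ as a $\mathcal C[0,1]\times\mathcal C[0,1]$-valued function and admits the following asymptotic representations as $|\mu|\to\infty$: (i) $$w_1(x)=e^{i\mu x}\big(1-(K_1e)(x)\big)+e^{i\mu x}R_1(x,\mu),$$ $$w_2(x)=e^{i\mu x}\Big(\int_x^1e^{2i\mu(t-x)}\sigma_2(t)\,dt-\int_x^1e^{2i\mu(t-x)}\sigma_2(t)(K_1e)(t)\,dt\Big)+e^{i\mu x}R_2(x,\mu),$$ where $\|R_j(\cdot,\mu)\|_{\mathcal C}\le C_j\,\widetilde\gamma(\mu)$ for a constant $C_j>0$, $j=1,2$; (ii) $$w_1(x)=e^{i\mu x}\big(1-(K_1e)(x)\big)+e^{i\mu x}S_1(x,\mu),\qquad w_2(x)=e^{i\mu x}\int_x^1e^{2i\mu(t-x)}\sigma_2(t)\,dt+e^{i\mu x}S_2(x,\mu),$$ where $|S_j(x,\mu)|\le C_j\Lambda_q(x,\mu)$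 for $x\in[0,1]$, $j=1,2$; (iii) $$w_1(x)=e^{i\mu x}+e^{i\mu x}T_1(x,\mu),\qquad w_2(x)=e^{i\mu x}T_2(x,\mu),$$ where $|T_j(x,\mu)|\le C_j\,\Xi_q(x,\mu)$ for $x\in[0,1]$, $j=1,2$.
   Context: Solutions of the system are pairs of absolutely continuous functions on $[0,1]$ satisfying the equations almost everywhere; $\mu\in\mathbb C$ is the spectral parameter. $\|\cdot\|_{\mathcal C}$ is the sup norm on $\mathcal C[0,1]$ (continuous complex-valued functions). $\Sigma_r=\{\mu\in\mathbb C:\operatorname{Im}\mu>-r\}$ and $\Sigma_r(R)=\{\mu\in\Sigma_r:|\mu|>R\}$. $\sigma_0(x)=\max\{|\sigma_1(x)|,|\sigma_2(x)|\}$. $e$ denotes the constant function $e(x)=1$ on $[0,1]$. The operator $K_1=K_1(\mu)$ on $\mathcal C[0,1]$ is $$(K_1z)(x)=\int_0^x\sigma_1(t)\int_t^1e^{2i\mu(s-t)}\sigma_2(s)z(s)\,ds\,dt.$$ Define $$\gamma_{0,1}(x,\mu)=\Big|\int_0^xe^{2i\mu(x-t)}\sigma_1(t)\,dt\Big|,\qquad \gamma_{0,2}(x,\mu)=\Big|\int_x^1e^{2i\mu(t-x)}\sigma_2(t)\,dt\Big|,$$ $\gamma_{j,q}(\mu)=\|\gamma_{0,j}(\cdot,\mu)\|_{L^q[0,1]}$ for $j=1,2$ (the supremum over $[0,1]$ if $p=1$, $q=\infty$), $$\widetilde\gamma(\mu)=\int_0^1|\sigma_2(s)|\gamma_{0,1}^2(s,\mu)\,ds+\int_0^1|\sigma_1(s)|\gamma_{0,2}^2(s,\mu)\,ds,$$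 $$\Xi_q(x,\mu)=\gamma_{1,q}(\mu)+\gamma_{2,q}(\mu)+\gamma_{0,1}(x,\mu)+\gamma_{0,2}(x,\mu),$$ $$\Lambda_q(x,\mu)=\widetilde\gamma(\mu)+\gamma_{1,q}^2(\mu)+\gamma_{2,q}^2(\mu)+\gamma_{0,1}^2(x,\mu)+\gamma_{0,2}^2(x,\mu).$$ A representation "as $|\mu|\to\infty$" means that the stated remainder bound holds for all $\mu\in\Sigma_r$ with $|\mu|$ sufficiently large, with constants $C_j$ independent of $x$ and $\mu$. *)

theory Defs
  imports "HOL-Analysis.Analysis"
begin

definition Lp_space :: "real \<Rightarrow> (real \<Rightarrow> complex) set" where
  "Lp_space p = {f. f \<in> borel_measurable (lebesgue_on {0..1}) \<and>
     integrable (lebesgue_on {0..1}) (\<lambda>x. norm (f x) powr p)}"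

definition Lp_norm :: "real \<Rightarrow> (real \<Rightarrow> real) \<Rightarrow> real" where
  "Lp_norm p f = (LINT x:{0..1}|lebesgue. \<bar>f x\<bar> powr p) powr (1 / p)"

text \<open>
  The supremum is taken in the conditionally complete type \<^typ>\<open>real\<close>; it is only used for
  functions that are continuous, hence bounded, on the unit interval.
\<close>

definition sup_norm :: "(real \<Rightarrow> 'a::real_normed_vector) \<Rightarrow> real" where
  "sup_norm f = (SUP x\<in>{0..1}. norm (f x))"

text \<open>For exponent \<open>\<infinity>\<close> this is the plain supremum, not the essential one.\<close>

definition Lq_norm :: "ennreal \<Rightarrow> (real \<Rightarrow> real) \<Rightarrow> real" where
  "Lq_norm q f = (if q = \<infinity> then sup_norm f else Lp_norm (enn2real q) f)"

definition abs_cont_on :: "real \<Rightarrow> real \<Rightarrow> (real \<Rightarrow> complex) \<Rightarrow> bool" where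
  "abs_cont_on a b f \<longleftrightarrow>
     (\<forall>\<epsilon>>0. \<exists>\<delta>>0. \<forall>I :: (real \<times> real) set.
        finite I \<longrightarrow> (\<forall>(u, v)\<in>I. a \<le> u \<and> u \<le> v \<and> v \<le> b) \<longrightarrow>
        disjoint_family_on (\<lambda>(u, v). {u<..<v}) I \<longrightarrow>
        (\<Sum>(u, v)\<in>I. v - u) < \<delta> \<longrightarrow>
        (\<Sum>(u, v)\<in>I. norm (f v - f u)) < \<epsilon>)"

definition Dirac_solution ::
  "(real \<Rightarrow> complex) \<Rightarrow> (real \<Rightarrow> complex) \<Rightarrow> complex \<Rightarrow> (real \<Rightarrow> complex) \<Rightarrow> (real \<Rightarrow> complex) \<Rightarrow> bool"
  where
  "Dirac_solution \<sigma>\<^sub>1 \<sigma>\<^sub>2 \<mu> y\<^sub>1 y\<^sub>2 \<longleftrightarrow>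
     abs_cont_on 0 1 y\<^sub>1 \<and> abs_cont_on 0 1 y\<^sub>2 \<and>
     (AE x in lebesgue_on {0..1}. \<exists>d\<^sub>1 d\<^sub>2.
        (y\<^sub>1 has_vector_derivative d\<^sub>1) (at x within {0..1}) \<and>
        (y\<^sub>2 has_vector_derivative d\<^sub>2) (at x within {0..1}) \<and>
        d\<^sub>1 + \<sigma>\<^sub>1 x * y\<^sub>2 x = \<i> * \<mu> * y\<^sub>1 x \<and>
        d\<^sub>2 + \<sigma>\<^sub>2 x * y\<^sub>1 x = - \<i> * \<mu> * y\<^sub>2 x)"

text \<open>
  Complex differentiability, at every point of \<open>S\<close>, of \<open>\<mu> \<mapsto> (w\<^sub>1 \<mu>, w\<^sub>2 \<mu>)\<close> as a map into
  the product of two copies of the Banach space of continuous complex functions on the unit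
  interval: the difference quotients converge in the supremum norm.
\<close>

definition C01_pair_holomorphic_on ::
  "(complex \<Rightarrow> real \<Rightarrow> complex) \<Rightarrow> (complex \<Rightarrow> real \<Rightarrow> complex) \<Rightarrow> complex set \<Rightarrow> bool" where
  "C01_pair_holomorphic_on w\<^sub>1 w\<^sub>2 S \<longleftrightarrow>
     (\<forall>\<mu>\<in>S. continuous_on {0..1} (w\<^sub>1 \<mu>) \<and> continuous_on {0..1} (w\<^sub>2 \<mu>)) \<and>
     (\<forall>\<mu>\<in>S. \<exists>d\<^sub>1 d\<^sub>2. continuous_on {0..1} d\<^sub>1 \<and> continuous_on {0..1} d\<^sub>2 \<and>
        uniform_limit {0..1} (\<lambda>\<nu> x. (w\<^sub>1 \<nu> x - w\<^sub>1 \<mu> x) / (\<nu> - \<mu>)) d\<^sub>1 (at \<mu> within S) \<and>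
        uniform_limit {0..1} (\<lambda>\<nu> x. (w\<^sub>2 \<nu> x - w\<^sub>2 \<mu> x) / (\<nu> - \<mu>)) d\<^sub>2 (at \<mu> within S))"

text \<open>As for \<^const>\<open>analytic_on\<close>: holomorphic on an open neighbourhood.\<close>

definition C01_pair_analytic_on ::
  "(complex \<Rightarrow> real \<Rightarrow> complex) \<Rightarrow> (complex \<Rightarrow> real \<Rightarrow> complex) \<Rightarrow> complex set \<Rightarrow> bool" where
  "C01_pair_analytic_on w\<^sub>1 w\<^sub>2 S \<longleftrightarrow>
     (\<forall>\<mu>\<in>S. \<exists>\<epsilon>>0. C01_pair_holomorphic_on w\<^sub>1 w\<^sub>2 (ball \<mu> \<epsilon>))"

definition \<Sigma>_region :: "real \<Rightarrow> complex set" where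
  "\<Sigma>_region r = {\<mu>. Im \<mu> > - r}"

definition \<Sigma>_outer :: "real \<Rightarrow> real \<Rightarrow> complex set" where
  "\<Sigma>_outer r R = {\<mu> \<in> \<Sigma>_region r. norm \<mu> > R}"

context
  fixes \<sigma>\<^sub>1 \<sigma>\<^sub>2 :: "real \<Rightarrow> complex"
begin

definition \<sigma>0 :: "real \<Rightarrow> real" where
  "\<sigma>0 x = max (norm (\<sigma>\<^sub>1 x)) (norm (\<sigma>\<^sub>2 x))"

definition K1 :: "complex \<Rightarrow> (real \<Rightarrow> complex) \<Rightarrow> real \<Rightarrow> complex" where
  "K1 \<mu> z x =
     (LINT t:{0..x}|lebesgue. \<sigma>\<^sub>1 t *
        (LINT s:{t..1}|lebesgue. exp (2 * \<i> * \<mu> * of_real (s - t)) * \<sigma>\<^sub>2 s * z s))"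

definition \<gamma>01 :: "complex \<Rightarrow> real \<Rightarrow> real" where
  "\<gamma>01 \<mu> x = norm (LINT t:{0..x}|lebesgue. exp (2 * \<i> * \<mu> * of_real (x - t)) * \<sigma>\<^sub>1 t)"

definition \<gamma>02 :: "complex \<Rightarrow> real \<Rightarrow> real" where
  "\<gamma>02 \<mu> x = norm (LINT t:{x..1}|lebesgue. exp (2 * \<i> * \<mu> * of_real (t - x)) * \<sigma>\<^sub>2 t)"

definition \<gamma>1 :: "ennreal \<Rightarrow> complex \<Rightarrow> real" where
  "\<gamma>1 q \<mu> = Lq_norm q (\<gamma>01 \<mu>)"

definition \<gamma>2 :: "ennreal \<Rightarrow> complex \<Rightarrow> real" where
  "\<gamma>2 q \<mu> = Lq_norm q (\<gamma>02 \<mu>)"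

definition \<gamma>_tilde :: "complex \<Rightarrow> real" where
  "\<gamma>_tilde \<mu> =
     (LINT s:{0..1}|lebesgue. norm (\<sigma>\<^sub>2 s) * (\<gamma>01 \<mu> s)\<^sup>2) +
     (LINT s:{0..1}|lebesgue. norm (\<sigma>\<^sub>1 s) * (\<gamma>02 \<mu> s)\<^sup>2)"

definition \<Xi> :: "ennreal \<Rightarrow> real \<Rightarrow> complex \<Rightarrow> real" where
  "\<Xi> q x \<mu> = \<gamma>1 q \<mu> + \<gamma>2 q \<mu> + \<gamma>01 \<mu> x + \<gamma>02 \<mu> x"

definition \<Lambda> :: "ennreal \<Rightarrow> real \<Rightarrow> complex \<Rightarrow> real" where
  "\<Lambda> q x \<mu> = \<gamma>_tilde \<mu> + (\<gamma>1 q \<mu>)\<^sup>2 + (\<gamma>2 q \<mu>)\<^sup>2 + (\<gamma>01 \<mu> x)\<^sup>2 + (\<gamma>02 \<mu> x)\<^sup>2"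

end

end

theory Submission
  imports Defs
begin

text \<open>
  Substituting \<open>w\<^sub>1 = exp (\<i> \<mu> x) z\<close> and \<open>w\<^sub>2 = exp (\<i> \<mu> x) v\<close> turns the boundary value problem into
  \<open>v = V z\<close>, \<open>z + K z = 1\<close> with \<open>(V f) x = \<integral>\<^bsub>x..1\<^esub> exp (2 \<i> \<mu> (s - x)) \<sigma>\<^sub>2 f\<close> and
  \<open>(K f) x = \<integral>\<^bsub>0..x\<^esub> \<sigma>\<^sub>1 V f\<close>; here \<open>K\<close> is \<^const>\<open>K1\<close>. Let
  \<open>g\<^sub>1 x = \<integral>\<^bsub>0..x\<^esub> exp (2 \<i> \<mu> (x - t)) \<sigma>\<^sub>1\<close> and \<open>g\<^sub>2 = V 1\<close>, so that \<open>\<gamma>01 = |g\<^sub>1|\<close> and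
  \<open>\<gamma>02 = |g\<^sub>2|\<close>. Integration by parts gives \<open>K f = g\<^sub>1 V f + \<integral>\<^bsub>0..x\<^esub> g\<^sub>1 \<sigma>\<^sub>2 f\<close>, whence
  \<open>\<parallel>K\<^sup>2\<parallel> \<le> a \<gamma>\<^sub>1 \<le> 1/2\<close>, and \<open>1 + K\<close> is invertible with a uniformly bounded inverse.
  The remainder \<open>R = z - (1 - K 1)\<close> solves \<open>R + K R = K (K 1)\<close>. Two more integrations by parts,
  with \<open>u = K 1\<close>, give
  \<open>V u = g\<^sub>2 u + \<integral>\<^bsub>x..1\<^esub> exp (2 \<i> \<mu> (t - x)) \<sigma>\<^sub>1 g\<^sub>2\<^sup>2\<close> and
  \<open>K u = u\<^sup>2 / 2 + \<integral>\<^bsub>0..x\<^esub> \<sigma>\<^sub>1 (V u - g\<^sub>2 u)\<close>, both controlled by \<open>\<integral> |\<sigma>\<^sub>1| |g\<^sub>2|\<^sup>2\<close> because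
  \<open>u\<^sup>2\<close> is, by Cauchy--Schwarz. Hoelder's inequality bounds \<open>u\<close> by \<open>\<gamma>\<^sub>2\<close>.
\<close>

section \<open>Absolutely continuous functions\<close>

text \<open>The operator \<open>K\<close> itself need not be small; only its square is, because the
  oscillation of the kernel becomes visible once integration by parts has moved it into
  \<open>g1\<close>. Hence \<open>u + K u = f\<close> is always used in the iterated form
  \<open>u = f - K f + K (K u)\<close>: it gives a contraction for existence, and its last term can
  be absorbed on the left for the bound. The factors of \<open>a\<close> can be read off
  \<open>K (K f)\<close>: each \<open>K\<close> costs one kernel bound
  \<open>\<kappa> = exp (2 * r)\<close>, the factor 2 counts the two terms left by the integration
  by parts, and the three norms of \<open>\<sigma>0\<close> come from the outer
  \<open>\<sigma>1\<close>, from \<open>V f\<close>, and from Hoelder's inequality applied to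
  \<open>g1\<close>. The second obstacle is regularity. The potentials are merely integrable and the
  equations hold almost everywhere, so product rule, integrating factors and the passage from the
  system to the integral equation all rest on the Lebesgue fundamental theorem of calculus. It is
  proved for the gauge integral and packaged in the predicate \<open>primitive01\<close>.\<close>

lemma abs_cont_onE:
  assumes "abs_cont_on a b F" "0 < e"
  obtains d where "d > 0"
    "\<And>I. \<lbrakk>finite I; \<And>u v. (u, v) \<in> I \<Longrightarrow> a \<le> u \<and> u \<le> v \<and> v \<le> b;
       disjoint_family_on (\<lambda>(u, v). {u<..<v}) I; (\<Sum>(u, v)\<in>I. v - u) < d\<rbrakk>
      \<Longrightarrow> (\<Sum>(u, v)\<in>I. norm (F v - F u)) < e"
proof -
  obtain d where "d > 0" and d: "\<forall>I. finite I \<longrightarrow>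
      (\<forall>(u, v)\<in>I. a \<le> u \<and> u \<le> v \<and> v \<le> b) \<longrightarrow> disjoint_family_on (\<lambda>(u, v). {u<..<v}) I \<longrightarrow>
      (\<Sum>(u, v)\<in>I. v - u) < d \<longrightarrow> (\<Sum>(u, v)\<in>I. norm (F v - F u)) < e"
    using assms unfolding abs_cont_on_def by meson
  show thesis
  proof (rule that[OF \<open>d > 0\<close>])
    fix I :: "(real \<times> real) set"
    assume "finite I" and I: "\<And>u v. (u, v) \<in> I \<Longrightarrow> a \<le> u \<and> u \<le> v \<and> v \<le> b"
      and "disjoint_family_on (\<lambda>(u, v). {u<..<v}) I" "(\<Sum>(u, v)\<in>I. v - u) < d"
    moreover have "\<forall>(u, v)\<in>I. a \<le> u \<and> u \<le> v \<and> v \<le> b"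
      using I by blast
    ultimately show "(\<Sum>(u, v)\<in>I. norm (F v - F u)) < e"
      using d by blast
  qed
qed

text \<open>Absolute continuity speaks of total lengths, the gauge argument of an open set of small
  measure around a null set; this converts one into the other.\<close>

lemma sum_open_interval_lengths_le_measure:
  fixes I :: "(real \<times> real) set"
  assumes "finite I" "\<And>u v. (u, v) \<in> I \<Longrightarrow> u \<le> v \<and> {u<..<v} \<subseteq> U"
    and "disjoint_family_on (\<lambda>(u, v). {u<..<v}) I" "U \<in> lmeasurable"
  shows "(\<Sum>(u, v)\<in>I. v - u) \<le> measure lebesgue U"
proof -
  have "(\<Sum>(u, v)\<in>I. v - u) = (\<Sum>i\<in>I. measure lebesgue ((\<lambda>(u, v). {u<..<v}) i))"
    using assms(2) by (intro sum.cong) auto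
  also have "\<dots> = measure lebesgue (\<Union>i\<in>I. (\<lambda>(u, v). {u<..<v}) i)"
  proof (rule measure_finite_Union[symmetric])
    show "emeasure lebesgue ((\<lambda>(u, v). {u<..<v}) i) \<noteq> \<infinity>" if "i \<in> I" for i
      by (cases i; cases "fst i \<le> snd i") auto
  qed (use assms(1,3) in auto)
  also have "\<dots> \<le> measure lebesgue U"
    using assms by (intro measure_mono_fmeasurable) (auto intro!: sets.finite_UN)
  finally show ?thesis .
qed

text \<open>
  Cousin-type argument: a gauge fine on the null set keeps the intervals tagged there inside an
  open set of small measure, where absolute continuity controls the increments; elsewhere the
  straddle estimate of the ordinary fundamental theorem applies.
\<close>

theorem abs_cont_on_has_integral:
  fixes F f :: "real \<Rightarrow> complex"
  assumes "a \<le> b" and F: "abs_cont_on a b F" and N: "negligible N"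
    and der: "\<And>x. x \<in> {a..b} - N \<Longrightarrow> (F has_vector_derivative f x) (at x within {a..b})"
  shows "(f has_integral (F b - F a)) {a..b}"
proof -
  \<comment> \<open>Vanishing on \<open>N\<close> removes the null tags from the Riemann sum; at
    such tags only the increments of \<open>F\<close> remain to be estimated.\<close>
  define g where "g x = (if x \<in> N then 0 else f x)" for x
  have "(g has_integral (F b - F a)) (cbox a b)"
    unfolding has_integral
  proof (intro allI impI)
    fix e :: real
    assume "e > 0"
    \<comment> \<open>The summand 1 keeps the denominator positive when
      \<open>a = b\<close>.\<close>
    define e1 where "e1 = e / (2 * (b - a + 1))"
    have e1: "e1 > 0" "e1 * (b - a) < e / 2"
      using \<open>e > 0\<close> \<open>a \<le> b\<close> by (auto simp: e1_def field_simps)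
    obtain \<delta> where "\<delta> > 0" and \<delta>: "\<And>I. \<lbrakk>finite I; \<And>u v. (u, v) \<in> I \<Longrightarrow> a \<le> u \<and> u \<le> v \<and> v \<le> b;
       disjoint_family_on (\<lambda>(u, v). {u<..<v}) I; (\<Sum>(u, v)\<in>I. v - u) < \<delta>\<rbrakk>
      \<Longrightarrow> (\<Sum>(u, v)\<in>I. norm (F v - F u)) < e / 2"
      using abs_cont_onE[OF F, of "e / 2"] \<open>e > 0\<close> by (metis half_gt_zero)
    have "N \<in> lmeasurable"
      using N by (rule negligible_imp_measurable)
    then obtain U where U: "open U" "N \<subseteq> U" "U \<in> lmeasurable" "measure lebesgue U < \<delta>"
    proof -
      obtain U where U: "open U" "N \<subseteq> U" "U - N \<in> lmeasurable" "emeasure lebesgue (U - N) < ennreal \<delta>"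
        using sets_lebesgue_outer_open[OF fmeasurableD[OF \<open>N \<in> lmeasurable\<close>] \<open>\<delta> > 0\<close>] by metis
      have null: "N \<in> null_sets lebesgue"
        using N negligible_iff_null_sets by blast
      have "U \<in> lmeasurable"
        by (metis U(2,3) \<open>N \<in> lmeasurable\<close> fmeasurable.Un Diff_partition)
      \<comment> \<open>The outer approximation controls \<open>U - N\<close> only; as
        \<open>N\<close> is null, this is already the measure of \<open>U\<close>.\<close>
      moreover have "measure lebesgue U = measure lebesgue (U - N)"
        using null \<open>U \<in> lmeasurable\<close> by (metis measure_Diff_null_set fmeasurableD)
      ultimately show thesis
        using U that \<open>\<delta> > 0\<close> by (metis emeasure_eq_measure2 ennreal_less_iff measure_nonneg)
    qed
    have "\<exists>d>0. (x \<in> N \<longrightarrow> ball x d \<subseteq> U) \<and> (x \<in> {a..b} - N \<longrightarrow>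
         (\<forall>y\<in>{a..b}. norm (y - x) < d \<longrightarrow> norm (F y - F x - (y - x) *\<^sub>R f x) \<le> e1 * norm (y - x)))" for x
    proof (cases "x \<in> N")
      case True
      then show ?thesis
        using U(1,2) open_contains_ball by (metis DiffD2 subsetD)
    next
      case False
      show ?thesis
      proof (cases "x \<in> {a..b}")
        case True
        then have "(F has_derivative (\<lambda>h. h *\<^sub>R f x)) (at x within {a..b})"
          using der[of x] False by (simp add: has_vector_derivative_def)
        then show ?thesis
          using False e1(1) unfolding has_derivative_within_alt by blast
      qed (use False zero_less_one in blast)
    qed
    then obtain d where d0: "\<And>x. d x > 0" and dU: "\<And>x. x \<in> N \<Longrightarrow> ball x (d x) \<subseteq> U"
      and d: "\<And>x y. \<lbrakk>x \<in> {a..b} - N; y \<in> {a..b}; norm (y - x) < d x\<rbrakk> \<Longrightarrow>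
         norm (F y - F x - (y - x) *\<^sub>R f x) \<le> e1 * norm (y - x)"
      by metis
    show "\<exists>\<gamma>. gauge \<gamma> \<and> (\<forall>p. p tagged_division_of cbox a b \<and> \<gamma> fine p \<longrightarrow>
        norm ((\<Sum>(x, K)\<in>p. measure lborel K *\<^sub>R g x) - (F b - F a)) < e)"
    proof (rule exI, safe)
      show "gauge (\<lambda>x. ball x (d x))"
        using d0 gauge_ball_dependent by blast
    next
      fix p
      assume ptag: "p tagged_division_of cbox a b" and finep: "(\<lambda>x. ball x (d x)) fine p"
      note finp = tagged_division_of_finite[OF ptag]
      \<comment> \<open>Degenerate intervals have zero increment and are left out: the remaining
        ones have nonempty disjoint interiors, so passing to pairs of endpoints is
        injective.\<close>
      define p1 where "p1 = {(x, K) \<in> p. x \<in> N \<and> Inf K < Sup K}"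
      define I where "I = (\<lambda>(x, K). (Inf K, Sup K)) ` p1"
      have K: "\<exists>u v. K = {u..v} \<and> u \<le> v \<and> a \<le> u \<and> v \<le> b \<and> Inf K = u \<and> Sup K = v \<and> x \<in> K \<and>
          K \<subseteq> ball x (d x)" if xK: "(x, K) \<in> p" for x K
      proof -
        obtain u v where uv: "K = {u..v}" "x \<in> K" "K \<subseteq> cbox a b"
          using tagged_division_ofD(2-4)[OF ptag xK] by (metis box_real(2))
        then have "u \<le> v" by auto
        then show ?thesis
          using uv finep that by (auto simp: fine_def)
      qed
      have interior: "interior K = {Inf K<..<Sup K}" if "(x, K) \<in> p" for x K
        using K[OF that] by (metis interior_atLeastAtMost_real)
      have disj: "{Inf K<..<Sup K} \<inter> {Inf L<..<Sup L} = {}"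
        if "(x, K) \<in> p" "(y, L) \<in> p" "(x, K) \<noteq> (y, L)" for x K y L
        using tagged_division_ofD(5)[OF ptag that] interior that by metis
      have inj: "inj_on (\<lambda>(x, K). (Inf K, Sup K)) p1"
      proof (rule inj_onI, clarify)
        fix x K y L
        assume *: "(x, K) \<in> p1" "(y, L) \<in> p1" "Inf K = Inf L" "Sup K = Sup L"
        have "{Inf K<..<Sup K} \<inter> {Inf L<..<Sup L} \<noteq> {}"
          using * by (auto simp: p1_def)
        then show "x = y \<and> K = L"
          using disj[of x K y L] * by (auto simp: p1_def)
      qed
      have "disjoint_family_on (\<lambda>(u, v). {u<..<v}) I"
        unfolding disjoint_family_on_def I_def using disj by (fastforce simp: p1_def)
      moreover have "finite I"
        unfolding I_def p1_def using finp by (auto intro: finite_subset)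
      moreover have I: "a \<le> u \<and> u \<le> v \<and> v \<le> b \<and> {u<..<v} \<subseteq> U" if uv: "(u, v) \<in> I" for u v
      proof -
        obtain x K where xK: "(x, K) \<in> p" "x \<in> N" "u = Inf K" "v = Sup K"
          using uv by (auto simp: I_def p1_def)
        then have "K \<subseteq> U"
          using K[OF xK(1)] dU[of x] by blast
        then show ?thesis
          using K[OF xK(1)] xK by fastforce
      qed
      moreover have "(\<Sum>(u, v)\<in>I. v - u) < \<delta>"
        using sum_open_interval_lengths_le_measure[of I U] calculation U by fastforce
      ultimately have "(\<Sum>(u, v)\<in>I. norm (F v - F u)) < e / 2"
        using \<delta>[of I] by blast
      moreover have "(\<Sum>(u, v)\<in>I. norm (F v - F u)) = (\<Sum>(x, K)\<in>p1. norm (F (Sup K) - F (Inf K)))"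
        unfolding I_def using inj by (subst sum.reindex) (auto simp: case_prod_unfold)
      ultimately have S1: "(\<Sum>(x, K)\<in>p1. norm (F (Sup K) - F (Inf K))) < e / 2" by simp
      have ba: "b - a = (\<Sum>(x,K)\<in>p. Sup K - Inf K)" "F b - F a = (\<Sum>(x,K)\<in>p. F (Sup K) - F (Inf K))"
        using additive_tagged_division_1[where f= "\<lambda>x. x"] additive_tagged_division_1[where f= F]
            \<open>a \<le> b\<close> ptag by auto
      have "norm (\<Sum>(x, K)\<in>p. measure lborel K *\<^sub>R g x - (F (Sup K) - F (Inf K)))
          \<le> (\<Sum>z\<in>p. e1 * (case z of (x, K) \<Rightarrow> Sup K - Inf K) +
                   (if z \<in> p1 then (case z of (x, K) \<Rightarrow> norm (F (Sup K) - F (Inf K))) else 0))"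
      proof (rule sum_norm_le, safe)
        fix x K
        assume xK: "(x, K) \<in> p"
        obtain u v where uv: "K = {u..v}" "u \<le> v" "a \<le> u" "v \<le> b" "x \<in> K" "K \<subseteq> ball x (d x)"
            "Inf K = u" "Sup K = v"
          using K[OF xK] by metis
        show "norm (measure lborel K *\<^sub>R g x - (F (Sup K) - F (Inf K)))
          \<le> e1 * (Sup K - Inf K) + (if (x, K) \<in> p1 then norm (F (Sup K) - F (Inf K)) else 0)"
        proof (cases "x \<in> N")
          case True
          then show ?thesis
            using uv xK e1 by (cases "u = v") (auto simp: p1_def g_def norm_minus_commute)
        next
          case False
          \<comment> \<open>Straddling: the tag lies between \<open>u\<close> and \<open>v\<close>,
            so the two one-sided errors carry the weights \<open>x - u\<close> and
            \<open>v - x\<close>, which add up to \<open>v - u\<close>.\<close>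
          have "norm ((v - u) *\<^sub>R f x - (F v - F u)) =
              norm (F u - F x - (u - x) *\<^sub>R f x - (F v - F x - (v - x) *\<^sub>R f x))"
            by (auto simp: algebra_simps)
          also have "\<dots> \<le> norm (F u - F x - (u - x) *\<^sub>R f x) + norm (F v - F x - (v - x) *\<^sub>R f x)"
            by (rule norm_triangle_ineq4)
          also have "\<dots> \<le> e1 * norm (u - x) + e1 * norm (v - x)"
          proof (intro add_mono d)
            have "u \<in> K" "v \<in> K"
              using uv(1,2) by auto
            then have "u \<in> ball x (d x)" "v \<in> ball x (d x)"
              using uv(6) by auto
            then show "norm (u - x) < d x" "norm (v - x) < d x"
              by (auto simp: dist_real_def)
          qed (use uv False in auto)
          also have "\<dots> = e1 * (v - u)"
            using uv by (auto simp: algebra_simps)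
          finally show ?thesis
            using uv False by (auto simp: g_def p1_def)
        qed
      qed
      also have "\<dots> = e1 * (b - a) + (\<Sum>(x, K)\<in>p1. norm (F (Sup K) - F (Inf K)))"
      proof -
        have "p1 = p \<inter> p1"
          by (auto simp: p1_def)
        then show ?thesis
          using finp by (simp add: sum.distrib ba sum_distrib_left[symmetric] sum.inter_restrict[symmetric])
      qed
      also have "\<dots> < e"
        using S1 e1 by linarith
      finally show "norm ((\<Sum>(x, K)\<in>p. measure lborel K *\<^sub>R g x) - (F b - F a)) < e"
        unfolding ba(2) by (simp add: split_def sum_subtractf)
    qed
  qed
  then show ?thesis
    by (intro has_integral_spike[OF N, of _ f g]) (auto simp: g_def)
qed


section \<open>Absolute continuity and differentiability of indefinite integrals\<close>

lemma absolutely_integrable_on_subinterval_real: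
  fixes f :: "real \<Rightarrow> 'b::euclidean_space"
  assumes "f absolutely_integrable_on {a..b}" "a \<le> u" "v \<le> b"
  shows "f absolutely_integrable_on {u..v}" "f integrable_on {u..v}"
proof -
  show "f absolutely_integrable_on {u..v}"
    using absolutely_integrable_on_subinterval[OF assms(1)] assms(2,3) by auto
  then show "f integrable_on {u..v}"
    by (rule set_lebesgue_integral_eq_integral(1))
qed

text \<open>The closed intervals may share endpoints, but the open ones are disjoint, so at each
  point at most one cut-off function \<open>h i\<close> is nonzero and their sum stays below
  \<open>g\<close>.\<close>

lemma sum_integral_disjoint_intervals_le:
  fixes g :: "real \<Rightarrow> real"
  assumes "finite I" "\<And>u v. (u, v) \<in> I \<Longrightarrow> a \<le> u \<and> u \<le> v \<and> v \<le> b"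
    and "disjoint_family_on (\<lambda>(u, v). {u<..<v}) I"
    and g: "g integrable_on {a..b}" "\<And>x. x \<in> {a..b} \<Longrightarrow> 0 \<le> g x"
  shows "(\<Sum>(u, v)\<in>I. integral {u..v} g) \<le> integral {a..b} g"
proof -
  define h where "h = (\<lambda>(u, v) x. if x \<in> {u<..<v} then g x else 0 :: real)"
  have h: "(h i has_integral (case i of (u, v) \<Rightarrow> integral {u..v} g)) {a..b}" if "i \<in> I" for i
  proof -
    obtain u v where i: "i = (u, v)" "a \<le> u" "u \<le> v" "v \<le> b"
      using assms(2) \<open>i \<in> I\<close> by (cases i) auto
    have "(g has_integral integral {u..v} g) {u..v}"
      using g(1) i integrable_on_subinterval by fastforce
    then have "(g has_integral integral {u..v} g) {u<..<v}"
      by (simp add: has_integral_Icc_iff_Ioo)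
    moreover have "{u<..<v} \<subseteq> {a..b}"
      using i by auto
    ultimately show ?thesis
      using has_integral_restrict[of "{u<..<v}" "{a..b}" g "integral {u..v} g"] i
      by (simp add: h_def)
  qed
  have "(\<Sum>(u, v)\<in>I. integral {u..v} g) = integral {a..b} (\<lambda>x. \<Sum>i\<in>I. h i x)"
    by (rule integral_unique[symmetric], rule has_integral_sum[OF \<open>finite I\<close> h])
  also have "\<dots> \<le> integral {a..b} g"
  proof (rule integral_le)
    show "(\<lambda>x. \<Sum>i\<in>I. h i x) integrable_on {a..b}"
      using h by (intro integrable_sum[OF \<open>finite I\<close>]) blast
    fix x assume x: "x \<in> {a..b}"
    show "(\<Sum>i\<in>I. h i x) \<le> g x"
    proof (cases "\<exists>i\<in>I. x \<in> (case i of (u, v) \<Rightarrow> {u<..<v})")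
      case True
      then obtain i where i: "i \<in> I" "x \<in> (case i of (u, v) \<Rightarrow> {u<..<v})" by blast
      have "h j x = 0" if "j \<in> I - {i}" for j
      proof -
        have "x \<notin> (case j of (u, v) \<Rightarrow> {u<..<v})"
          using disjoint_family_onD[OF assms(3), of i j] i that by blast
        then show ?thesis
          by (auto simp: h_def split: prod.splits)
      qed
      then have "(\<Sum>i\<in>I. h i x) = h i x"
        using i \<open>finite I\<close> by (subst sum.remove[of _ i]) (auto intro: sum.neutral)
      then show ?thesis
        using g(2)[OF x] by (auto simp: h_def split: prod.splits)
    next
      case False
      then have "(\<Sum>i\<in>I. h i x) = 0"
        by (intro sum.neutral) (auto simp: h_def split: prod.splits)
      then show ?thesis
        using g(2)[OF x] by simp
    qed
  qed (use g in auto)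
  finally show ?thesis .
qed

text \<open>Splits an unbounded integrable function into a bounded part and an excess of small
  integral; dominated convergence provides the level \<open>n\<close>.\<close>

lemma integrable_truncation:
  fixes g :: "real \<Rightarrow> real"
  assumes g: "g absolutely_integrable_on {a..b}" and "0 < e" and nn: "\<And>x. x \<in> {a..b} \<Longrightarrow> 0 \<le> g x"
  obtains n :: nat where "(\<lambda>x. min (g x) n) absolutely_integrable_on {a..b}"
    "integral {a..b} (\<lambda>x. g x - min (g x) n) < e"
proof -
  have ai: "(\<lambda>x. min (g x) (real n)) absolutely_integrable_on {a..b}" for n
    using absolutely_integrable_min_1[OF g absolutely_integrable_on_const] by auto
  have "(\<lambda>n. integral {a..b} (\<lambda>x. min (g x) (real n))) \<longlonglongrightarrow> integral {a..b} g"
  proof (rule dominated_convergence(2))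
    show "(\<lambda>x. min (g x) (real n)) integrable_on {a..b}" for n
      using ai set_lebesgue_integral_eq_integral(1) by blast
    show "g integrable_on {a..b}"
      using g set_lebesgue_integral_eq_integral(1) by blast
    show "norm (min (g x) (real n)) \<le> g x" if "x \<in> {a..b}" for n x
      using nn[OF that] by auto
    show "(\<lambda>n. min (g x) (real n)) \<longlonglongrightarrow> g x" for x
    proof (rule tendsto_eventually)
      obtain m where "g x \<le> real m"
        using real_arch_simple by blast
      then show "\<forall>\<^sub>F n in sequentially. min (g x) (real n) = g x"
        unfolding eventually_sequentially by (intro exI[of _ m]) auto
    qed
  qed
  then obtain n where "norm (integral {a..b} (\<lambda>x. min (g x) (real n)) - integral {a..b} g) < e"
    using LIMSEQ_D \<open>0 < e\<close> by blast
  moreover have "integral {a..b} (\<lambda>x. g x - min (g x) (real n)) =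
      integral {a..b} g - integral {a..b} (\<lambda>x. min (g x) (real n))"
    using ai g set_lebesgue_integral_eq_integral(1) by (intro integral_diff) blast+
  ultimately show thesis
    using that[OF ai[of n]] by auto
qed

theorem abs_cont_on_indefinite_integral:
  fixes f :: "real \<Rightarrow> complex"
  assumes f: "f absolutely_integrable_on {a..b}"
  shows "abs_cont_on a b (\<lambda>x. integral {a..x} f)"
  unfolding abs_cont_on_def
proof (intro allI impI)
  fix e :: real
  assume "e > 0"
  have nf: "(\<lambda>x. norm (f x)) absolutely_integrable_on {a..b}"
    using f by (rule set_integrable_norm)
  obtain n :: nat where n: "(\<lambda>x. min (norm (f x)) n) absolutely_integrable_on {a..b}"
    "integral {a..b} (\<lambda>x. norm (f x) - min (norm (f x)) n) < e / 2"
    using integrable_truncation[OF nf, of "e / 2"] \<open>e > 0\<close> by auto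
  show "\<exists>\<delta>>0. \<forall>I. finite I \<longrightarrow> (\<forall>(u, v)\<in>I. a \<le> u \<and> u \<le> v \<and> v \<le> b) \<longrightarrow>
      disjoint_family_on (\<lambda>(u, v). {u<..<v}) I \<longrightarrow> (\<Sum>(u, v)\<in>I. v - u) < \<delta> \<longrightarrow>
      (\<Sum>(u, v)\<in>I. norm (integral {a..v} f - integral {a..u} f)) < e"
  \<comment> \<open>The truncated part is at most \<open>n\<close> and contributes at most
    \<open>n\<close> times the total length, hence at most \<open>e / 2\<close>; the excess
    contributes less than \<open>e / 2\<close> over the whole interval. The added 1 covers
    \<open>n = 0\<close>.\<close>
  proof (intro exI[of _ "e / (2 * (real n + 1))"] conjI allI impI)
    show "0 < e / (2 * (real n + 1))"
      using \<open>e > 0\<close> by simp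
    fix I :: "(real \<times> real) set"
    assume I: "finite I" "\<forall>(u, v)\<in>I. a \<le> u \<and> u \<le> v \<and> v \<le> b"
      "disjoint_family_on (\<lambda>(u, v). {u<..<v}) I" and lt: "(\<Sum>(u, v)\<in>I. v - u) < e / (2 * (real n + 1))"
    let ?g = "\<lambda>x. norm (f x) - min (norm (f x)) (real n)"
    have g: "?g absolutely_integrable_on {a..b}"
      using nf n(1) by (rule set_integral_diff)
    have "norm (integral {a..v} f - integral {a..u} f) \<le> integral {u..v} ?g + real n * (v - u)"
      if "(u, v) \<in> I" for u v
    proof -
      have uv: "a \<le> u" "u \<le> v" "v \<le> b"
        using I(2) that by auto
      have "integral {a..u} f + integral {u..v} f = integral {a..v} f"
        using uv f by (intro Henstock_Kurzweil_Integration.integral_combine absolutely_integrable_on_subinterval_real(2)) auto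
      then have "norm (integral {a..v} f - integral {a..u} f) = norm (integral {u..v} f)"
        by (metis add_diff_cancel_left')
      also have "\<dots> \<le> integral {u..v} (\<lambda>x. ?g x + real n)"
      proof (rule integral_norm_bound_integral)
        show "f integrable_on {u..v}" "(\<lambda>x. ?g x + real n) integrable_on {u..v}"
          using absolutely_integrable_on_subinterval_real(2)[OF f] absolutely_integrable_on_subinterval_real(2)[OF g] uv
          by (auto intro!: integrable_add)
      qed auto
      also have "\<dots> = integral {u..v} ?g + real n * (v - u)"
        using absolutely_integrable_on_subinterval_real(2)[OF g] uv
        by (subst Henstock_Kurzweil_Integration.integral_add) auto
      finally show ?thesis .
    qed
    then have "(\<Sum>(u, v)\<in>I. norm (integral {a..v} f - integral {a..u} f)) \<le>
        (\<Sum>(u, v)\<in>I. integral {u..v} ?g + real n * (v - u))"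
      by (intro sum_mono) auto
    also have "\<dots> = (\<Sum>(u, v)\<in>I. integral {u..v} ?g) + real n * (\<Sum>(u, v)\<in>I. v - u)"
      by (simp add: case_prod_unfold sum.distrib sum_distrib_left)
    also have "\<dots> \<le> integral {a..b} ?g + real n * (e / (2 * (real n + 1)))"
    proof (intro add_mono mult_left_mono)
      show "(\<Sum>(u, v)\<in>I. integral {u..v} ?g) \<le> integral {a..b} ?g"
        using I absolutely_integrable_on_subinterval_real(2)[OF g, of a b]
        by (intro sum_integral_disjoint_intervals_le) auto
    qed (use lt in auto)
    also have "\<dots> < e / 2 + e / 2"
      using n(2) \<open>e > 0\<close> by (intro add_less_le_mono) (auto simp: field_simps)
    finally show "(\<Sum>(u, v)\<in>I. norm (integral {a..v} f - integral {a..u} f)) < e"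
      by simp
  qed
qed

theorem indefinite_integral_has_vector_derivative_ae:
  fixes f :: "real \<Rightarrow> complex"
  assumes f: "f integrable_on {a..b}"
  obtains N where "negligible N" "\<And>x. x \<in> {a..b} - N \<Longrightarrow>
     ((\<lambda>x. integral {a..x} f) has_vector_derivative f x) (at x within {a..b})"
proof -
  define g where "g x = (if x \<in> {a..b} then f x else 0)" for x
  have g: "g integrable_on UNIV"
    using f unfolding g_def by (subst integrable_restrict_UNIV)
  have int_g: "g integrable_on {u..v}" for u v
    using integrable_on_subcbox[OF g, of u v] by simp
  have refl: "(\<lambda>x. g (- x)) integrable_on {u..v}" for u v
    using Henstock_Kurzweil_Integration.integrable_reflect_real[of g "-u" "-v"] int_g by simp
  obtain N1 where N1: "negligible N1" "\<And>x e. \<lbrakk>x \<notin> N1; 0 < e\<rbrakk> \<Longrightarrow> \<exists>d>0. \<forall>h. 0 < h \<and> h < d \<longrightarrow>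
      norm (integral {x..x + h} g /\<^sub>R h - g x) < e"
    using integrable_ccontinuous_explicit[of g] int_g by (auto simp: cbox_interval)
  obtain N2 where N2: "negligible N2" "\<And>x e. \<lbrakk>x \<notin> N2; 0 < e\<rbrakk> \<Longrightarrow> \<exists>d>0. \<forall>h. 0 < h \<and> h < d \<longrightarrow>
      norm (integral {x..x + h} (\<lambda>x. g (- x)) /\<^sub>R h - g (- x)) < e"
    using integrable_ccontinuous_explicit[of "\<lambda>x. g (- x)"] refl by (auto simp: cbox_interval)
  show thesis
  proof (rule that[of "N1 \<union> uminus ` N2"])
    show "negligible (N1 \<union> uminus ` N2)"
      using N1(1) negligible_differentiable_image_negligible[OF order_refl N2(1), of uminus]
      by (auto intro: differentiable_on_minus)
    fix x assume x: "x \<in> {a..b} - (N1 \<union> uminus ` N2)"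
    then have "- x \<notin> N2" "x \<notin> N1"
      by (auto simp: image_iff)
    have "\<exists>d>0. \<forall>y\<in>{a..b}. norm (y - x) < d \<longrightarrow>
        norm (integral {a..y} f - integral {a..x} f - (y - x) *\<^sub>R f x) \<le> e * norm (y - x)"
      if "e > 0" for e
    proof -
      obtain d1 where d1: "d1 > 0" "\<And>h. \<lbrakk>0 < h; h < d1\<rbrakk> \<Longrightarrow> norm (integral {x..x + h} g /\<^sub>R h - g x) < e"
        using N1(2)[OF \<open>x \<notin> N1\<close> \<open>e > 0\<close>] by blast
      obtain d2 where d2: "d2 > 0" "\<And>h. \<lbrakk>0 < h; h < d2\<rbrakk> \<Longrightarrow>
          norm (integral {- x..- x + h} (\<lambda>x. g (- x)) /\<^sub>R h - g x) < e"
        using N2(2)[OF \<open>- x \<notin> N2\<close> \<open>e > 0\<close>] by auto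
      have fg: "integral {u..v} g = integral {u..v} f" if "a \<le> u" "v \<le> b" for u v
        using that by (intro integral_cong) (auto simp: g_def)
      have comb: "integral {a..v} f - integral {a..u} f = integral {u..v} g" if "a \<le> u" "u \<le> v" "v \<le> b" for u v
      proof -
        have "f integrable_on {a..v}"
          using f that by (auto intro: integrable_on_subinterval)
        then show ?thesis
          using Henstock_Kurzweil_Integration.integral_combine[of a u v f] that fg[of u v] by (simp add: algebra_simps)
      qed
      have aux: "norm (J - h *\<^sub>R c) \<le> e * h" if "norm (J /\<^sub>R h - c) < e" "h > 0" for J c :: complex and h
      proof -
        have "J - h *\<^sub>R c = h *\<^sub>R (J /\<^sub>R h - c)"
          using that by (simp add: algebra_simps)
        then have "norm (J - h *\<^sub>R c) = h * norm (J /\<^sub>R h - c)"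
          using that by simp
        then show ?thesis
          using that by (simp add: mult.commute)
      qed
      show ?thesis
      proof (intro exI[of _ "min d1 d2"] conjI ballI impI)
        fix y assume y: "y \<in> {a..b}" "norm (y - x) < min d1 d2"
        show "norm (integral {a..y} f - integral {a..x} f - (y - x) *\<^sub>R f x) \<le> e * norm (y - x)"
        proof (cases x y rule: linorder_cases)
          case less
          then show ?thesis
            using aux[OF d1(2)[of "y - x"]] y x comb[of x y] by (auto simp: g_def)
        next
          case greater
          have "integral {- x..- y} (\<lambda>x. g (- x)) = integral {y..x} g"
            by (rule Henstock_Kurzweil_Integration.integral_reflect_real)
          then have "norm (integral {a..x} f - integral {a..y} f - (x - y) *\<^sub>R f x) \<le> e * (x - y)"
            using aux[OF d2(2)[of "x - y"]] y x comb[of y x] greater by (auto simp: g_def)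
          moreover have "norm (integral {a..y} f - integral {a..x} f - (y - x) *\<^sub>R f x) =
              norm (integral {a..x} f - integral {a..y} f - (x - y) *\<^sub>R f x)"
            by (subst norm_minus_cancel[symmetric]) (simp add: algebra_simps)
          ultimately show ?thesis
            using greater by simp
        qed auto
      qed (use d1 d2 in auto)
    qed
    then show "((\<lambda>x. integral {a..x} f) has_vector_derivative f x) (at x within {a..b})"
      unfolding has_vector_derivative_def has_derivative_within_alt
      using bounded_linear_scaleR_left by blast
  qed
qed

section \<open>Primitives of integrable functions\<close>

lemma abs_cont_on_subinterval:
  assumes "abs_cont_on a b F" "a \<le> c" "d \<le> b"
  shows "abs_cont_on c d F"
  unfolding abs_cont_on_def
proof (intro allI impI)
  fix e :: real assume "e > 0"
  obtain \<delta> where "\<delta> > 0" and \<delta>: "\<And>I. \<lbrakk>finite I; \<And>u v. (u, v) \<in> I \<Longrightarrow> a \<le> u \<and> u \<le> v \<and> v \<le> b;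
       disjoint_family_on (\<lambda>(u, v). {u<..<v}) I; (\<Sum>(u, v)\<in>I. v - u) < \<delta>\<rbrakk>
      \<Longrightarrow> (\<Sum>(u, v)\<in>I. norm (F v - F u)) < e"
    using abs_cont_onE[OF assms(1) \<open>e > 0\<close>] by blast
  show "\<exists>\<delta>>0. \<forall>I. finite I \<longrightarrow> (\<forall>(u, v)\<in>I. c \<le> u \<and> u \<le> v \<and> v \<le> d) \<longrightarrow>
      disjoint_family_on (\<lambda>(u, v). {u<..<v}) I \<longrightarrow> (\<Sum>(u, v)\<in>I. v - u) < \<delta> \<longrightarrow>
      (\<Sum>(u, v)\<in>I. norm (F v - F u)) < e"
    using assms(2,3) by (intro exI[of _ \<delta>] conjI \<open>\<delta> > 0\<close> allI impI \<delta>) force+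
qed

lemma abs_cont_on_shift:
  assumes "abs_cont_on a b F" "\<And>x. x \<in> {a..b} \<Longrightarrow> G x = c + F x"
  shows "abs_cont_on a b G"
  unfolding abs_cont_on_def
proof (intro allI impI)
  fix e :: real assume "e > 0"
  obtain \<delta> where "\<delta> > 0" and \<delta>: "\<And>I. \<lbrakk>finite I; \<And>u v. (u, v) \<in> I \<Longrightarrow> a \<le> u \<and> u \<le> v \<and> v \<le> b;
       disjoint_family_on (\<lambda>(u, v). {u<..<v}) I; (\<Sum>(u, v)\<in>I. v - u) < \<delta>\<rbrakk>
      \<Longrightarrow> (\<Sum>(u, v)\<in>I. norm (F v - F u)) < e"
    using abs_cont_onE[OF assms(1) \<open>e > 0\<close>] by blast
  show "\<exists>\<delta>>0. \<forall>I. finite I \<longrightarrow> (\<forall>(u, v)\<in>I. a \<le> u \<and> u \<le> v \<and> v \<le> b) \<longrightarrow>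
      disjoint_family_on (\<lambda>(u, v). {u<..<v}) I \<longrightarrow> (\<Sum>(u, v)\<in>I. v - u) < \<delta> \<longrightarrow>
      (\<Sum>(u, v)\<in>I. norm (G v - G u)) < e"
  proof (intro exI[of _ \<delta>] conjI \<open>\<delta> > 0\<close> allI impI)
    fix I assume I: "finite I" "\<forall>(u, v)\<in>I. a \<le> u \<and> u \<le> v \<and> v \<le> b"
      "disjoint_family_on (\<lambda>(u, v). {u<..<v}) I" "(\<Sum>(u, v)\<in>I. v - u) < \<delta>"
    have "(\<Sum>(u, v)\<in>I. norm (G v - G u)) = (\<Sum>(u, v)\<in>I. norm (F v - F u))"
      using I(2) assms(2) by (intro sum.cong) force+
    also have "\<dots> < e"
      using I by (intro \<delta>) auto
    finally show "(\<Sum>(u, v)\<in>I. norm (G v - G u)) < e" .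
  qed
qed

lemma abs_cont_on_mult:
  assumes F: "abs_cont_on a b F" and G: "abs_cont_on a b G"
    and BF: "\<And>x. x \<in> {a..b} \<Longrightarrow> norm (F x) \<le> BF" and BG: "\<And>x. x \<in> {a..b} \<Longrightarrow> norm (G x) \<le> BG"
  shows "abs_cont_on a b (\<lambda>x. F x * G x)"
  unfolding abs_cont_on_def
proof (intro allI impI)
  fix e :: real assume "e > 0"
  \<comment> \<open>Absolute values and the summand 1 make \<open>B\<close> positive and at least as
    large as both bounds.\<close>
  define B where "B = \<bar>BF\<bar> + \<bar>BG\<bar> + 1"
  define e' where "e' = e / (2 * B)"
  have "B > 0"
    by (simp add: B_def)
  then have B: "B > 0" "e' > 0" "B * e' + B * e' = e"
    using \<open>e > 0\<close> by (auto simp: e'_def field_simps)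
  obtain \<delta>1 where "\<delta>1 > 0" and \<delta>1: "\<And>I. \<lbrakk>finite I; \<And>u v. (u, v) \<in> I \<Longrightarrow> a \<le> u \<and> u \<le> v \<and> v \<le> b;
       disjoint_family_on (\<lambda>(u, v). {u<..<v}) I; (\<Sum>(u, v)\<in>I. v - u) < \<delta>1\<rbrakk>
      \<Longrightarrow> (\<Sum>(u, v)\<in>I. norm (F v - F u)) < e'"
    using abs_cont_onE[OF F \<open>e' > 0\<close>] by blast
  obtain \<delta>2 where "\<delta>2 > 0" and \<delta>2: "\<And>I. \<lbrakk>finite I; \<And>u v. (u, v) \<in> I \<Longrightarrow> a \<le> u \<and> u \<le> v \<and> v \<le> b;
       disjoint_family_on (\<lambda>(u, v). {u<..<v}) I; (\<Sum>(u, v)\<in>I. v - u) < \<delta>2\<rbrakk>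
      \<Longrightarrow> (\<Sum>(u, v)\<in>I. norm (G v - G u)) < e'"
    using abs_cont_onE[OF G \<open>e' > 0\<close>] by blast
  show "\<exists>\<delta>>0. \<forall>I. finite I \<longrightarrow> (\<forall>(u, v)\<in>I. a \<le> u \<and> u \<le> v \<and> v \<le> b) \<longrightarrow>
      disjoint_family_on (\<lambda>(u, v). {u<..<v}) I \<longrightarrow> (\<Sum>(u, v)\<in>I. v - u) < \<delta> \<longrightarrow>
      (\<Sum>(u, v)\<in>I. norm (F v * G v - F u * G u)) < e"
  proof (intro exI[of _ "min \<delta>1 \<delta>2"] conjI allI impI)
    fix I assume I: "finite I" "\<forall>(u, v)\<in>I. a \<le> u \<and> u \<le> v \<and> v \<le> b"
      "disjoint_family_on (\<lambda>(u, v). {u<..<v}) I" "(\<Sum>(u, v)\<in>I. v - u) < min \<delta>1 \<delta>2"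
    have "norm (F v * G v - F u * G u) \<le> B * norm (F v - F u) + B * norm (G v - G u)"
      if "(u, v) \<in> I" for u v
    proof -
      have uv: "u \<in> {a..b}" "v \<in> {a..b}"
        using I(2) that by fastforce+
      have "F v * G v - F u * G u = (F v - F u) * G v + F u * (G v - G u)"
        by (simp add: algebra_simps)
      also have "norm \<dots> \<le> norm (F v - F u) * norm (G v) + norm (F u) * norm (G v - G u)"
        by (metis norm_triangle_ineq norm_mult)
      also have "\<dots> \<le> norm (F v - F u) * B + B * norm (G v - G u)"
        using BF[OF uv(1)] BG[OF uv(2)] by (intro add_mono mult_left_mono mult_right_mono) (auto simp: B_def)
      finally show ?thesis
        by (simp add: mult.commute)
    qed
    then have "(\<Sum>(u, v)\<in>I. norm (F v * G v - F u * G u)) \<le>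
        (\<Sum>(u, v)\<in>I. B * norm (F v - F u) + B * norm (G v - G u))"
      by (intro sum_mono) auto
    also have "\<dots> = B * (\<Sum>(u, v)\<in>I. norm (F v - F u)) + B * (\<Sum>(u, v)\<in>I. norm (G v - G u))"
      by (simp add: case_prod_unfold sum.distrib sum_distrib_left)
    also have "\<dots> < B * e' + B * e'"
      using I B by (intro add_strict_mono mult_strict_left_mono \<delta>1 \<delta>2) auto
    finally show "(\<Sum>(u, v)\<in>I. norm (F v * G v - F u * G u)) < e"
      using B by simp
  qed (use \<open>\<delta>1 > 0\<close> \<open>\<delta>2 > 0\<close> in auto)
qed

lemma absolutely_integrable_continuous_mult:
  fixes f g :: "real \<Rightarrow> 'a::{euclidean_space, real_normed_algebra}"
  assumes "continuous_on {a..b} g" "f absolutely_integrable_on {a..b}"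
  shows "(\<lambda>x. g x * f x) absolutely_integrable_on {a..b}"
proof (rule absolutely_integrable_bounded_measurable_product[where h = "(*)"])
  show "bilinear ((*) :: 'a \<Rightarrow> 'a \<Rightarrow> 'a)"
    by (rule bilinear_times)
  show "g \<in> borel_measurable (lebesgue_on {a..b})"
    using assms(1) by (intro continuous_imp_measurable_on_sets_lebesgue) auto
  show "bounded (g ` {a..b})"
    using assms(1) by (intro compact_imp_bounded compact_continuous_image) auto
qed (use assms in auto)

text \<open>The integrated form of "\<open>F\<close> is absolutely continuous with derivative
  \<open>f\<close> almost everywhere". The exceptional null set disappears, and naming the density
  explicitly lets a differential equation be written as a single \<open>primitive01\<close>
  fact.\<close>

definition primitive01 :: "(real \<Rightarrow> complex) \<Rightarrow> (real \<Rightarrow> complex) \<Rightarrow> bool" where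
  "primitive01 f F \<longleftrightarrow> f absolutely_integrable_on {0..1} \<and>
     (\<forall>x\<in>{0..1}. F x = F 0 + integral {0..x} f)"

lemma primitive01_imp_integrable:
  "primitive01 f F \<Longrightarrow> f absolutely_integrable_on {0..1}"
  by (simp add: primitive01_def)

lemma primitive01D:
  "primitive01 f F \<Longrightarrow> x \<in> {0..1} \<Longrightarrow> F x = F 0 + integral {0..x} f"
  unfolding primitive01_def by blast

lemma primitive01_integral:
  assumes "primitive01 f F" "0 \<le> x" "x \<le> y" "y \<le> 1"
  shows "integral {x..y} f = F y - F x"
proof -
  have F: "F x = F 0 + integral {0..x} f" "F y = F 0 + integral {0..y} f"
    using assms by (intro primitive01D[OF assms(1)]; simp)+
  have "integral {0..x} f + integral {x..y} f = integral {0..y} f"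
    using assms absolutely_integrable_on_subinterval_real(2)[OF primitive01_imp_integrable[OF assms(1)]]
    by (intro Henstock_Kurzweil_Integration.integral_combine) auto
  then show ?thesis
    unfolding F by (simp add: algebra_simps)
qed

lemma primitive01_abs_cont:
  assumes "primitive01 f F"
  shows "abs_cont_on 0 1 F"
  by (rule abs_cont_on_shift[OF abs_cont_on_indefinite_integral[where f = f and a = 0 and b = 1], of _ "F 0"])
    (use primitive01_imp_integrable[OF assms] primitive01D[OF assms] in blast)+

lemma primitive01_derivative_ae:
  assumes "primitive01 f F"
  obtains N where "negligible N"
    "\<And>x. x \<in> {0..1} - N \<Longrightarrow> (F has_vector_derivative f x) (at x within {0..1})"
proof -
  obtain N where N: "negligible N" "\<And>x. x \<in> {0..1} - N \<Longrightarrow>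
     ((\<lambda>x. integral {0..x} f) has_vector_derivative f x) (at x within {0..1})"
    using indefinite_integral_has_vector_derivative_ae[where f = f and a = 0 and b = 1]
      primitive01_imp_integrable[OF assms] absolutely_integrable_on_def by metis
  show thesis
  proof (rule that[OF N(1)])
    fix x :: real assume x: "x \<in> {0..1} - N"
    have "((\<lambda>x. F 0 + integral {0..x} f) has_vector_derivative 0 + f x) (at x within {0..1})"
      by (intro has_vector_derivative_add N(2) x has_vector_derivative_const)
    then show "(F has_vector_derivative f x) (at x within {0..1})"
      by (intro has_vector_derivative_transform[OF _ primitive01D[OF assms]]) (use x in auto)
  qed
qed

text \<open>The place where the gauge form of the fundamental theorem enters;
  \<open>primitive01_abs_cont\<close> and \<open>primitive01_derivative_ae\<close> lead
  back.\<close>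

lemma abs_cont_imp_primitive01:
  assumes "abs_cont_on 0 1 F" "f absolutely_integrable_on {0..1}" "negligible N"
    and "\<And>x. x \<in> {0..1} - N \<Longrightarrow> (F has_vector_derivative f x) (at x within {0..1})"
  shows "primitive01 f F"
  unfolding primitive01_def
proof (intro conjI ballI)
  fix x :: real assume x: "x \<in> {0..1}"
  have "(f has_integral (F x - F 0)) {0..x}"
  proof (rule abs_cont_on_has_integral[OF _ _ assms(3)])
    show "abs_cont_on 0 x F"
      using assms(1) x by (auto intro: abs_cont_on_subinterval)
    show "(F has_vector_derivative f y) (at y within {0..x})" if "y \<in> {0..x} - N" for y
      using assms(4)[of y] x that by (auto intro: has_vector_derivative_within_subset)
  qed (use x in auto)
  then show "F x = F 0 + integral {0..x} f"
    by (simp add: integral_unique)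
qed (use assms in auto)

lemma primitive01_continuous:
  assumes "primitive01 f F"
  shows "continuous_on {0..1} F"
proof -
  have "f integrable_on {0..1}"
    using primitive01_imp_integrable[OF assms] absolutely_integrable_on_def by blast
  then have "continuous_on {0..1} (\<lambda>x. F 0 + integral {0..x} f)"
    by (intro continuous_intros indefinite_integral_continuous_1)
  then show ?thesis
    by (rule continuous_on_eq) (rule primitive01D[OF assms, symmetric])
qed

lemma continuous_on_norm_bound:
  fixes f :: "real \<Rightarrow> 'a::real_normed_vector"
  assumes "continuous_on {0..1} f"
  obtains B where "0 \<le> B" "\<And>x. x \<in> {0..1} \<Longrightarrow> norm (f x) \<le> B"
proof -
  have "bounded (f ` {0..1})"
    using assms by (intro compact_imp_bounded compact_continuous_image) auto
  then obtain B where "\<forall>y \<in> f ` {0..1}. norm y \<le> B"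
    using bounded_iff by blast
  then show thesis
    using that[of B] by (metis norm_ge_zero order_trans atLeastAtMost_iff order_refl zero_le_one image_eqI)
qed

text \<open>Products of absolutely continuous functions are absolutely continuous, and the product
  rule holds off two null sets. Every later integration by parts and every integrating factor is an
  instance.\<close>

lemma primitive01_mult:
  assumes F: "primitive01 f F" and G: "primitive01 g G"
  shows "primitive01 (\<lambda>x. f x * G x + F x * g x) (\<lambda>x. F x * G x)"
proof -
  note cF = primitive01_continuous[OF F] and cG = primitive01_continuous[OF G]
  obtain N1 where N1: "negligible N1"
    "\<And>x. x \<in> {0..1} - N1 \<Longrightarrow> (F has_vector_derivative f x) (at x within {0..1})"
    using primitive01_derivative_ae[OF F] by blast
  obtain N2 where N2: "negligible N2"
    "\<And>x. x \<in> {0..1} - N2 \<Longrightarrow> (G has_vector_derivative g x) (at x within {0..1})"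
    using primitive01_derivative_ae[OF G] by blast
  obtain BF where BF: "\<And>x. x \<in> {0..1} \<Longrightarrow> norm (F x) \<le> BF"
    using continuous_on_norm_bound[OF cF] by blast
  obtain BG where BG: "\<And>x. x \<in> {0..1} \<Longrightarrow> norm (G x) \<le> BG"
    using continuous_on_norm_bound[OF cG] by blast
  show ?thesis
  proof (rule abs_cont_imp_primitive01)
    show "abs_cont_on 0 1 (\<lambda>x. F x * G x)"
      using abs_cont_on_mult[OF primitive01_abs_cont[OF F] primitive01_abs_cont[OF G] BF BG] .
    have "(\<lambda>x. G x * f x + F x * g x) absolutely_integrable_on {0..1}"
      using primitive01_imp_integrable[OF F] primitive01_imp_integrable[OF G] cF cG
      by (intro set_integral_add absolutely_integrable_continuous_mult)
    then show "(\<lambda>x. f x * G x + F x * g x) absolutely_integrable_on {0..1}"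
      by (simp add: mult.commute)
    show "negligible (N1 \<union> N2)"
      using N1 N2 by auto
    show "((\<lambda>x. F x * G x) has_vector_derivative f x * G x + F x * g x) (at x within {0..1})"
      if "x \<in> {0..1} - (N1 \<union> N2)" for x
      using has_vector_derivative_mult[OF N1(2)[of x] N2(2)[of x]] that by (auto simp: add.commute)
  qed
qed

lemma primitive01_cong:
  assumes "primitive01 f F" "\<And>x. x \<in> {0..1} \<Longrightarrow> g x = f x" "\<And>x. x \<in> {0..1} \<Longrightarrow> G x = F x"
  shows "primitive01 g G"
  unfolding primitive01_def
proof (intro conjI ballI)
  show "g absolutely_integrable_on {0..1}"
    using primitive01_imp_integrable[OF assms(1)] assms(2)
    by (metis (no_types, lifting) set_integrable_cong)
  fix x :: real assume x: "x \<in> {0..1}"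
  have "integral {0..x} g = integral {0..x} f"
    using x assms(2) by (intro integral_cong) auto
  then show "G x = G 0 + integral {0..x} g"
    using primitive01D[OF assms(1) x] assms(3)[OF x] assms(3)[of 0] by simp
qed

lemma primitive01_indefinite:
  "f absolutely_integrable_on {0..1} \<Longrightarrow> primitive01 f (\<lambda>x. c + integral {0..x} f)"
  by (simp add: primitive01_def)

lemma primitive01_tail:
  assumes "f absolutely_integrable_on {0..1}"
  shows "primitive01 (\<lambda>x. - f x) (\<lambda>x. integral {x..1} f)"
proof (rule primitive01_cong)
  show "primitive01 (\<lambda>x. - f x) (\<lambda>x. integral {0..1} f + integral {0..x} (\<lambda>x. - f x))"
    using set_integrable_mult_right[of "-1" lebesgue "{0..1}" f] assms
    by (intro primitive01_indefinite) simp
  show "integral {x..1} f = integral {0..1} f + integral {0..x} (\<lambda>x. - f x)" if "x \<in> {0..1}" for x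
    using Henstock_Kurzweil_Integration.integral_combine[of 0 x 1 f] that
      absolutely_integrable_on_subinterval_real(2)[OF assms, of 0 1] by (auto simp: algebra_simps)
qed auto

lemma primitive01_exp:
  "primitive01 (\<lambda>x. c * exp (c * of_real x)) (\<lambda>x. exp (c * of_real x))"
proof (rule abs_cont_imp_primitive01)
  let ?E = "\<lambda>x::real. exp (c * of_real x)"
  have "continuous_on {0..1} (\<lambda>x::real. c * ?E x)"
    by (intro continuous_intros)
  then show ai: "(\<lambda>x. c * ?E x) absolutely_integrable_on {0..1}"
    by (rule absolutely_integrable_continuous_real)
  have der: "(?E has_vector_derivative c * ?E x) (at x within S)" for x S
    by (rule has_vector_derivative_real_field) (auto intro!: derivative_eq_intros)
  have "?E x = 1 + integral {0..x} (\<lambda>x. c * ?E x)" if "x \<in> {0..1}" for x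
  proof -
    have "((\<lambda>x. c * ?E x) has_integral (?E x - ?E 0)) {0..x}"
      using that der by (intro fundamental_theorem_of_calculus) auto
    then have "integral {0..x} (\<lambda>x. c * ?E x) = ?E x - ?E 0"
      by (rule integral_unique)
    then show ?thesis
      by (simp only: of_real_0 mult_zero_right exp_zero) simp
  qed
  then show "abs_cont_on 0 1 ?E"
    by (intro abs_cont_on_shift[OF abs_cont_on_indefinite_integral[OF ai]])
  show "negligible {}" "\<And>x. x \<in> {0..1} - {} \<Longrightarrow> (?E has_vector_derivative c * ?E x) (at x within {0..1})"
    using der by auto
qed

lemma AE_lebesgue_on_iff_negligible:
  assumes "S \<in> sets lebesgue"
  shows "(AE x in lebesgue_on S. P x) \<longleftrightarrow> (\<exists>N. negligible N \<and> (\<forall>x\<in>S - N. P x))"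
proof -
  have "(AE x in lebesgue_on S. P x) \<longleftrightarrow> (AE x in lebesgue. x \<in> S \<longrightarrow> P x)"
    using assms by (intro AE_restrict_space_iff) auto
  also have "\<dots> \<longleftrightarrow> (\<exists>N\<in>null_sets lebesgue. {x. \<not> (x \<in> S \<longrightarrow> P x)} \<subseteq> N)"
    by (simp add: eventually_ae_filter)
  also have "\<dots> \<longleftrightarrow> (\<exists>N. negligible N \<and> (\<forall>x\<in>S - N. P x))"
    by (auto simp: negligible_iff_null_sets)
  finally show ?thesis .
qed

section \<open>The integral operators\<close>

text \<open>Banach's theorem is applied in the complete space of bounded continuous functions on the
  whole line. Clamping the argument with \<open>c\<close> turns a function continuous on the unit
  interval into such a function without changing it there.\<close>

lemma contraction_fixpoint_C01:
  fixes T :: "(real \<Rightarrow> complex) \<Rightarrow> real \<Rightarrow> complex"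
  assumes cont: "\<And>f. continuous_on {0..1} f \<Longrightarrow> continuous_on {0..1} (T f)"
    and contr: "\<And>f g B x. \<lbrakk>continuous_on {0..1} f; continuous_on {0..1} g;
      \<And>y. y \<in> {0..1} \<Longrightarrow> norm (f y - g y) \<le> B; x \<in> {0..1}\<rbrakk> \<Longrightarrow> norm (T f x - T g x) \<le> B / 2"
  obtains f where "continuous_on {0..1} f" "\<And>x. x \<in> {0..1} \<Longrightarrow> T f x = f x"
proof -
  define c :: "real \<Rightarrow> real" where "c x = max 0 (min 1 x)" for x
  have c: "c x \<in> {0..1}" "x \<in> {0..1} \<Longrightarrow> c x = x" for x
    by (auto simp: c_def)
  have cc: "continuous_on UNIV c"
    unfolding c_def by (intro continuous_intros)
  define \<Phi> :: "(real \<Rightarrow>\<^sub>C complex) \<Rightarrow> (real \<Rightarrow>\<^sub>C complex)" where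
    "\<Phi> \<phi> = Bcontfun (\<lambda>x. T (apply_bcontfun \<phi>) (c x))" for \<phi>
  have \<Phi>: "apply_bcontfun (\<Phi> \<phi>) x = T (apply_bcontfun \<phi>) (c x)" for \<phi> x
  proof -
    have T: "continuous_on {0..1} (T (apply_bcontfun \<phi>))"
      by (intro cont) simp
    have "continuous_on UNIV (\<lambda>x. T (apply_bcontfun \<phi>) (c x))"
      using c(1) by (intro continuous_on_compose2[OF T cc]) auto
    moreover have "bounded (T (apply_bcontfun \<phi>) ` {0..1})"
      using T by (intro compact_imp_bounded compact_continuous_image) auto
    then have "bounded (range (\<lambda>x. T (apply_bcontfun \<phi>) (c x)))"
      using c(1) by (elim bounded_subset) auto
    ultimately show ?thesis
      unfolding \<Phi>_def by (subst Bcontfun_inverse) (auto simp: bcontfun_def)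
  qed
  have "dist (\<Phi> \<phi>) (\<Phi> \<psi>) \<le> 1 / 2 * dist \<phi> \<psi>" for \<phi> \<psi>
  proof (rule dist_bound)
    fix x
    have "norm (T (apply_bcontfun \<phi>) (c x) - T (apply_bcontfun \<psi>) (c x)) \<le> dist \<phi> \<psi> / 2"
      by (rule contr) (use c(1) dist_bounded[of \<phi> _ \<psi>] in \<open>auto simp: dist_norm\<close>)
    then show "dist (apply_bcontfun (\<Phi> \<phi>) x) (apply_bcontfun (\<Phi> \<psi>) x) \<le> 1 / 2 * dist \<phi> \<psi>"
      by (simp add: \<Phi> dist_norm)
  qed
  then obtain \<phi> where "\<Phi> \<phi> = \<phi>"
    using banach_fix_type[of "1 / 2" \<Phi>] by auto
  show thesis
  proof (rule that[of "apply_bcontfun \<phi>"])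
    show "T (apply_bcontfun \<phi>) x = apply_bcontfun \<phi> x" if "x \<in> {0..1}" for x
      using \<Phi>[of \<phi> x] \<open>\<Phi> \<phi> = \<phi>\<close> c(2)[OF that] by simp
  qed simp
qed

text \<open>Enlarging the domain of a nonnegative majorant makes the bounds independent of the
  variable endpoint, as sup norm estimates require.\<close>

lemma norm_integral_le_01:
  fixes f :: "real \<Rightarrow> complex" and g :: "real \<Rightarrow> real"
  assumes "0 \<le> a" "b \<le> 1" "f integrable_on {a..b}" "g absolutely_integrable_on {0..1}"
    and "\<And>x. x \<in> {a..b} \<Longrightarrow> norm (f x) \<le> g x" "\<And>x. x \<in> {0..1} \<Longrightarrow> 0 \<le> g x"
  shows "norm (integral {a..b} f) \<le> integral {0..1} g"
proof -
  note g = absolutely_integrable_on_subinterval_real(2)[OF assms(4)]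
  have "norm (integral {a..b} f) \<le> integral {a..b} g"
    using assms g by (intro integral_norm_bound_integral) auto
  also have "\<dots> \<le> integral {0..1} g"
    using assms g by (intro integral_subset_le) auto
  finally show ?thesis .
qed

text \<open>The norm equals \<open>exp (- 2 * Im \<mu> * d)\<close>; in the half-plane it can grow
  only as fast as \<open>exp (2 * r * d)\<close>, and \<open>d\<close> is a difference of ordered
  points of the unit interval.\<close>

lemma norm_exp_kernel_le:
  assumes "- r \<le> Im \<mu>" "0 \<le> r" "0 \<le> d" "d \<le> 1"
  shows "norm (exp (2 * \<i> * \<mu> * of_real d)) \<le> exp (2 * r)"
proof -
  have "- Im \<mu> * d \<le> r * d"
    using assms by (intro mult_right_mono) auto
  also have "\<dots> \<le> r * 1"
    using assms by (intro mult_left_mono) auto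
  finally show ?thesis
    by (simp add: norm_exp_eq_Re algebra_simps)
qed

text \<open>Only L1 data are kept here. The exponent \<open>p\<close> enters at the end, when
  \<open>N\<close> becomes the L^p norm of \<open>\<sigma>0\<close> and Hoelder's inequality turns
  \<open>I1\<close> and \<open>I2\<close> into the norms of \<open>\<gamma>01\<close> and
  \<open>\<gamma>02\<close>.\<close>

locale dirac_potential =
  fixes \<sigma>1 \<sigma>2 :: "real \<Rightarrow> complex" and r N :: real
  assumes \<sigma>1: "\<sigma>1 absolutely_integrable_on {0..1}"
    and \<sigma>2: "\<sigma>2 absolutely_integrable_on {0..1}"
    and r: "0 \<le> r"
    and N1: "integral {0..1} (\<lambda>x. norm (\<sigma>1 x)) \<le> N"
    and N2: "integral {0..1} (\<lambda>x. norm (\<sigma>2 x)) \<le> N"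
begin

definition V :: "complex \<Rightarrow> (real \<Rightarrow> complex) \<Rightarrow> real \<Rightarrow> complex" where
  "V \<mu> f x = integral {x..1} (\<lambda>s. exp (2 * \<i> * \<mu> * of_real (s - x)) * \<sigma>2 s * f s)"

definition K :: "complex \<Rightarrow> (real \<Rightarrow> complex) \<Rightarrow> real \<Rightarrow> complex" where
  "K \<mu> f x = integral {0..x} (\<lambda>t. \<sigma>1 t * V \<mu> f t)"

definition g1 :: "complex \<Rightarrow> real \<Rightarrow> complex" where
  "g1 \<mu> x = integral {0..x} (\<lambda>t. exp (2 * \<i> * \<mu> * of_real (x - t)) * \<sigma>1 t)"

definition g2 :: "complex \<Rightarrow> real \<Rightarrow> complex" where
  "g2 \<mu> = V \<mu> (\<lambda>_. 1)"

definition \<kappa> :: real where "\<kappa> = exp (2 * r)"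

text \<open>Weighted L1 norms are the currency of all estimates: \<open>g1\<close> and
  \<open>g2\<close> are small only on average against the potentials, not necessarily in the sup
  norm.\<close>

definition I1 :: "(real \<Rightarrow> complex) \<Rightarrow> real" where
  "I1 f = integral {0..1} (\<lambda>s. norm (f s) * norm (\<sigma>1 s))"

definition I2 :: "(real \<Rightarrow> complex) \<Rightarrow> real" where
  "I2 f = integral {0..1} (\<lambda>s. norm (f s) * norm (\<sigma>2 s))"

lemma \<kappa>_ge_1: "1 \<le> \<kappa>"
  using r by (simp add: \<kappa>_def)

lemma N_nonneg: "0 \<le> N"
proof -
  have "0 \<le> integral {0..1} (\<lambda>x. norm (\<sigma>1 x))"
    using \<sigma>1 absolutely_integrable_on_def by (intro Henstock_Kurzweil_Integration.integral_nonneg) auto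
  then show ?thesis
    using N1 by simp
qed

lemma norm_\<sigma>: "(\<lambda>x. norm (\<sigma>1 x)) absolutely_integrable_on {0..1}"
  "(\<lambda>x. norm (\<sigma>2 x)) absolutely_integrable_on {0..1}"
  using \<sigma>1 \<sigma>2 by (auto intro: set_integrable_norm)

lemma I_integrable:
  assumes "continuous_on {0..1} f"
  shows "(\<lambda>s. norm (f s) * norm (\<sigma>1 s)) absolutely_integrable_on {0..1}"
    "(\<lambda>s. norm (f s) * norm (\<sigma>2 s)) absolutely_integrable_on {0..1}"
  using assms by (auto intro!: absolutely_integrable_continuous_mult norm_\<sigma> continuous_intros)

text \<open>Common source of the estimates for \<open>I1\<close> and \<open>I2\<close>: the total
  weight is at most \<open>N\<close>, so an additive constant costs a factor \<open>N\<close>. The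
  case \<open>A = 0\<close> gives the plain sup bounds.\<close>

lemma weighted_integral_le:
  fixes s h g :: "real \<Rightarrow> real"
  assumes s: "s absolutely_integrable_on {0..1}" "\<And>x. x \<in> {0..1} \<Longrightarrow> 0 \<le> s x" "integral {0..1} s \<le> N"
    and h: "continuous_on {0..1} h" and g: "continuous_on {0..1} g"
    and le: "\<And>x. x \<in> {0..1} \<Longrightarrow> h x \<le> A * g x + B" and "0 \<le> B"
  shows "integral {0..1} (\<lambda>x. h x * s x) \<le> A * integral {0..1} (\<lambda>x. g x * s x) + N * B"
proof -
  have hs: "(\<lambda>x. h x * s x) integrable_on {0..1}" and gs: "(\<lambda>x. g x * s x) integrable_on {0..1}"
    using absolutely_integrable_continuous_mult[OF h s(1)] absolutely_integrable_continuous_mult[OF g s(1)]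
    by (simp_all add: absolutely_integrable_on_def)
  have si: "s integrable_on {0..1}"
    using s by (simp add: absolutely_integrable_on_def)
  have "integral {0..1} (\<lambda>x. h x * s x) \<le> integral {0..1} (\<lambda>x. A * (g x * s x) + B * s x)"
  proof (rule integral_le[OF hs])
    show "(\<lambda>x. A * (g x * s x) + B * s x) integrable_on {0..1}"
      using gs si by (intro integrable_add integrable_on_mult_right)
    show "h x * s x \<le> A * (g x * s x) + B * s x" if "x \<in> {0..1}" for x
      using mult_right_mono[OF le[OF that] s(2)[OF that]] by (simp add: algebra_simps)
  qed
  also have "\<dots> = A * integral {0..1} (\<lambda>x. g x * s x) + B * integral {0..1} s"
    using gs si by (subst Henstock_Kurzweil_Integration.integral_add) (auto intro!: integrable_on_mult_right)
  also have "B * integral {0..1} s \<le> B * N"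
    using s(3) \<open>0 \<le> B\<close> by (rule mult_left_mono)
  finally show ?thesis
    by (simp add: mult.commute)
qed

lemma I_le:
  assumes "continuous_on {0..1} f" "continuous_on {0..1} g" "0 \<le> B"
    and "\<And>x. x \<in> {0..1} \<Longrightarrow> norm (f x) \<le> A * norm (g x) + B"
  shows "I1 f \<le> A * I1 g + N * B" "I2 f \<le> A * I2 g + N * B"
  unfolding I1_def I2_def using assms
  by (auto intro!: weighted_integral_le norm_\<sigma> N1 N2 continuous_intros)

lemma I_le_const:
  assumes "continuous_on {0..1} f" "0 \<le> B" "\<And>x. x \<in> {0..1} \<Longrightarrow> norm (f x) \<le> B"
  shows "I1 f \<le> N * B" "I2 f \<le> N * B"
  using I_le[of f "\<lambda>_. 0" B 0] assms by (auto simp: I1_def I2_def)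

text \<open>No integrability is assumed: a non-integrable function has integral 0 by
  default.\<close>

lemma I_nonneg: "0 \<le> I1 f" "0 \<le> I2 f"
  unfolding I1_def I2_def
  by (cases "(\<lambda>s. norm (f s) * norm (\<sigma>1 s)) integrable_on {0..1}";
      auto intro!: Henstock_Kurzweil_Integration.integral_nonneg simp: not_integrable_integral)
    (cases "(\<lambda>s. norm (f s) * norm (\<sigma>2 s)) integrable_on {0..1}";
      auto intro!: Henstock_Kurzweil_Integration.integral_nonneg simp: not_integrable_integral)

section \<open>Differential equations and bounds for the operators\<close>

lemma integrable_V:
  assumes "continuous_on {0..1} f"
  shows "(\<lambda>s. exp (2 * \<i> * \<mu> * of_real (s - x)) * \<sigma>2 s * f s) absolutely_integrable_on {0..1}"
proof -
  have "(\<lambda>s. (exp (2 * \<i> * \<mu> * of_real (s - x)) * f s) * \<sigma>2 s) absolutely_integrable_on {0..1}"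
    using assms by (intro absolutely_integrable_continuous_mult \<sigma>2 continuous_intros)
  then show ?thesis
    by (simp add: ac_simps)
qed

lemma V_1 [simp]: "V \<mu> f 1 = 0"
  by (simp add: V_def)

text \<open>The kernel factors as \<open>exp (- c * x) * exp (c * s)\<close> with
  \<open>c = 2 * \<i> * \<mu>\<close>, so \<open>V \<mu> f\<close> is an exponential times a tail
  integral and the product rule applies.\<close>

lemma primitive01_V:
  assumes f: "continuous_on {0..1} f"
  shows "primitive01 (\<lambda>x. - (2 * \<i> * \<mu>) * V \<mu> f x - \<sigma>2 x * f x) (V \<mu> f)"
proof -
  let ?c = "2 * \<i> * \<mu>"
  define h where "h s = exp (?c * of_real s) * \<sigma>2 s * f s" for s
  have h: "h absolutely_integrable_on {0..1}"
    using integrable_V[OF f, of \<mu> 0] by (simp add: h_def[abs_def])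
  have E: "exp (?c * of_real (s - x)) = exp (- ?c * of_real x) * exp (?c * of_real s)" for s x
    unfolding exp_add[symmetric] by (simp add: algebra_simps)
  have V: "V \<mu> f x = exp (- ?c * of_real x) * integral {x..1} h" for x
    unfolding V_def h_def integral_mult_right[symmetric] E by (simp add: mult.assoc)
  show ?thesis
  proof (rule primitive01_cong[OF primitive01_mult[OF primitive01_exp[of "- ?c"] primitive01_tail[OF h]]])
    fix x
    have "exp (- ?c * of_real x) * h x = \<sigma>2 x * f x"
      by (simp add: h_def mult.assoc[symmetric] exp_add[symmetric])
    then show "- ?c * V \<mu> f x - \<sigma>2 x * f x =
       - ?c * exp (- ?c * of_real x) * integral {x..1} h + exp (- ?c * of_real x) * - h x"
      by (simp add: V)
  qed (rule V)
qed

lemma continuous_V: "continuous_on {0..1} f \<Longrightarrow> continuous_on {0..1} (V \<mu> f)"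
  by (rule primitive01_continuous[OF primitive01_V])

lemma continuous_g2: "continuous_on {0..1} (g2 \<mu>)"
  unfolding g2_def by (intro continuous_V continuous_intros)

lemma primitive01_K:
  assumes f: "continuous_on {0..1} f"
  shows "primitive01 (\<lambda>t. \<sigma>1 t * V \<mu> f t) (K \<mu> f)"
proof -
  have "(\<lambda>t. V \<mu> f t * \<sigma>1 t) absolutely_integrable_on {0..1}"
    by (intro absolutely_integrable_continuous_mult \<sigma>1 continuous_V f)
  then show ?thesis
    using primitive01_indefinite[of "\<lambda>t. \<sigma>1 t * V \<mu> f t" 0] by (simp add: K_def[abs_def] mult.commute)
qed

lemma K_0 [simp]: "K \<mu> f 0 = 0"
  by (simp add: K_def)

lemma continuous_K: "continuous_on {0..1} f \<Longrightarrow> continuous_on {0..1} (K \<mu> f)"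
  by (rule primitive01_continuous[OF primitive01_K])

text \<open>The same factorisation with the roles of the endpoints exchanged; the multiple of
  \<open>2 * \<i> * \<mu>\<close> therefore has the opposite sign to the one for
  \<open>V\<close>.\<close>

lemma primitive01_g1: "primitive01 (\<lambda>x. \<sigma>1 x + 2 * \<i> * \<mu> * g1 \<mu> x) (g1 \<mu>)"
proof -
  let ?c = "2 * \<i> * \<mu>"
  define h where "h t = exp (- ?c * of_real t) * \<sigma>1 t" for t
  have h: "h absolutely_integrable_on {0..1}"
    unfolding h_def by (intro absolutely_integrable_continuous_mult \<sigma>1 continuous_intros)
  have E: "exp (?c * of_real (x - t)) = exp (?c * of_real x) * exp (- ?c * of_real t)" for t x
    unfolding exp_add[symmetric] by (simp add: algebra_simps)
  have g1: "g1 \<mu> x = exp (?c * of_real x) * (0 + integral {0..x} h)" for x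
    unfolding g1_def h_def add_0 integral_mult_right[symmetric] E by (simp add: mult.assoc)
  show ?thesis
  proof (rule primitive01_cong[OF primitive01_mult[OF primitive01_exp[of ?c] primitive01_indefinite[OF h, of 0]]])
    fix x
    have "exp (?c * of_real x) * h x = \<sigma>1 x"
      by (simp add: h_def mult.assoc[symmetric] exp_add[symmetric])
    then show "\<sigma>1 x + ?c * g1 \<mu> x =
       ?c * exp (?c * of_real x) * (0 + integral {0..x} h) + exp (?c * of_real x) * h x"
      by (simp add: g1)
  qed (rule g1)
qed

lemma continuous_g1: "continuous_on {0..1} (g1 \<mu>)"
  by (rule primitive01_continuous[OF primitive01_g1])

lemma norm_V_le:
  assumes "- r \<le> Im \<mu>" "continuous_on {0..1} f" "x \<in> {0..1}"
  shows "norm (V \<mu> f x) \<le> \<kappa> * I2 f"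
proof -
  have "norm (V \<mu> f x) \<le> integral {0..1} (\<lambda>s. \<kappa> * (norm (f s) * norm (\<sigma>2 s)))"
    unfolding V_def
  proof (rule norm_integral_le_01)
    show "(\<lambda>s. exp (2 * \<i> * \<mu> * of_real (s - x)) * \<sigma>2 s * f s) integrable_on {x..1}"
      using assms by (intro absolutely_integrable_on_subinterval_real(2)[OF integrable_V]) auto
    show "(\<lambda>s. \<kappa> * (norm (f s) * norm (\<sigma>2 s))) absolutely_integrable_on {0..1}"
      using I_integrable(2)[OF assms(2)] by (intro set_integrable_mult_right)
    show "norm (exp (2 * \<i> * \<mu> * of_real (s - x)) * \<sigma>2 s * f s) \<le> \<kappa> * (norm (f s) * norm (\<sigma>2 s))"
      if "s \<in> {x..1}" for s
      using norm_exp_kernel_le[OF assms(1) r, of "s - x"] that assms(3)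
      by (simp add: norm_mult \<kappa>_def mult.assoc mult.commute[of "norm (\<sigma>2 s)"] mult_right_mono)
  qed (use assms \<kappa>_ge_1 in auto)
  then show ?thesis
    by (simp add: I2_def)
qed

lemma norm_integral_\<sigma>1_le:
  assumes "continuous_on {0..1} f" "x \<in> {0..1}"
  shows "norm (integral {0..x} (\<lambda>t. \<sigma>1 t * f t)) \<le> I1 f"
  unfolding I1_def
proof (rule norm_integral_le_01)
  show "(\<lambda>t. \<sigma>1 t * f t) integrable_on {0..x}"
    using absolutely_integrable_on_subinterval_real(2)[OF absolutely_integrable_continuous_mult[OF assms(1) \<sigma>1]] assms(2)
    by (simp add: mult.commute)
qed (use assms I_integrable in \<open>auto simp: norm_mult\<close>)

lemma norm_K_le_I1:
  assumes "continuous_on {0..1} f" "x \<in> {0..1}"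
  shows "norm (K \<mu> f x) \<le> I1 (V \<mu> f)"
  unfolding K_def using assms by (intro norm_integral_\<sigma>1_le continuous_V)

lemma norm_K_le:
  assumes "- r \<le> Im \<mu>" "continuous_on {0..1} f" "x \<in> {0..1}"
  shows "norm (K \<mu> f x) \<le> N * (\<kappa> * I2 f)"
proof -
  have "I1 (V \<mu> f) \<le> N * (\<kappa> * I2 f)"
    using assms I_nonneg \<kappa>_ge_1 by (intro I_le_const continuous_V norm_V_le) auto
  then show ?thesis
    using norm_K_le_I1[of f x \<mu>] assms by simp
qed

text \<open>In the derivative of \<open>g1 * V f\<close> the two terms with
  \<open>2 * \<i> * \<mu>\<close> cancel, which leaves
  \<open>\<sigma>1 * V f - g1 * f * \<sigma>2\<close>. No boundary term appears at 0 because
  \<open>g1\<close> vanishes there.\<close>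

lemma K_by_parts:
  assumes f: "continuous_on {0..1} f" and x: "x \<in> {0..1}"
  shows "K \<mu> f x = g1 \<mu> x * V \<mu> f x + integral {0..x} (\<lambda>s. g1 \<mu> s * f s * \<sigma>2 s)"
proof -
  have "primitive01 (\<lambda>x. \<sigma>1 x * V \<mu> f x - g1 \<mu> x * f x * \<sigma>2 x) (\<lambda>x. g1 \<mu> x * V \<mu> f x)"
    by (rule primitive01_cong[OF primitive01_mult[OF primitive01_g1 primitive01_V[OF f]]])
      (simp_all add: algebra_simps)
  then have "integral {0..x} (\<lambda>x. \<sigma>1 x * V \<mu> f x - g1 \<mu> x * f x * \<sigma>2 x) =
      g1 \<mu> x * V \<mu> f x - g1 \<mu> 0 * V \<mu> f 0"
    by (rule primitive01_integral) (use x in auto)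
  moreover have "integral {0..x} (\<lambda>x. \<sigma>1 x * V \<mu> f x - g1 \<mu> x * f x * \<sigma>2 x) =
      K \<mu> f x - integral {0..x} (\<lambda>s. g1 \<mu> s * f s * \<sigma>2 s)"
    unfolding K_def
  proof (rule Henstock_Kurzweil_Integration.integral_diff)
    show "(\<lambda>x. \<sigma>1 x * V \<mu> f x) integrable_on {0..x}"
      using primitive01_imp_integrable[OF primitive01_K[OF f]] x by (auto intro: absolutely_integrable_on_subinterval_real(2))
    have "(\<lambda>s. g1 \<mu> s * f s * \<sigma>2 s) absolutely_integrable_on {0..1}"
      by (intro absolutely_integrable_continuous_mult \<sigma>2 continuous_intros continuous_g1 f)
    then show "(\<lambda>s. g1 \<mu> s * f s * \<sigma>2 s) integrable_on {0..x}"
      using x by (auto intro: absolutely_integrable_on_subinterval_real(2))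
  qed
  moreover have "g1 \<mu> 0 = 0"
    by (simp add: g1_def)
  ultimately show ?thesis
    by (simp add: algebra_simps)
qed

text \<open>The factor \<open>norm (g1 \<mu> x)\<close> is deliberately left pointwise: its supremum
  need not be small, but a further application of \<open>K\<close> integrates it against
  \<open>\<sigma>2\<close>.\<close>

lemma norm_K_le_g1:
  assumes "- r \<le> Im \<mu>" "continuous_on {0..1} f" "0 \<le> B" "\<And>x. x \<in> {0..1} \<Longrightarrow> norm (f x) \<le> B" "x \<in> {0..1}"
  shows "norm (K \<mu> f x) \<le> \<kappa> * (N * B) * norm (g1 \<mu> x) + B * I2 (g1 \<mu>)"
proof -
  have gf: "(\<lambda>s. g1 \<mu> s * f s * \<sigma>2 s) absolutely_integrable_on {0..1}"
    by (intro absolutely_integrable_continuous_mult \<sigma>2 continuous_intros continuous_g1 assms)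
  have "norm (integral {0..x} (\<lambda>s. g1 \<mu> s * f s * \<sigma>2 s)) \<le>
      integral {0..1} (\<lambda>s. B * (norm (g1 \<mu> s) * norm (\<sigma>2 s)))"
  proof (rule norm_integral_le_01)
    show "(\<lambda>s. g1 \<mu> s * f s * \<sigma>2 s) integrable_on {0..x}"
      using gf assms by (auto intro: absolutely_integrable_on_subinterval_real(2))
    show "(\<lambda>s. B * (norm (g1 \<mu> s) * norm (\<sigma>2 s))) absolutely_integrable_on {0..1}"
      using I_integrable(2)[OF continuous_g1] by (intro set_integrable_mult_right)
    show "norm (g1 \<mu> s * f s * \<sigma>2 s) \<le> B * (norm (g1 \<mu> s) * norm (\<sigma>2 s))" if "s \<in> {0..x}" for s
      using mult_left_mono[OF assms(4)[of s], of "norm (g1 \<mu> s) * norm (\<sigma>2 s)"] that assms(5)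
      by (simp add: norm_mult algebra_simps)
  qed (use assms in auto)
  then have "norm (integral {0..x} (\<lambda>s. g1 \<mu> s * f s * \<sigma>2 s)) \<le> B * I2 (g1 \<mu>)"
    by (simp add: I2_def)
  moreover have "norm (g1 \<mu> x * V \<mu> f x) \<le> norm (g1 \<mu> x) * (\<kappa> * (N * B))"
  proof -
    have "norm (V \<mu> f x) \<le> \<kappa> * I2 f"
      using assms by (intro norm_V_le)
    also have "\<dots> \<le> \<kappa> * (N * B)"
      using assms \<kappa>_ge_1 I_le_const[of f B] by (intro mult_left_mono) auto
    finally show ?thesis
      by (simp add: norm_mult mult_left_mono)
  qed
  ultimately show ?thesis
    unfolding K_by_parts[OF assms(2,5)]
    using norm_triangle_ineq[of "g1 \<mu> x * V \<mu> f x" "integral {0..x} (\<lambda>s. g1 \<mu> s * f s * \<sigma>2 s)"]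
    by (simp add: mult.commute)
qed

text \<open>The outer \<open>K\<close> sees its argument only through \<open>I2\<close>, so the
  pointwise bound of the inner one turns into a multiple of \<open>I2 (g1 \<mu>)\<close>.\<close>

lemma norm_K_K_le:
  assumes "- r \<le> Im \<mu>" "continuous_on {0..1} f" "0 \<le> B" "\<And>x. x \<in> {0..1} \<Longrightarrow> norm (f x) \<le> B" "x \<in> {0..1}"
  shows "norm (K \<mu> (K \<mu> f) x) \<le> 2 * \<kappa>\<^sup>2 * N\<^sup>2 * I2 (g1 \<mu>) * B"
proof -
  have "I2 (K \<mu> f) \<le> \<kappa> * (N * B) * I2 (g1 \<mu>) + N * (B * I2 (g1 \<mu>))"
    using assms I_nonneg by (intro I_le continuous_K continuous_g1 norm_K_le_g1) auto
  \<comment> \<open>Both summands are brought to the larger factor \<open>\<kappa>\<close>, using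
    that \<open>\<kappa>\<close> is at least 1; this is the origin of the factor 2.\<close>
  also have "\<dots> \<le> \<kappa> * (N * B) * I2 (g1 \<mu>) + \<kappa> * (N * B) * I2 (g1 \<mu>)"
    using mult_right_mono[OF \<kappa>_ge_1, of "N * B * I2 (g1 \<mu>)"] N_nonneg I_nonneg assms(3)
    by (simp add: algebra_simps)
  finally have "I2 (K \<mu> f) \<le> 2 * (\<kappa> * (N * B) * I2 (g1 \<mu>))"
    by linarith
  then have "N * (\<kappa> * I2 (K \<mu> f)) \<le> N * (\<kappa> * (2 * (\<kappa> * (N * B) * I2 (g1 \<mu>))))"
    using N_nonneg \<kappa>_ge_1 by (intro mult_left_mono) auto
  then show ?thesis
    using norm_K_le[OF assms(1) continuous_K[OF assms(2)] assms(5), of \<mu>]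
    by (simp add: power2_eq_square algebra_simps)
qed

section \<open>Linearity of the operators and dependence on values in the unit interval only\<close>

lemma V_diff:
  assumes "continuous_on {0..1} f" "continuous_on {0..1} g" "x \<in> {0..1}"
  shows "V \<mu> (\<lambda>x. f x - g x) x = V \<mu> f x - V \<mu> g x"
  unfolding V_def right_diff_distrib using assms
  by (intro Henstock_Kurzweil_Integration.integral_diff absolutely_integrable_on_subinterval_real(2)[OF integrable_V]) auto

lemma V_cmult: "V \<mu> (\<lambda>x. c * f x) x = c * V \<mu> f x"
  unfolding V_def integral_mult_right[symmetric] by (intro integral_cong) (simp add: ac_simps)

lemma V_cong: "(\<And>y. y \<in> {0..1} \<Longrightarrow> f y = g y) \<Longrightarrow> x \<in> {0..1} \<Longrightarrow> V \<mu> f x = V \<mu> g x"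
  unfolding V_def by (intro integral_cong) auto

lemma K_diff:
  assumes "continuous_on {0..1} f" "continuous_on {0..1} g" "x \<in> {0..1}"
  shows "K \<mu> (\<lambda>x. f x - g x) x = K \<mu> f x - K \<mu> g x"
proof -
  have "K \<mu> (\<lambda>x. f x - g x) x = integral {0..x} (\<lambda>t. \<sigma>1 t * V \<mu> f t - \<sigma>1 t * V \<mu> g t)"
    unfolding K_def using assms by (intro integral_cong) (auto simp: V_diff right_diff_distrib)
  also have "\<dots> = K \<mu> f x - K \<mu> g x"
    unfolding K_def using assms(3)
    by (intro Henstock_Kurzweil_Integration.integral_diff
        absolutely_integrable_on_subinterval_real(2)[OF primitive01_imp_integrable[OF primitive01_K]] assms) auto
  finally show ?thesis .
qed

lemma K_cmult: "K \<mu> (\<lambda>x. c * f x) x = c * K \<mu> f x"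
  unfolding K_def V_cmult integral_mult_right[symmetric] by (intro integral_cong) (simp add: ac_simps)

lemma K_cong: "(\<And>y. y \<in> {0..1} \<Longrightarrow> f y = g y) \<Longrightarrow> x \<in> {0..1} \<Longrightarrow> K \<mu> f x = K \<mu> g x"
  unfolding K_def by (intro integral_cong arg_cong2[where f = "(*)"] V_cong) auto

end

section \<open>Inverting the integral equation\<close>

lemma abs_cont_on_continuous:
  assumes "abs_cont_on a b F"
  shows "continuous_on {a..b} F"
  unfolding continuous_on_iff
proof (intro ballI allI impI)
  fix x e :: real assume x: "x \<in> {a..b}" and "e > 0"
  obtain \<delta> where "\<delta> > 0" and \<delta>: "\<And>I. \<lbrakk>finite I; \<And>u v. (u, v) \<in> I \<Longrightarrow> a \<le> u \<and> u \<le> v \<and> v \<le> b;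
       disjoint_family_on (\<lambda>(u, v). {u<..<v}) I; (\<Sum>(u, v)\<in>I. v - u) < \<delta>\<rbrakk>
      \<Longrightarrow> (\<Sum>(u, v)\<in>I. norm (F v - F u)) < e"
    using abs_cont_onE[OF assms \<open>e > 0\<close>] by blast
  have "dist (F y) (F x) < e" if "y \<in> {a..b}" "dist y x < \<delta>" for y
  proof -
    have "(\<Sum>(u, v)\<in>{(min x y, max x y)}. norm (F v - F u)) < e"
    proof (rule \<delta>)
      show "disjoint_family_on (\<lambda>(u, v). {u<..<v}) {(min x y, max x y)}"
        by (simp add: disjoint_family_on_def)
      show "(\<Sum>(u, v)\<in>{(min x y, max x y)}. v - u) < \<delta>"
        using that by (auto simp: dist_real_def max_def min_def)
    qed (use x that in auto)
    then show ?thesis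
      by (cases "x \<le> y") (simp_all add: dist_norm norm_minus_commute)
  qed
  then show "\<exists>d>0. \<forall>y\<in>{a..b}. dist y x < d \<longrightarrow> dist (F y) (F x) < e"
    using \<open>\<delta> > 0\<close> by blast
qed

lemma primitive01_diff:
  assumes F: "primitive01 f F" and G: "primitive01 g G"
  shows "primitive01 (\<lambda>x. f x - g x) (\<lambda>x. F x - G x)"
  unfolding primitive01_def
proof (intro conjI ballI)
  note f = primitive01_imp_integrable[OF F] and g = primitive01_imp_integrable[OF G]
  show "(\<lambda>x. f x - g x) absolutely_integrable_on {0..1}"
    using f g by (rule set_integral_diff)
  fix x :: real assume x: "x \<in> {0..1}"
  have "integral {0..x} (\<lambda>x. f x - g x) = integral {0..x} f - integral {0..x} g"
    using x absolutely_integrable_on_subinterval_real(2)[OF f] absolutely_integrable_on_subinterval_real(2)[OF g]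
    by (intro Henstock_Kurzweil_Integration.integral_diff) auto
  also have "\<dots> = (F x - F 0) - (G x - G 0)"
    using primitive01D[OF F x] primitive01D[OF G x] by (metis add_diff_cancel_left')
  finally show "F x - G x = F 0 - G 0 + integral {0..x} (\<lambda>x. f x - g x)"
    by simp
qed

lemma primitive01_const: "primitive01 (\<lambda>_. 0) (\<lambda>_. c)"
  by (simp add: primitive01_def set_integrable_def)

text \<open>Trades the equations almost everywhere for integrated ones. The forward direction needs
  integrable right-hand sides; these are sums of continuous functions and products of a continuous
  function with a potential.\<close>

lemma Dirac_solution_iff_primitive01:
  assumes \<sigma>: "\<sigma>1 absolutely_integrable_on {0..1}" "\<sigma>2 absolutely_integrable_on {0..1}"
  shows "Dirac_solution \<sigma>1 \<sigma>2 \<mu> y1 y2 \<longleftrightarrow>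
    primitive01 (\<lambda>x. \<i> * \<mu> * y1 x - \<sigma>1 x * y2 x) y1 \<and>
    primitive01 (\<lambda>x. - \<i> * \<mu> * y2 x - \<sigma>2 x * y1 x) y2"
    (is "?L \<longleftrightarrow> primitive01 ?d1 y1 \<and> primitive01 ?d2 y2")
proof
  assume ?L
  then have ac: "abs_cont_on 0 1 y1" "abs_cont_on 0 1 y2"
    and ae: "AE x in lebesgue_on {0..1}. \<exists>d1 d2.
        (y1 has_vector_derivative d1) (at x within {0..1}) \<and>
        (y2 has_vector_derivative d2) (at x within {0..1}) \<and>
        d1 + \<sigma>1 x * y2 x = \<i> * \<mu> * y1 x \<and> d2 + \<sigma>2 x * y1 x = - \<i> * \<mu> * y2 x"
    by (auto simp: Dirac_solution_def)
  obtain N where N: "negligible N" "\<forall>x\<in>{0..1} - N. \<exists>d1 d2.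
        (y1 has_vector_derivative d1) (at x within {0..1}) \<and>
        (y2 has_vector_derivative d2) (at x within {0..1}) \<and>
        d1 + \<sigma>1 x * y2 x = \<i> * \<mu> * y1 x \<and> d2 + \<sigma>2 x * y1 x = - \<i> * \<mu> * y2 x"
    using ae by (subst (asm) AE_lebesgue_on_iff_negligible) auto
  have der: "(y1 has_vector_derivative ?d1 x) (at x within {0..1})"
    "(y2 has_vector_derivative ?d2 x) (at x within {0..1})" if "x \<in> {0..1} - N" for x
    using N(2) that by (metis add_diff_cancel_right')+
  have cont: "continuous_on {0..1} y1" "continuous_on {0..1} y2"
    using ac by (auto intro: abs_cont_on_continuous)
  have "(\<lambda>x. c * f x - g x * s x) absolutely_integrable_on {0..1}"
    if "continuous_on {0..1} f" "continuous_on {0..1} g" "s absolutely_integrable_on {0..1}"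
    for c and f g s :: "real \<Rightarrow> complex"
  proof (rule set_integral_diff(1))
    show "(\<lambda>x. c * f x) absolutely_integrable_on {0..1}"
      using that by (intro absolutely_integrable_continuous_real continuous_intros)
    show "(\<lambda>x. g x * s x) absolutely_integrable_on {0..1}"
      using that by (intro absolutely_integrable_continuous_mult)
  qed
  from this[OF cont \<sigma>(1), of "\<i> * \<mu>"] this[OF cont(2,1) \<sigma>(2), of "- \<i> * \<mu>"]
  have "?d1 absolutely_integrable_on {0..1}" "?d2 absolutely_integrable_on {0..1}"
    by (simp_all add: mult.commute)
  then show "primitive01 ?d1 y1 \<and> primitive01 ?d2 y2"
    using ac N(1) der by (intro conjI abs_cont_imp_primitive01[where N = N])
next
  assume R: "primitive01 ?d1 y1 \<and> primitive01 ?d2 y2"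
  obtain A where A: "negligible A"
    "\<And>x. x \<in> {0..1} - A \<Longrightarrow> (y1 has_vector_derivative ?d1 x) (at x within {0..1})"
    using primitive01_derivative_ae R by blast
  obtain B where B: "negligible B"
    "\<And>x. x \<in> {0..1} - B \<Longrightarrow> (y2 has_vector_derivative ?d2 x) (at x within {0..1})"
    using primitive01_derivative_ae R by blast
  have "AE x in lebesgue_on {0..1}. \<exists>d1 d2.
        (y1 has_vector_derivative d1) (at x within {0..1}) \<and>
        (y2 has_vector_derivative d2) (at x within {0..1}) \<and>
        d1 + \<sigma>1 x * y2 x = \<i> * \<mu> * y1 x \<and> d2 + \<sigma>2 x * y1 x = - \<i> * \<mu> * y2 x"
  proof (subst AE_lebesgue_on_iff_negligible, simp, intro exI[of _ "A \<union> B"] conjI ballI)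
    fix x assume "x \<in> {0..1} - (A \<union> B)"
    then show "\<exists>d1 d2. (y1 has_vector_derivative d1) (at x within {0..1}) \<and>
        (y2 has_vector_derivative d2) (at x within {0..1}) \<and>
        d1 + \<sigma>1 x * y2 x = \<i> * \<mu> * y1 x \<and> d2 + \<sigma>2 x * y1 x = - \<i> * \<mu> * y2 x"
      using A(2)[of x] B(2)[of x] by (intro exI[of _ "?d1 x"] exI[of _ "?d2 x"]) auto
  qed (use A B in auto)
  then show ?L
    using R by (auto simp: Dirac_solution_def intro: primitive01_abs_cont)
qed

section \<open>Invertibility of \<open>1 + K\<close> and the boundary value problem\<close>

context dirac_potential
begin

text \<open>The threshold is chosen so that the constant in \<open>norm_K_K_le\<close> is at most
  1/2.\<close>

definition admissible :: "complex \<Rightarrow> bool" where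
  "admissible \<mu> \<longleftrightarrow> - r \<le> Im \<mu> \<and> 4 * \<kappa>\<^sup>2 * N\<^sup>2 * I2 (g1 \<mu>) \<le> 1"

text \<open>Bound for the inverse of \<open>1 + K\<close>: the norm of \<open>1 - K\<close> is at
  most \<open>1 + N * (\<kappa> * N)\<close>, and absorbing the squared operator costs the factor 2.
  It does not depend on the spectral parameter.\<close>

definition L :: real where "L = 2 * (1 + N * (\<kappa> * N))"

lemma L_pos: "0 < L"
  using N_nonneg \<kappa>_ge_1 by (auto simp: L_def intro!: add_pos_nonneg)

lemma norm_K_le_sup:
  assumes "- r \<le> Im \<mu>" "continuous_on {0..1} f" "0 \<le> B" "\<And>x. x \<in> {0..1} \<Longrightarrow> norm (f x) \<le> B" "x \<in> {0..1}"
  shows "norm (K \<mu> f x) \<le> N * (\<kappa> * N) * B"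
proof -
  have "N * (\<kappa> * I2 f) \<le> N * (\<kappa> * (N * B))"
    using assms N_nonneg \<kappa>_ge_1 by (intro mult_left_mono I_le_const) auto
  then show ?thesis
    using norm_K_le[OF assms(1,2,5)] by (simp add: mult.assoc)
qed

lemma norm_V_le_sup:
  assumes "- r \<le> Im \<mu>" "continuous_on {0..1} f" "0 \<le> B" "\<And>x. x \<in> {0..1} \<Longrightarrow> norm (f x) \<le> B" "x \<in> {0..1}"
  shows "norm (V \<mu> f x) \<le> \<kappa> * N * B"
proof -
  have "\<kappa> * I2 f \<le> \<kappa> * (N * B)"
    using assms N_nonneg \<kappa>_ge_1 by (intro mult_left_mono I_le_const) auto
  then show ?thesis
    using norm_V_le[OF assms(1,2,5)] by (simp add: mult.assoc)
qed

lemma norm_K_K_le_half: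
  assumes "admissible \<mu>" "continuous_on {0..1} f" "\<And>x. x \<in> {0..1} \<Longrightarrow> norm (f x) \<le> B" "x \<in> {0..1}"
  shows "norm (K \<mu> (K \<mu> f) x) \<le> B / 2"
proof -
  have "0 \<le> B"
    using assms(3)[OF assms(4)] by (meson norm_ge_zero order_trans)
  then have "norm (K \<mu> (K \<mu> f) x) \<le> 2 * \<kappa>\<^sup>2 * N\<^sup>2 * I2 (g1 \<mu>) * B"
    using assms by (intro norm_K_K_le) (auto simp: admissible_def)
  also have "\<dots> \<le> 1 / 2 * B"
    using assms(1) \<open>0 \<le> B\<close> by (intro mult_right_mono) (auto simp: admissible_def)
  finally show ?thesis by simp
qed

text \<open>The iterated equation is evaluated at a point where \<open>norm (u y)\<close> is
  maximal, so the contribution of \<open>K (K u)\<close> is at most half of the left-hand side. With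
  \<open>B = 0\<close> this is uniqueness.\<close>

lemma K_stability:
  assumes \<mu>: "admissible \<mu>" and u: "continuous_on {0..1} u" and f: "continuous_on {0..1} f"
    and eq: "\<And>x. x \<in> {0..1} \<Longrightarrow> u x + K \<mu> u x = f x"
    and B: "\<And>x. x \<in> {0..1} \<Longrightarrow> norm (f x) \<le> B" and x: "x \<in> {0..1}"
  shows "norm (u x) \<le> L * B"
proof -
  have "0 \<le> B"
    using B[OF x] by (meson norm_ge_zero order_trans)
  obtain y where y: "y \<in> {0..1}" and max: "\<And>x. x \<in> {0..1} \<Longrightarrow> norm (u x) \<le> norm (u y)"
    using continuous_attains_sup[of "{0..1}" "\<lambda>x. norm (u x)"] continuous_on_norm[OF u] by auto
  have "K \<mu> u y = K \<mu> (\<lambda>x. f x - K \<mu> u x) y"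
    using y eq by (intro K_cong) (auto simp: algebra_simps)
  also have "\<dots> = K \<mu> f y - K \<mu> (K \<mu> u) y"
    using u f y by (intro K_diff continuous_K)
  finally have "u y = f y - K \<mu> f y + K \<mu> (K \<mu> u) y"
    using eq[OF y] by algebra
  then have "norm (u y) \<le> norm (f y) + norm (K \<mu> f y) + norm (K \<mu> (K \<mu> u) y)"
    using norm_triangle_ineq[of "f y - K \<mu> f y" "K \<mu> (K \<mu> u) y"]
      norm_triangle_ineq4[of "f y" "K \<mu> f y"] by simp
  also have "\<dots> \<le> B + N * (\<kappa> * N) * B + norm (u y) / 2"
    using B y \<mu> u f max \<open>0 \<le> B\<close>
    by (intro add_mono norm_K_le_sup norm_K_K_le_half) (auto simp: admissible_def)
  finally have "norm (u y) \<le> L * B"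
    by (simp add: L_def algebra_simps)
  then show ?thesis
    using max[OF x] by simp
qed

text \<open>The fixed point \<open>u\<close> of \<open>u = f - K f + K (K u)\<close> need not solve
  \<open>u + K u = f\<close> at once. Its defect \<open>d = u + K u - f\<close> satisfies
  \<open>K d = d\<close>, hence \<open>K (K d) = d\<close>, and halving by the squared operator
  forces \<open>d = 0\<close>.\<close>

lemma K_solution_exists:
  assumes \<mu>: "admissible \<mu>" and f: "continuous_on {0..1} f"
  shows "\<exists>u. continuous_on {0..1} u \<and> (\<forall>x\<in>{0..1}. u x + K \<mu> u x = f x)"
proof -
  obtain u where u: "continuous_on {0..1} u"
    and fixp: "\<And>x. x \<in> {0..1} \<Longrightarrow> f x - K \<mu> f x + K \<mu> (K \<mu> u) x = u x"
  proof (rule contraction_fixpoint_C01[of "\<lambda>u x. f x - K \<mu> f x + K \<mu> (K \<mu> u) x"])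
    show "continuous_on {0..1} (\<lambda>x. f x - K \<mu> f x + K \<mu> (K \<mu> u) x)" if "continuous_on {0..1} u" for u
      using f that by (intro continuous_intros continuous_K)
    fix u v :: "real \<Rightarrow> complex" and B x :: real
    assume uv: "continuous_on {0..1} u" "continuous_on {0..1} v"
      "\<And>y. y \<in> {0..1} \<Longrightarrow> norm (u y - v y) \<le> B" and x: "x \<in> {0..1}"
    have "K \<mu> (K \<mu> (\<lambda>x. u x - v x)) x = K \<mu> (\<lambda>x. K \<mu> u x - K \<mu> v x) x"
      using uv x by (intro K_cong K_diff)
    also have "\<dots> = K \<mu> (K \<mu> u) x - K \<mu> (K \<mu> v) x"
      using uv x by (intro K_diff continuous_K)
    finally have "f x - K \<mu> f x + K \<mu> (K \<mu> u) x - (f x - K \<mu> f x + K \<mu> (K \<mu> v) x) =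
        K \<mu> (K \<mu> (\<lambda>x. u x - v x)) x"
      by simp
    then show "norm (f x - K \<mu> f x + K \<mu> (K \<mu> u) x - (f x - K \<mu> f x + K \<mu> (K \<mu> v) x)) \<le> B / 2"
      using norm_K_K_le_half[OF \<mu> continuous_on_diff[OF uv(1,2)] uv(3) x] by simp
  qed blast
  define d where "d x = u x - (f x - K \<mu> u x)" for x
  have fKu: "continuous_on {0..1} (\<lambda>x. f x - K \<mu> u x)"
    using f u by (intro continuous_intros continuous_K)
  have d: "continuous_on {0..1} d"
    unfolding d_def using f u by (intro continuous_intros continuous_K)
  have Kd: "K \<mu> d x = K \<mu> u x - K \<mu> f x + K \<mu> (K \<mu> u) x" if "x \<in> {0..1}" for x
    using that f u fKu by (simp add: d_def[abs_def] K_diff continuous_K)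
  have Kd': "K \<mu> d x = d x" if "x \<in> {0..1}" for x
    unfolding Kd[OF that] d_def fixp[OF that, symmetric] by simp
  have KKd: "K \<mu> (K \<mu> d) x = d x" if "x \<in> {0..1}" for x
    using Kd' that K_cong[of "K \<mu> d" d x \<mu>] by simp
  obtain y where y: "y \<in> {0..1}" and max: "\<And>x. x \<in> {0..1} \<Longrightarrow> norm (d x) \<le> norm (d y)"
    using continuous_attains_sup[of "{0..1}" "\<lambda>x. norm (d x)"] continuous_on_norm[OF d] by auto
  have "norm (d y) \<le> norm (d y) / 2"
    using norm_K_K_le_half[OF \<mu> d max y] KKd[OF y] by simp
  then have "d x = 0" if "x \<in> {0..1}" for x
    using max[OF that] by simp
  then show ?thesis
    using u by (intro exI[of _ u]) (auto simp: d_def algebra_simps)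
qed

text \<open>The choice determines \<open>Z \<mu>\<close> on the unit interval only, and only for
  admissible parameters; elsewhere its values are arbitrary.\<close>

definition Z :: "complex \<Rightarrow> real \<Rightarrow> complex" where
  "Z \<mu> = (SOME u. continuous_on {0..1} u \<and> (\<forall>x\<in>{0..1}. u x + K \<mu> u x = 1))"

definition W1 :: "complex \<Rightarrow> real \<Rightarrow> complex" where
  "W1 \<mu> x = exp (\<i> * \<mu> * of_real x) * Z \<mu> x"

definition W2 :: "complex \<Rightarrow> real \<Rightarrow> complex" where
  "W2 \<mu> x = exp (\<i> * \<mu> * of_real x) * V \<mu> (Z \<mu>) x"

lemma Z:
  assumes "admissible \<mu>"
  shows continuous_Z: "continuous_on {0..1} (Z \<mu>)"
    and Z_eq: "x \<in> {0..1} \<Longrightarrow> Z \<mu> x + K \<mu> (Z \<mu>) x = 1"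
  using someI_ex[OF K_solution_exists[OF assms, of "\<lambda>_. 1"]] by (auto simp: Z_def)

lemma norm_Z_le:
  assumes "admissible \<mu>" "x \<in> {0..1}"
  shows "norm (Z \<mu> x) \<le> L"
  using K_stability[OF assms(1) continuous_Z[OF assms(1)], of "\<lambda>_. 1" 1 x] Z_eq assms by simp

lemma W_solution:
  assumes \<mu>: "admissible \<mu>"
  shows "Dirac_solution \<sigma>1 \<sigma>2 \<mu> (W1 \<mu>) (W2 \<mu>)" "W1 \<mu> 0 = 1" "W2 \<mu> 1 = 0"
proof -
  let ?E = "\<lambda>x. exp (\<i> * \<mu> * of_real x)"
  have Z: "primitive01 (\<lambda>t. - (\<sigma>1 t * V \<mu> (Z \<mu>) t)) (Z \<mu>)"
    by (rule primitive01_cong[OF primitive01_diff[OF primitive01_const[of 1] primitive01_K[OF continuous_Z[OF \<mu>]]]])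
      (use Z_eq[OF \<mu>] in \<open>auto simp: algebra_simps\<close>)
  have "primitive01 (\<lambda>x. \<i> * \<mu> * W1 \<mu> x - \<sigma>1 x * W2 \<mu> x) (W1 \<mu>)"
    by (rule primitive01_cong[OF primitive01_mult[OF primitive01_exp[of "\<i> * \<mu>"] Z]])
      (auto simp: W1_def W2_def algebra_simps)
  moreover have "primitive01 (\<lambda>x. - \<i> * \<mu> * W2 \<mu> x - \<sigma>2 x * W1 \<mu> x) (W2 \<mu>)"
    by (rule primitive01_cong[OF primitive01_mult[OF primitive01_exp[of "\<i> * \<mu>"] primitive01_V[OF continuous_Z[OF \<mu>]]]])
      (auto simp: W1_def W2_def algebra_simps)
  ultimately show "Dirac_solution \<sigma>1 \<sigma>2 \<mu> (W1 \<mu>) (W2 \<mu>)"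
    using Dirac_solution_iff_primitive01[OF \<sigma>1 \<sigma>2] by blast
  show "W1 \<mu> 0 = 1" "W2 \<mu> 1 = 0"
    using Z_eq[OF \<mu>, of 0] by (auto simp: W1_def W2_def)
qed

text \<open>Undoing the exponential substitution in an arbitrary solution leads back to the integral
  equation, where \<open>K_stability\<close> with zero right-hand side decides.\<close>

lemma W_unique:
  assumes \<mu>: "admissible \<mu>" and y: "Dirac_solution \<sigma>1 \<sigma>2 \<mu> y1 y2" "y1 0 = 1" "y2 1 = 0"
    and x: "x \<in> {0..1}"
  shows "y1 x = W1 \<mu> x" "y2 x = W2 \<mu> x"
proof -
  have prim: "primitive01 (\<lambda>x. \<i> * \<mu> * y1 x - \<sigma>1 x * y2 x) y1"
    "primitive01 (\<lambda>x. - \<i> * \<mu> * y2 x - \<sigma>2 x * y1 x) y2"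
    using y(1) Dirac_solution_iff_primitive01[OF \<sigma>1 \<sigma>2] by blast+
  define z where "z x = exp (- (\<i> * \<mu>) * of_real x) * y1 x" for x
  define v where "v x = exp (- (\<i> * \<mu>) * of_real x) * y2 x" for x
  have z: "primitive01 (\<lambda>x. - (\<sigma>1 x * v x)) z"
    by (rule primitive01_cong[OF primitive01_mult[OF primitive01_exp[of "- (\<i> * \<mu>)"] prim(1)]])
      (auto simp: z_def v_def algebra_simps)
  have v: "primitive01 (\<lambda>x. - (2 * \<i> * \<mu>) * v x - \<sigma>2 x * z x) v"
    by (rule primitive01_cong[OF primitive01_mult[OF primitive01_exp[of "- (\<i> * \<mu>)"] prim(2)]])
      (auto simp: z_def v_def algebra_simps)
  note cz = primitive01_continuous[OF z]
  \<comment> \<open>The difference \<open>v - V \<mu> z\<close> solves the homogeneous equation, so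
    with its integrating factor it is constant; the condition at 1 makes it zero.\<close>
  have "primitive01 (\<lambda>_. 0) (\<lambda>x. exp (2 * \<i> * \<mu> * of_real x) * (v x - V \<mu> z x))"
    by (rule primitive01_cong[OF primitive01_mult[OF primitive01_exp[of "2 * \<i> * \<mu>"]
            primitive01_diff[OF v primitive01_V[OF cz]]]])
      (auto simp: algebra_simps)
  from primitive01_integral[OF this, of _ 1] have vV: "v t = V \<mu> z t" if "t \<in> {0..1}" for t
    using that y(3) by (auto simp: v_def)
  have zK: "z t + K \<mu> z t = 1" if t: "t \<in> {0..1}" for t
  proof -
    have "integral {0..t} (\<lambda>x. - (\<sigma>1 x * v x)) = integral {0..t} (\<lambda>x. - (\<sigma>1 x * V \<mu> z x))"
      using t by (intro integral_cong) (simp add: vV)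
    then have "z t = z 0 - K \<mu> z t"
      using primitive01D[OF z t] by (simp add: K_def)
    then show ?thesis
      using y(2) by (simp add: z_def)
  qed
  have zZ: "z t = Z \<mu> t" if t: "t \<in> {0..1}" for t
  proof -
    have "norm (z t - Z \<mu> t) \<le> L * 0"
    proof (rule K_stability[OF \<mu> _ _ _ _ t, of "\<lambda>t. z t - Z \<mu> t" "\<lambda>_. 0"])
      show "z x - Z \<mu> x + K \<mu> (\<lambda>t. z t - Z \<mu> t) x = 0" if "x \<in> {0..1}" for x
        unfolding K_diff[OF cz continuous_Z[OF \<mu>] that] using zK[OF that] Z_eq[OF \<mu> that]
        by algebra
    qed (use cz continuous_Z[OF \<mu>] in \<open>auto intro: continuous_intros\<close>)
    then show ?thesis by simp
  qed
  have E: "exp (\<i> * \<mu> * of_real x) * exp (- (\<i> * \<mu>) * of_real x) = 1"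
    unfolding exp_add[symmetric] by simp
  have "y1 x = exp (\<i> * \<mu> * of_real x) * z x" "y2 x = exp (\<i> * \<mu> * of_real x) * v x"
    unfolding z_def v_def mult.assoc[symmetric] E by simp_all
  moreover have "V \<mu> z x = V \<mu> (Z \<mu>) x"
    using zZ x by (intro V_cong)
  ultimately show "y1 x = W1 \<mu> x" "y2 x = W2 \<mu> x"
    using vV[OF x] zZ[OF x] by (simp_all add: W1_def W2_def)
qed

section \<open>Bounds for the remainders by weighted integrals of \<open>g2\<close>\<close>

definition \<Gamma>2 :: "complex \<Rightarrow> real" where
  "\<Gamma>2 \<mu> = integral {0..1} (\<lambda>s. norm (\<sigma>1 s) * (norm (g2 \<mu> s))\<^sup>2)"

lemma integrable_\<Gamma>2: "(\<lambda>s. norm (\<sigma>1 s) * (norm (g2 \<mu> s))\<^sup>2) absolutely_integrable_on {0..1}"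
proof -
  have "(\<lambda>s. (norm (g2 \<mu> s))\<^sup>2 * norm (\<sigma>1 s)) absolutely_integrable_on {0..1}"
    by (intro absolutely_integrable_continuous_mult norm_\<sigma> continuous_intros continuous_g2)
  then show ?thesis
    by (simp add: mult.commute)
qed

text \<open>
  Cauchy--Schwarz by completing the square; \<open>N + 1\<close> in place of the \<open>L\<^sup>1\<close> norm of \<open>\<sigma>1\<close>
  avoids the division by zero for the zero potential.
\<close>

lemma I1_g2_square_le: "(I1 (g2 \<mu>))\<^sup>2 \<le> (N + 1) * \<Gamma>2 \<mu>"
proof -
  define A where "A = I1 (g2 \<mu>)"
  \<comment> \<open>The minimiser of
    \<open>\<Gamma>2 \<mu> - 2 * l * A + l\<^sup>2 * (N + 1)\<close> in \<open>l\<close>.\<close>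
  define l where "l = A / (N + 1)"
  note int1 = I_integrable(1)[OF continuous_g2, of \<mu>, THEN set_lebesgue_integral_eq_integral(1)]
  note int2 = integrable_\<Gamma>2[of \<mu>, THEN set_lebesgue_integral_eq_integral(1)]
  note int3 = norm_\<sigma>(1)[THEN set_lebesgue_integral_eq_integral(1)]
  have "0 \<le> integral {0..1} (\<lambda>s. norm (\<sigma>1 s) * (norm (g2 \<mu> s))\<^sup>2 - 2 * l * (norm (g2 \<mu> s) * norm (\<sigma>1 s))
      + l\<^sup>2 * norm (\<sigma>1 s))"
  proof (rule Henstock_Kurzweil_Integration.integral_nonneg)
    show "(\<lambda>s. norm (\<sigma>1 s) * (norm (g2 \<mu> s))\<^sup>2 - 2 * l * (norm (g2 \<mu> s) * norm (\<sigma>1 s))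
      + l\<^sup>2 * norm (\<sigma>1 s)) integrable_on {0..1}"
      using int1 int2 int3 by (intro integrable_add integrable_diff integrable_on_mult_right)
    show "0 \<le> norm (\<sigma>1 s) * (norm (g2 \<mu> s))\<^sup>2 - 2 * l * (norm (g2 \<mu> s) * norm (\<sigma>1 s))
      + l\<^sup>2 * norm (\<sigma>1 s)" for s
    proof -
      have "0 \<le> norm (\<sigma>1 s) * (norm (g2 \<mu> s) - l)\<^sup>2"
        by simp
      then show ?thesis
        by (simp add: power2_diff algebra_simps)
    qed
  qed
  also have "\<dots> = \<Gamma>2 \<mu> - 2 * l * A + l\<^sup>2 * integral {0..1} (\<lambda>s. norm (\<sigma>1 s))"
    unfolding \<Gamma>2_def A_def I1_def using int1 int2 int3
    by (simp add: Henstock_Kurzweil_Integration.integral_add Henstock_Kurzweil_Integration.integral_diff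
        integrable_add integrable_diff integrable_on_mult_right)
  also have "\<dots> \<le> \<Gamma>2 \<mu> - 2 * l * A + l\<^sup>2 * (N + 1)"
    using N1 by (intro add_left_mono mult_left_mono) auto
  also have "\<dots> = \<Gamma>2 \<mu> - A\<^sup>2 / (N + 1)"
  proof -
    have "l * (N + 1) = A"
      using N_nonneg by (simp add: l_def)
    then have "l\<^sup>2 * (N + 1) = l * A"
      by (simp add: power2_eq_square mult.assoc)
    moreover have "l * A = A\<^sup>2 / (N + 1)"
      by (simp add: l_def power2_eq_square)
    ultimately show ?thesis
      by simp
  qed
  finally show ?thesis
    using N_nonneg by (simp add: A_def field_simps)
qed

lemma \<Gamma>2_nonneg: "0 \<le> \<Gamma>2 \<mu>"
  unfolding \<Gamma>2_def using integrable_\<Gamma>2[of \<mu>, THEN set_lebesgue_integral_eq_integral(1)]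
  by (intro Henstock_Kurzweil_Integration.integral_nonneg) auto

lemma norm_K_one_le: "x \<in> {0..1} \<Longrightarrow> norm (K \<mu> (\<lambda>_. 1) x) \<le> I1 (g2 \<mu>)"
  unfolding g2_def by (rule norm_K_le_I1) auto

lemma primitive01_K_one: "primitive01 (\<lambda>t. \<sigma>1 t * g2 \<mu> t) (K \<mu> (\<lambda>_. 1))"
  unfolding g2_def by (rule primitive01_K) auto

lemma continuous_K_one: "continuous_on {0..1} (K \<mu> (\<lambda>_. 1))"
  by (intro continuous_K continuous_intros)

lemma primitive01_g2: "primitive01 (\<lambda>x. - (2 * \<i> * \<mu>) * g2 \<mu> x - \<sigma>2 x) (g2 \<mu>)"
  using primitive01_V[of "\<lambda>_. 1" \<mu>] by (simp add: g2_def[symmetric])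

text \<open>With \<open>u = K \<mu> (\<lambda>_. 1)\<close>, both \<open>V u\<close> and
  \<open>g2 * u\<close> have a term \<open>- \<sigma>2 * u\<close> in their derivative. In the
  difference \<open>D\<close> it cancels, leaving \<open>- c * D - \<sigma>1 * g2\<^sup>2\<close>
  with \<open>c = 2 * \<i> * \<mu>\<close>. The factor \<open>exp (c * x)\<close> solves this
  equation, and \<open>D\<close> vanishes at 1.\<close>

lemma V_K_one:
  assumes "- r \<le> Im \<mu>" "x \<in> {0..1}"
  shows "norm (V \<mu> (K \<mu> (\<lambda>_. 1)) x - g2 \<mu> x * K \<mu> (\<lambda>_. 1) x) \<le> \<kappa> * \<Gamma>2 \<mu>"
proof -
  let ?c = "2 * \<i> * \<mu>" and ?u = "K \<mu> (\<lambda>_. 1)"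
  define D where "D t = V \<mu> ?u t - g2 \<mu> t * ?u t" for t
  have D: "primitive01 (\<lambda>t. - ?c * D t - \<sigma>1 t * (g2 \<mu> t)\<^sup>2) D"
    by (rule primitive01_cong[OF primitive01_diff[OF primitive01_V[OF continuous_K_one]
            primitive01_mult[OF primitive01_g2 primitive01_K_one]]])
      (auto simp: D_def algebra_simps power2_eq_square)
  have "primitive01 (\<lambda>t. - (exp (?c * of_real t) * \<sigma>1 t * (g2 \<mu> t)\<^sup>2)) (\<lambda>t. exp (?c * of_real t) * D t)"
    by (rule primitive01_cong[OF primitive01_mult[OF primitive01_exp[of ?c] D]])
      (auto simp: algebra_simps)
  from primitive01_integral[OF this, of x 1]
  have "integral {x..1} (\<lambda>t. - (exp (?c * of_real t) * \<sigma>1 t * (g2 \<mu> t)\<^sup>2)) = - (exp (?c * of_real x) * D x)"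
    using assms(2) by (simp add: D_def g2_def)
  then have "exp (?c * of_real x) * D x = integral {x..1} (\<lambda>t. exp (?c * of_real t) * \<sigma>1 t * (g2 \<mu> t)\<^sup>2)"
    by simp
  moreover have "exp (- ?c * of_real x) * (exp (?c * of_real x) * D x) = D x"
    unfolding mult.assoc[symmetric] exp_add[symmetric] by simp
  ultimately have Dx: "D x = integral {x..1} (\<lambda>t. exp (- ?c * of_real x) * (exp (?c * of_real t) * \<sigma>1 t * (g2 \<mu> t)\<^sup>2))"
    by simp
  have E: "exp (- ?c * of_real x) * (exp (?c * of_real t) * \<sigma>1 t * (g2 \<mu> t)\<^sup>2) =
      exp (?c * of_real (t - x)) * (g2 \<mu> t)\<^sup>2 * \<sigma>1 t" for t
  proof -
    have "exp (?c * of_real (t - x)) = exp (- ?c * of_real x) * exp (?c * of_real t)"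
      unfolding exp_add[symmetric] by (simp add: algebra_simps)
    then show ?thesis by simp
  qed
  have "norm (D x) \<le> integral {0..1} (\<lambda>s. \<kappa> * (norm (\<sigma>1 s) * (norm (g2 \<mu> s))\<^sup>2))"
    unfolding Dx E
  proof (rule norm_integral_le_01)
    have "(\<lambda>t. exp (?c * of_real (t - x)) * (g2 \<mu> t)\<^sup>2 * \<sigma>1 t) absolutely_integrable_on {0..1}"
      by (intro absolutely_integrable_continuous_mult \<sigma>1 continuous_intros continuous_g2)
    then show "(\<lambda>t. exp (?c * of_real (t - x)) * (g2 \<mu> t)\<^sup>2 * \<sigma>1 t) integrable_on {x..1}"
      using assms(2) by (auto intro: absolutely_integrable_on_subinterval_real(2))
    show "(\<lambda>s. \<kappa> * (norm (\<sigma>1 s) * (norm (g2 \<mu> s))\<^sup>2)) absolutely_integrable_on {0..1}"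
      using integrable_\<Gamma>2 by (intro set_integrable_mult_right)
    show "norm (exp (?c * of_real (t - x)) * (g2 \<mu> t)\<^sup>2 * \<sigma>1 t) \<le> \<kappa> * (norm (\<sigma>1 t) * (norm (g2 \<mu> t))\<^sup>2)"
      if "t \<in> {x..1}" for t
      using mult_right_mono[OF norm_exp_kernel_le[OF assms(1) r, of "t - x"],
          of "(norm (g2 \<mu> t))\<^sup>2 * norm (\<sigma>1 t)"] that assms(2)
      by (simp add: norm_mult norm_power \<kappa>_def algebra_simps)
  qed (use assms \<kappa>_ge_1 in auto)
  then show ?thesis
    by (simp add: D_def \<Gamma>2_def)
qed

text \<open>Since \<open>u = K \<mu> (\<lambda>_. 1)\<close> has density
  \<open>\<sigma>1 * g2\<close>, the main part \<open>\<sigma>1 * g2 * u\<close> of the integrand is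
  the derivative of half the square of \<open>u\<close>. That square costs
  \<open>(N + 1) / 2\<close> through Cauchy--Schwarz; the error from \<open>V_K_one\<close>,
  integrated against \<open>\<sigma>1\<close>, costs \<open>N * \<kappa>\<close>.\<close>

lemma norm_K_K_one_le:
  assumes "- r \<le> Im \<mu>" "x \<in> {0..1}"
  shows "norm (K \<mu> (K \<mu> (\<lambda>_. 1)) x) \<le> ((N + 1) / 2 + N * \<kappa>) * \<Gamma>2 \<mu>"
proof -
  let ?u = "K \<mu> (\<lambda>_. 1)"
  define D where "D t = V \<mu> ?u t - g2 \<mu> t * ?u t" for t
  have D: "continuous_on {0..1} D"
    unfolding D_def by (intro continuous_intros continuous_V continuous_g2 continuous_K_one)
  have sq: "primitive01 (\<lambda>t. \<sigma>1 t * (2 * (g2 \<mu> t * ?u t))) (\<lambda>t. ?u t * ?u t)"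
    by (rule primitive01_cong[OF primitive01_mult[OF primitive01_K_one primitive01_K_one]])
      (auto simp: algebra_simps)
  have "(\<lambda>t. D t * \<sigma>1 t) absolutely_integrable_on {0..1}"
    by (intro absolutely_integrable_continuous_mult \<sigma>1 D)
  then have Di: "(\<lambda>t. \<sigma>1 t * D t) integrable_on {0..x}"
    using assms by (auto simp: mult.commute intro: absolutely_integrable_on_subinterval_real(2))
  have sqi: "(\<lambda>t. \<sigma>1 t * (2 * (g2 \<mu> t * ?u t))) integrable_on {0..x}"
    using assms by (auto intro: absolutely_integrable_on_subinterval_real(2)[OF primitive01_imp_integrable[OF sq]])
  have "K \<mu> ?u x = integral {0..x} (\<lambda>t. 1 / 2 * (\<sigma>1 t * (2 * (g2 \<mu> t * ?u t))) + \<sigma>1 t * D t)"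
    unfolding K_def[of \<mu> ?u] by (intro integral_cong) (simp add: D_def algebra_simps)
  also have "\<dots> = 1 / 2 * integral {0..x} (\<lambda>t. \<sigma>1 t * (2 * (g2 \<mu> t * ?u t))) + integral {0..x} (\<lambda>t. \<sigma>1 t * D t)"
    using Di sqi by (subst Henstock_Kurzweil_Integration.integral_add)
      (simp_all only: integrable_on_mult_right integral_mult_right)
  also have "integral {0..x} (\<lambda>t. \<sigma>1 t * (2 * (g2 \<mu> t * ?u t))) = ?u x * ?u x"
    using primitive01_integral[OF sq, of 0 x] assms(2) by simp
  finally have "norm (K \<mu> ?u x) \<le> (norm (?u x))\<^sup>2 / 2 + norm (integral {0..x} (\<lambda>t. \<sigma>1 t * D t))"
    using norm_triangle_ineq[of "1 / 2 * (?u x * ?u x)" "integral {0..x} (\<lambda>t. \<sigma>1 t * D t)"]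
    by (simp add: norm_mult power2_eq_square)
  moreover have "(norm (?u x))\<^sup>2 / 2 \<le> (N + 1) / 2 * \<Gamma>2 \<mu>"
    using power_mono[OF norm_K_one_le[OF assms(2), of \<mu>], of 2] I1_g2_square_le[of \<mu>] by simp
  moreover have "norm (integral {0..x} (\<lambda>t. \<sigma>1 t * D t)) \<le> N * (\<kappa> * \<Gamma>2 \<mu>)"
  proof -
    have "I1 D \<le> N * (\<kappa> * \<Gamma>2 \<mu>)"
      using D V_K_one[OF assms(1)] \<kappa>_ge_1 \<Gamma>2_nonneg by (intro I_le_const) (auto simp: D_def)
    then show ?thesis
      using norm_integral_\<sigma>1_le[OF D assms(2)] by simp
  qed
  ultimately show ?thesis
    unfolding distrib_right[of "(N + 1) / 2"] mult.assoc by linarith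
qed

definition R1 :: "complex \<Rightarrow> real \<Rightarrow> complex" where
  "R1 \<mu> x = Z \<mu> x - (1 - K \<mu> (\<lambda>_. 1) x)"

lemma continuous_R1: "admissible \<mu> \<Longrightarrow> continuous_on {0..1} (R1 \<mu>)"
  unfolding R1_def by (intro continuous_intros continuous_Z continuous_K_one)

text \<open>Applying \<open>1 + K\<close> to the approximation \<open>1 - K 1\<close> gives
  \<open>1 - K (K 1)\<close>, so the remainder solves the same equation with right-hand side
  \<open>K (K 1)\<close>.\<close>

lemma norm_R1_le:
  assumes \<mu>: "admissible \<mu>" and x: "x \<in> {0..1}"
  shows "norm (R1 \<mu> x) \<le> L * (((N + 1) / 2 + N * \<kappa>) * \<Gamma>2 \<mu>)"
proof (rule K_stability[OF \<mu> continuous_R1[OF \<mu>] continuous_K[OF continuous_K_one] _ _ x])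
  have c: "continuous_on {0..1} (\<lambda>x. 1 - K \<mu> (\<lambda>_. 1) x)"
    by (intro continuous_intros continuous_K_one)
  show "R1 \<mu> x + K \<mu> (R1 \<mu>) x = K \<mu> (K \<mu> (\<lambda>_. 1)) x" if x: "x \<in> {0..1}" for x
    using Z_eq[OF \<mu> x] K_diff[OF continuous_Z[OF \<mu>] c x, of \<mu>]
      K_diff[OF continuous_on_const continuous_K_one x, of \<mu> 1 \<mu>]
    by (simp add: R1_def[abs_def] algebra_simps)
qed (use \<mu> norm_K_K_one_le in \<open>auto simp: admissible_def\<close>)

lemma V_Z_eq:
  assumes \<mu>: "admissible \<mu>" and x: "x \<in> {0..1}"
  shows "V \<mu> (Z \<mu>) x = g2 \<mu> x - V \<mu> (K \<mu> (\<lambda>_. 1)) x + V \<mu> (R1 \<mu>) x"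
proof -
  have c: "continuous_on {0..1} (\<lambda>x. 1 - K \<mu> (\<lambda>_. 1) x)"
    by (intro continuous_intros continuous_K_one)
  show ?thesis
    using V_diff[OF continuous_Z[OF \<mu>] c x, of \<mu>]
      V_diff[OF continuous_on_const continuous_K_one x, of \<mu> 1 \<mu>]
    by (simp add: R1_def[abs_def] g2_def algebra_simps)
qed

lemma norm_V_R1_le:
  assumes \<mu>: "admissible \<mu>" and x: "x \<in> {0..1}"
  shows "norm (V \<mu> (R1 \<mu>) x) \<le> \<kappa> * N * (L * (((N + 1) / 2 + N * \<kappa>) * \<Gamma>2 \<mu>))"
  using \<mu> x L_pos N_nonneg \<kappa>_ge_1 \<Gamma>2_nonneg
  by (intro norm_V_le_sup continuous_R1 norm_R1_le) (auto simp: admissible_def)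

text \<open>The product \<open>g2 * u\<close> in \<open>V_K_one\<close> is split by the inequality
  between the means. The square of \<open>u\<close> is again bounded by \<open>\<Gamma>2\<close>,
  while the pointwise square of \<open>g2\<close> survives; it accounts for the term with
  \<open>\<gamma>02\<close> in \<open>\<Lambda>\<close>.\<close>

lemma norm_V_K_one_le:
  assumes "- r \<le> Im \<mu>" "x \<in> {0..1}"
  shows "norm (V \<mu> (K \<mu> (\<lambda>_. 1)) x) \<le> (norm (g2 \<mu> x))\<^sup>2 / 2 + ((N + 1) / 2 + \<kappa>) * \<Gamma>2 \<mu>"
proof -
  let ?u = "K \<mu> (\<lambda>_. 1)"
  have "0 \<le> (norm (g2 \<mu> x) - norm (?u x))\<^sup>2"
    by simp
  then have "norm (g2 \<mu> x * ?u x) \<le> (norm (g2 \<mu> x))\<^sup>2 / 2 + (norm (?u x))\<^sup>2 / 2"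
    by (simp add: norm_mult power2_diff)
  moreover have "(norm (?u x))\<^sup>2 / 2 \<le> (N + 1) / 2 * \<Gamma>2 \<mu>"
    using power_mono[OF norm_K_one_le[OF assms(2), of \<mu>], of 2] I1_g2_square_le[of \<mu>] by simp
  ultimately show ?thesis
    using V_K_one[OF assms] norm_triangle_sub[of "V \<mu> ?u x" "g2 \<mu> x * ?u x"]
    unfolding distrib_right[of "(N + 1) / 2"] by linarith
qed

text \<open>First-order version: \<open>Z - 1\<close> solves the integral equation with right-hand
  side \<open>- K 1\<close>, which is linear in \<open>g2\<close>.\<close>

lemma norm_Z_minus_one_le:
  assumes \<mu>: "admissible \<mu>" and x: "x \<in> {0..1}"
  shows "norm (Z \<mu> x - 1) \<le> L * I1 (g2 \<mu>)"
proof (rule K_stability[OF \<mu> _ _ _ _ x, of "\<lambda>x. Z \<mu> x - 1" "\<lambda>x. - K \<mu> (\<lambda>_. 1) x"])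
  show "Z \<mu> x - 1 + K \<mu> (\<lambda>x. Z \<mu> x - 1) x = - K \<mu> (\<lambda>_. 1) x" if "x \<in> {0..1}" for x
    using K_diff[OF continuous_Z[OF \<mu>] continuous_on_const that, of \<mu> 1] Z_eq[OF \<mu> that]
    by (simp add: algebra_simps)
qed (use continuous_Z[OF \<mu>] continuous_K_one norm_K_one_le in \<open>auto intro!: continuous_intros\<close>)

lemma norm_V_Z_le:
  assumes \<mu>: "admissible \<mu>" and x: "x \<in> {0..1}"
  shows "norm (V \<mu> (Z \<mu>) x) \<le> norm (g2 \<mu> x) + \<kappa> * N * (L * I1 (g2 \<mu>))"
proof -
  have "norm (V \<mu> (\<lambda>x. Z \<mu> x - 1) x) \<le> \<kappa> * N * (L * I1 (g2 \<mu>))"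
    using \<mu> x L_pos I_nonneg
    by (intro norm_V_le_sup norm_Z_minus_one_le continuous_intros continuous_Z) (auto simp: admissible_def)
  moreover have "V \<mu> (\<lambda>x. Z \<mu> x - 1) x = V \<mu> (Z \<mu>) x - g2 \<mu> x"
    unfolding g2_def using \<mu> x by (intro V_diff continuous_Z continuous_intros)
  ultimately show ?thesis
    using norm_triangle_sub[of "V \<mu> (Z \<mu>) x" "g2 \<mu> x"] by simp
qed

end

section \<open>Analytic dependence on the spectral parameter\<close>

text \<open>
  A first-order expansion with quadratic remainder is stable under products by plain algebra and
  yields uniform convergence of the difference quotients.
\<close>

definition quad_diff :: "(complex \<Rightarrow> real \<Rightarrow> complex) \<Rightarrow> (real \<Rightarrow> complex) \<Rightarrow> complex \<Rightarrow> bool" where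
  "quad_diff F d \<mu> \<longleftrightarrow> (\<exists>C \<delta>. 0 \<le> C \<and> 0 < \<delta> \<and> (\<forall>\<nu> x. dist \<nu> \<mu> < \<delta> \<longrightarrow> x \<in> {0..1} \<longrightarrow>
     norm (F \<nu> x - F \<mu> x - (\<nu> - \<mu>) * d x) \<le> C * (norm (\<nu> - \<mu>))\<^sup>2))"

lemma quad_diffI:
  assumes "0 < \<delta>" "\<And>\<nu> x. dist \<nu> \<mu> < \<delta> \<Longrightarrow> x \<in> {0..1} \<Longrightarrow>
     norm (F \<nu> x - F \<mu> x - (\<nu> - \<mu>) * d x) \<le> C * (norm (\<nu> - \<mu>))\<^sup>2" "0 \<le> C"
  shows "quad_diff F d \<mu>"
  unfolding quad_diff_def using assms by blast

lemma quad_diff_imp_uniform_limit: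
  assumes "quad_diff F d \<mu>"
  shows "uniform_limit {0..1} (\<lambda>\<nu> x. (F \<nu> x - F \<mu> x) / (\<nu> - \<mu>)) d (at \<mu> within S)"
proof -
  obtain C \<delta> where "0 \<le> C" "0 < \<delta>" and C: "\<And>\<nu> x. dist \<nu> \<mu> < \<delta> \<Longrightarrow> x \<in> {0..1} \<Longrightarrow>
     norm (F \<nu> x - F \<mu> x - (\<nu> - \<mu>) * d x) \<le> C * (norm (\<nu> - \<mu>))\<^sup>2"
    using assms unfolding quad_diff_def by blast
  show ?thesis
    unfolding uniform_limit_iff
  proof (intro allI impI)
    fix e :: real assume "e > 0"
    show "\<forall>\<^sub>F \<nu> in at \<mu> within S. \<forall>x\<in>{0..1}. dist ((F \<nu> x - F \<mu> x) / (\<nu> - \<mu>)) (d x) < e"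
      unfolding eventually_at
    proof (intro exI[of _ "min \<delta> (e / (C + 1))"] conjI ballI impI)
      show "0 < min \<delta> (e / (C + 1))"
        using \<open>e > 0\<close> \<open>0 \<le> C\<close> \<open>0 < \<delta>\<close> by auto
      fix \<nu> x assume \<nu>: "\<nu> \<noteq> \<mu> \<and> dist \<nu> \<mu> < min \<delta> (e / (C + 1))" and x: "x \<in> {0..1::real}"
      have "norm (\<nu> - \<mu>) > 0" "norm (\<nu> - \<mu>) * (C + 1) < e"
        using \<nu> \<open>0 \<le> C\<close> by (auto simp: dist_norm field_simps)
      have "(F \<nu> x - F \<mu> x) / (\<nu> - \<mu>) - d x = (F \<nu> x - F \<mu> x - (\<nu> - \<mu>) * d x) / (\<nu> - \<mu>)"
        using \<nu> by (simp add: diff_divide_distrib)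
      then have "dist ((F \<nu> x - F \<mu> x) / (\<nu> - \<mu>)) (d x) =
          norm (F \<nu> x - F \<mu> x - (\<nu> - \<mu>) * d x) / norm (\<nu> - \<mu>)"
        by (simp add: dist_norm norm_divide)
      also have "\<dots> \<le> C * norm (\<nu> - \<mu>)"
        using C[of \<nu> x] \<nu> x \<open>norm (\<nu> - \<mu>) > 0\<close> by (simp add: divide_le_eq power2_eq_square mult.assoc)
      also have "\<dots> < e"
        using \<open>norm (\<nu> - \<mu>) * (C + 1) < e\<close> \<open>norm (\<nu> - \<mu>) > 0\<close>
        unfolding distrib_left mult.commute[of C] by linarith
      finally show "dist ((F \<nu> x - F \<mu> x) / (\<nu> - \<mu>)) (d x) < e" .
    qed
  qed
qed

lemma quad_diff_mult:
  assumes F: "quad_diff F f \<mu>" and G: "quad_diff G g \<mu>"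
    and cont: "continuous_on {0..1} (F \<mu>)" "continuous_on {0..1} f"
      "continuous_on {0..1} (G \<mu>)" "continuous_on {0..1} g"
  shows "quad_diff (\<lambda>\<nu> x. F \<nu> x * G \<nu> x) (\<lambda>x. f x * G \<mu> x + F \<mu> x * g x) \<mu>"
proof -
  obtain C1 \<delta>1 where "0 \<le> C1" "0 < \<delta>1" and C1: "\<And>\<nu> x. dist \<nu> \<mu> < \<delta>1 \<Longrightarrow> x \<in> {0..1} \<Longrightarrow>
     norm (F \<nu> x - F \<mu> x - (\<nu> - \<mu>) * f x) \<le> C1 * (norm (\<nu> - \<mu>))\<^sup>2"
    using F unfolding quad_diff_def by blast
  obtain C2 \<delta>2 where "0 \<le> C2" "0 < \<delta>2" and C2: "\<And>\<nu> x. dist \<nu> \<mu> < \<delta>2 \<Longrightarrow> x \<in> {0..1} \<Longrightarrow>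
     norm (G \<nu> x - G \<mu> x - (\<nu> - \<mu>) * g x) \<le> C2 * (norm (\<nu> - \<mu>))\<^sup>2"
    using G unfolding quad_diff_def by blast
  obtain BF where BF: "0 \<le> BF" "\<And>x. x \<in> {0..1} \<Longrightarrow> norm (F \<mu> x) \<le> BF"
    using continuous_on_norm_bound[OF cont(1)] by blast
  obtain Bf where Bf: "0 \<le> Bf" "\<And>x. x \<in> {0..1} \<Longrightarrow> norm (f x) \<le> Bf"
    using continuous_on_norm_bound[OF cont(2)] by blast
  obtain BG where BG: "0 \<le> BG" "\<And>x. x \<in> {0..1} \<Longrightarrow> norm (G \<mu> x) \<le> BG"
    using continuous_on_norm_bound[OF cont(3)] by blast
  obtain Bg where Bg: "0 \<le> Bg" "\<And>x. x \<in> {0..1} \<Longrightarrow> norm (g x) \<le> Bg"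
    using continuous_on_norm_bound[OF cont(4)] by blast
  let ?C = "Bf * Bg + (BF + Bf) * C2 + C1 * (BG + Bg + C2)"
  show ?thesis
  proof (rule quad_diffI[of "min 1 (min \<delta>1 \<delta>2)" _ _ _ ?C])
    fix \<nu> x assume \<nu>: "dist \<nu> \<mu> < min 1 (min \<delta>1 \<delta>2)" and x: "x \<in> {0..1::real}"
    define h where "h = \<nu> - \<mu>"
    have h: "norm h \<le> 1" "(norm h)\<^sup>2 \<le> 1"
      using \<nu> by (auto simp: h_def dist_norm power_le_one)
    define \<rho> where "\<rho> = F \<nu> x - F \<mu> x - h * f x"
    define \<tau> where "\<tau> = G \<nu> x - G \<mu> x - h * g x"
    have \<rho>: "norm \<rho> \<le> C1 * (norm h)\<^sup>2" and \<tau>: "norm \<tau> \<le> C2 * (norm h)\<^sup>2"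
      using C1[of \<nu> x] C2[of \<nu> x] \<nu> x by (auto simp: \<rho>_def \<tau>_def h_def)
    have \<tau>': "norm \<tau> \<le> C2"
      using \<tau> mult_left_mono[OF h(2) \<open>0 \<le> C2\<close>] by simp
    \<comment> \<open>Both factors are replaced by their expansions with errors
      \<open>\<rho>\<close> and \<open>\<tau>\<close>. The terms of order 0 and 1 in
      \<open>h\<close> cancel; each of the three remaining products contains \<open>h * h\<close>,
      \<open>\<tau>\<close> or \<open>\<rho>\<close>, all of quadratic size.\<close>
    have "F \<nu> x * G \<nu> x - F \<mu> x * G \<mu> x - h * (f x * G \<mu> x + F \<mu> x * g x) =
        h * h * (f x * g x) + (F \<mu> x + h * f x) * \<tau> + \<rho> * (G \<mu> x + h * g x + \<tau>)"
      unfolding \<rho>_def \<tau>_def by algebra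
    also have "norm \<dots> \<le> (norm h)\<^sup>2 * (Bf * Bg) + (BF + 1 * Bf) * (C2 * (norm h)\<^sup>2) +
        C1 * (norm h)\<^sup>2 * (BG + 1 * Bg + C2)"
    proof (intro norm_triangle_le add_mono)
      show "norm (h * h * (f x * g x)) \<le> (norm h)\<^sup>2 * (Bf * Bg)"
        using Bf Bg x by (auto simp: norm_mult power2_eq_square intro!: mult_left_mono mult_mono)
      have "norm (F \<mu> x + h * f x) \<le> BF + 1 * Bf"
        using BF(2)[OF x] mult_mono[OF h(1) Bf(2)[OF x]]
        by (intro norm_triangle_le add_mono) (simp_all add: norm_mult)
      then show "norm ((F \<mu> x + h * f x) * \<tau>) \<le> (BF + 1 * Bf) * (C2 * (norm h)\<^sup>2)"
        unfolding norm_mult using \<tau> BF(1) Bf(1) by (intro mult_mono) auto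
      have "norm (G \<mu> x + h * g x + \<tau>) \<le> BG + 1 * Bg + C2"
        using BG(2)[OF x] mult_mono[OF h(1) Bg(2)[OF x]] \<tau>'
        by (intro norm_triangle_le add_mono) (simp_all add: norm_mult)
      then show "norm (\<rho> * (G \<mu> x + h * g x + \<tau>)) \<le> C1 * (norm h)\<^sup>2 * (BG + 1 * Bg + C2)"
        unfolding norm_mult using \<rho> \<open>0 \<le> C1\<close> by (intro mult_mono) auto
    qed
    also have "\<dots> = ?C * (norm h)\<^sup>2"
      by (simp add: algebra_simps)
    finally show "norm (F \<nu> x * G \<nu> x - F \<mu> x * G \<mu> x - (\<nu> - \<mu>) * (f x * G \<mu> x + F \<mu> x * g x))
        \<le> ?C * (norm (\<nu> - \<mu>))\<^sup>2"
      by (simp add: h_def)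
  qed (use \<open>0 < \<delta>1\<close> \<open>0 < \<delta>2\<close> \<open>0 \<le> C1\<close> \<open>0 \<le> C2\<close> BF BG Bf Bg in auto)
qed

text \<open>After factoring out \<open>exp (c * \<mu> * d)\<close> the error is
  \<open>exp w - 1 - w\<close> with \<open>w = c * (\<nu> - \<mu>) * d\<close>. Since
  \<open>norm w\<close> is at most \<open>2 * norm (\<nu> - \<mu>)\<close>, hence at most 2,
  Taylor's formula gives \<open>4 * exp 2\<close>. Keeping the exponential at \<open>\<mu>\<close>
  as a factor allows the half-plane bound to be inserted later; \<open>norm c\<close> up to 2 covers
  both \<open>\<i>\<close> and \<open>2 * \<i>\<close>.\<close>

lemma norm_exp_diff_le:
  fixes c \<mu> \<nu> :: complex and d :: real
  assumes "norm c \<le> 2" "0 \<le> d" "d \<le> 1" "norm (\<nu> - \<mu>) \<le> 1"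
  shows "norm (exp (c * \<nu> * of_real d) - exp (c * \<mu> * of_real d)
      - (\<nu> - \<mu>) * (c * of_real d * exp (c * \<mu> * of_real d)))
    \<le> 4 * exp 2 * norm (exp (c * \<mu> * of_real d)) * (norm (\<nu> - \<mu>))\<^sup>2"
proof -
  define w where "w = c * (\<nu> - \<mu>) * of_real d"
  have "norm c * d \<le> 2 * 1"
    using assms by (intro mult_mono) auto
  then have "norm c * d * norm (\<nu> - \<mu>) \<le> 2 * norm (\<nu> - \<mu>)"
    by (intro mult_right_mono) auto
  then have w: "norm w \<le> 2 * norm (\<nu> - \<mu>)"
    using assms by (simp add: w_def norm_mult ac_simps)
  have "norm (exp w - 1 - w) \<le> exp \<bar>Re w\<bar> * (norm w)\<^sup>2"
    using Taylor_exp[of w 1] by (simp add: diff_diff_eq numeral_2_eq_2)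
  also have "\<dots> \<le> exp 2 * (2 * norm (\<nu> - \<mu>))\<^sup>2"
    using w assms(4) abs_Re_le_cmod[of w] by (intro mult_mono power_mono) auto
  finally have e: "norm (exp w - 1 - w) \<le> 4 * exp 2 * (norm (\<nu> - \<mu>))\<^sup>2"
    by (simp add: power_mult_distrib)
  have "exp (c * \<nu> * of_real d) = exp (c * \<mu> * of_real d) * exp w"
    unfolding exp_add[symmetric] by (simp add: w_def algebra_simps)
  then have eq: "exp (c * \<nu> * of_real d) - exp (c * \<mu> * of_real d)
      - (\<nu> - \<mu>) * (c * of_real d * exp (c * \<mu> * of_real d)) = exp (c * \<mu> * of_real d) * (exp w - 1 - w)"
    by (simp add: w_def algebra_simps)
  show ?thesis
    unfolding eq norm_mult using mult_left_mono[OF e, of "norm (exp (c * \<mu> * of_real d))"]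
    by (simp only: norm_ge_zero ac_simps)
qed

lemma quad_diff_exp:
  "quad_diff (\<lambda>\<nu> x. exp (\<i> * \<nu> * of_real x)) (\<lambda>x. \<i> * of_real x * exp (\<i> * \<mu> * of_real x)) \<mu>"
proof (rule quad_diffI[of 1 _ _ _ "4 * exp 2 * exp (norm \<mu>)"])
  fix \<nu> x assume \<nu>: "dist \<nu> \<mu> < 1" and x: "x \<in> {0..1::real}"
  have "norm (exp (\<i> * \<mu> * of_real x)) \<le> exp (norm \<mu>)"
  proof -
    have "norm (\<i> * \<mu> * of_real x) \<le> norm \<mu> * 1"
      using x mult_left_mono[of x 1 "norm \<mu>"] by (simp add: norm_mult)
    then show ?thesis
      using norm_exp[of "\<i> * \<mu> * of_real x"] by (simp add: order_trans)
  qed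
  then have "4 * exp 2 * norm (exp (\<i> * \<mu> * of_real x)) * (norm (\<nu> - \<mu>))\<^sup>2 \<le>
      4 * exp 2 * exp (norm \<mu>) * (norm (\<nu> - \<mu>))\<^sup>2"
    by (intro mult_right_mono mult_left_mono) auto
  then show "norm (exp (\<i> * \<nu> * of_real x) - exp (\<i> * \<mu> * of_real x) -
        (\<nu> - \<mu>) * (\<i> * of_real x * exp (\<i> * \<mu> * of_real x))) \<le> 4 * exp 2 * exp (norm \<mu>) * (norm (\<nu> - \<mu>))\<^sup>2"
    using norm_exp_diff_le[of \<i> x \<nu> \<mu>] \<nu> x
    by (elim order_trans[rotated]) (auto simp: dist_norm simp del: norm_exp_eq_Re)
qed auto

section \<open>Expansion of the operators and of the solution in the spectral parameter\<close>

context dirac_potential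
begin

text \<open>
  The derivative of \<open>V \<mu> f\<close> in \<open>\<mu>\<close> has the kernel \<open>2 \<i> (s - x) exp (2 \<i> \<mu> (s - x))\<close>; splitting
  \<open>s - x\<close> expresses it through \<open>V \<mu>\<close> itself.
\<close>

definition V' :: "complex \<Rightarrow> (real \<Rightarrow> complex) \<Rightarrow> real \<Rightarrow> complex" where
  "V' \<mu> f x = 2 * \<i> * (V \<mu> (\<lambda>s. of_real s * f s) x - of_real x * V \<mu> f x)"

definition K' :: "complex \<Rightarrow> (real \<Rightarrow> complex) \<Rightarrow> real \<Rightarrow> complex" where
  "K' \<mu> f x = integral {0..x} (\<lambda>t. \<sigma>1 t * V' \<mu> f t)"

definition C\<^sub>V :: real where "C\<^sub>V = 4 * exp 2 * \<kappa>"

lemma C\<^sub>V_pos: "0 < C\<^sub>V"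
  using \<kappa>_ge_1 by (simp add: C\<^sub>V_def)

lemma continuous_V': "continuous_on {0..1} f \<Longrightarrow> continuous_on {0..1} (V' \<mu> f)"
  unfolding V'_def[abs_def] by (intro continuous_intros continuous_V)

lemma continuous_K':
  assumes "continuous_on {0..1} f"
  shows "continuous_on {0..1} (K' \<mu> f)"
proof -
  have "(\<lambda>t. V' \<mu> f t * \<sigma>1 t) absolutely_integrable_on {0..1}"
    by (intro absolutely_integrable_continuous_mult \<sigma>1 continuous_V' assms)
  then have "primitive01 (\<lambda>t. \<sigma>1 t * V' \<mu> f t) (K' \<mu> f)"
    using primitive01_indefinite[of "\<lambda>t. \<sigma>1 t * V' \<mu> f t" 0] by (simp add: K'_def[abs_def] mult.commute)
  then show ?thesis
    by (rule primitive01_continuous)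
qed

text \<open>The Taylor error of the kernel is measured relative to the kernel at
  \<open>\<mu>\<close>, so the half-plane condition at \<open>\<mu>\<close> yields the constant
  \<open>C\<^sub>V\<close>.\<close>

lemma V_expansion:
  assumes \<mu>: "- r \<le> Im \<mu>" and \<nu>: "norm (\<nu> - \<mu>) \<le> 1"
    and f: "continuous_on {0..1} f" "0 \<le> B" "\<And>x. x \<in> {0..1} \<Longrightarrow> norm (f x) \<le> B" and x: "x \<in> {0..1}"
  shows "norm (V \<nu> f x - V \<mu> f x - (\<nu> - \<mu>) * V' \<mu> f x) \<le> C\<^sub>V * (N * B) * (norm (\<nu> - \<mu>))\<^sup>2"
proof -
  let ?h = "\<nu> - \<mu>"
  let ?k = "\<lambda>\<mu> s. exp (2 * \<i> * \<mu> * of_real (s - x))"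
  let ?q = "\<lambda>s. ?k \<nu> s - ?k \<mu> s - ?h * (2 * \<i> * of_real (s - x) * ?k \<mu> s)"
  have sf: "continuous_on {0..1} (\<lambda>s. of_real s * f s)"
    using f by (intro continuous_intros)
  have int: "(\<lambda>s. ?k \<mu> s * \<sigma>2 s * f s) integrable_on {x..1}" if "continuous_on {0..1} f" for \<mu> f
    using x by (intro absolutely_integrable_on_subinterval_real(2)[OF integrable_V[OF that]]) auto
  have "V \<nu> f x - V \<mu> f x - ?h * V' \<mu> f x = V \<nu> f x - V \<mu> f x
      - (2 * \<i> * ?h * V \<mu> (\<lambda>s. of_real s * f s) x - 2 * \<i> * ?h * of_real x * V \<mu> f x)"
    by (simp add: V'_def algebra_simps)
  also have "\<dots> = integral {x..1} (\<lambda>s. ?k \<nu> s * \<sigma>2 s * f s - ?k \<mu> s * \<sigma>2 s * f s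
      - (2 * \<i> * ?h * (?k \<mu> s * \<sigma>2 s * (of_real s * f s)) - 2 * \<i> * ?h * of_real x * (?k \<mu> s * \<sigma>2 s * f s)))"
    unfolding V_def integral_mult_right[symmetric]
    using int[OF f(1)] int[OF sf]
    by (simp only: Henstock_Kurzweil_Integration.integral_diff integrable_diff integrable_on_mult_right)
  also have "\<dots> = integral {x..1} (\<lambda>s. ?q s * f s * \<sigma>2 s)"
    by (intro integral_cong) (simp add: algebra_simps)
  finally have eq: "V \<nu> f x - V \<mu> f x - ?h * V' \<mu> f x = integral {x..1} (\<lambda>s. ?q s * f s * \<sigma>2 s)" .
  have "norm (integral {x..1} (\<lambda>s. ?q s * f s * \<sigma>2 s)) \<le> integral {0..1} (\<lambda>s. C\<^sub>V * (norm ?h)\<^sup>2 * (norm (f s) * norm (\<sigma>2 s)))"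
  proof (rule norm_integral_le_01)
    have "(\<lambda>s. ?q s * f s * \<sigma>2 s) absolutely_integrable_on {0..1}"
      using f by (intro absolutely_integrable_continuous_mult \<sigma>2 continuous_intros)
    then show "(\<lambda>s. ?q s * f s * \<sigma>2 s) integrable_on {x..1}"
      using x by (auto intro: absolutely_integrable_on_subinterval_real(2))
    show "(\<lambda>s. C\<^sub>V * (norm ?h)\<^sup>2 * (norm (f s) * norm (\<sigma>2 s))) absolutely_integrable_on {0..1}"
      using I_integrable(2)[OF f(1)] by (intro set_integrable_mult_right)
    show "norm (?q s * f s * \<sigma>2 s) \<le> C\<^sub>V * (norm ?h)\<^sup>2 * (norm (f s) * norm (\<sigma>2 s))" if s: "s \<in> {x..1}" for s
    proof -
      have "norm (?q s) \<le> 4 * exp 2 * norm (?k \<mu> s) * (norm ?h)\<^sup>2"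
        using s x \<nu> by (intro norm_exp_diff_le) (auto simp: norm_mult)
      also have "\<dots> \<le> 4 * exp 2 * \<kappa> * (norm ?h)\<^sup>2"
        unfolding \<kappa>_def using s x \<mu> r by (intro mult_right_mono mult_left_mono norm_exp_kernel_le) auto
      finally have "norm (?q s) \<le> C\<^sub>V * (norm ?h)\<^sup>2"
        by (simp add: C\<^sub>V_def)
      then show ?thesis
        unfolding norm_mult[of _ "\<sigma>2 s"] norm_mult[of _ "f s"]
        by (simp add: mult.assoc[of _ "norm (f s)"] mult_right_mono)
    qed
  qed (use x C\<^sub>V_pos in auto)
  also have "\<dots> = C\<^sub>V * (norm ?h)\<^sup>2 * I2 f"
    by (simp add: I2_def)
  also have "\<dots> \<le> C\<^sub>V * (norm ?h)\<^sup>2 * (N * B)"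
    using f C\<^sub>V_pos by (intro mult_left_mono I_le_const) auto
  finally show ?thesis
    unfolding eq by (simp only: ac_simps)
qed

lemma K_expansion:
  assumes \<mu>: "- r \<le> Im \<mu>" and \<nu>: "norm (\<nu> - \<mu>) \<le> 1"
    and f: "continuous_on {0..1} f" "0 \<le> B" "\<And>x. x \<in> {0..1} \<Longrightarrow> norm (f x) \<le> B" and x: "x \<in> {0..1}"
  shows "norm (K \<nu> f x - K \<mu> f x - (\<nu> - \<mu>) * K' \<mu> f x) \<le> N * (C\<^sub>V * (N * B) * (norm (\<nu> - \<mu>))\<^sup>2)"
proof -
  let ?D = "\<lambda>t. V \<nu> f t - V \<mu> f t - (\<nu> - \<mu>) * V' \<mu> f t"
  have int: "(\<lambda>t. \<sigma>1 t * g t) integrable_on {0..x}" if "continuous_on {0..1} g" for g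
    using absolutely_integrable_on_subinterval_real(2)[OF absolutely_integrable_continuous_mult[OF that \<sigma>1], of 0 x] x
    by (simp add: mult.commute)
  have D: "continuous_on {0..1} ?D"
    by (intro continuous_intros continuous_V continuous_V' f)
  have "integral {0..x} (\<lambda>t. \<sigma>1 t * ?D t) =
      integral {0..x} (\<lambda>t. \<sigma>1 t * V \<nu> f t - \<sigma>1 t * V \<mu> f t - (\<nu> - \<mu>) * (\<sigma>1 t * V' \<mu> f t))"
    by (intro integral_cong) (simp add: algebra_simps)
  also have "\<dots> = K \<nu> f x - K \<mu> f x - (\<nu> - \<mu>) * K' \<mu> f x"
    unfolding K_def K'_def integral_mult_right[symmetric]
    using int[OF continuous_V[OF f(1)]] int[OF continuous_V'[OF f(1)]]
    by (simp only: Henstock_Kurzweil_Integration.integral_diff integrable_diff integrable_on_mult_right)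
  finally have "norm (K \<nu> f x - K \<mu> f x - (\<nu> - \<mu>) * K' \<mu> f x) \<le> I1 ?D"
    using norm_integral_\<sigma>1_le[OF D x] by simp
  also have "\<dots> \<le> N * (C\<^sub>V * (N * B) * (norm (\<nu> - \<mu>))\<^sup>2)"
    using D V_expansion[OF \<mu> \<nu> f] C\<^sub>V_pos N_nonneg f(2) by (intro I_le_const) auto
  finally show ?thesis .
qed

text \<open>\<open>D\<close> solves the formally differentiated equation
  \<open>D + K D = - K' Z\<close>. The candidate error \<open>?q\<close> is tested with the operator
  at \<open>\<nu>\<close>: \<open>?q + K \<nu> ?q\<close> is quadratically small, and
  \<open>K_stability\<close> at \<open>\<nu>\<close> transfers this to \<open>?q\<close>, because
  \<open>L\<close> is the same for all admissible parameters. Continuity of \<open>Z\<close> in the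
  parameter thus need not be known beforehand.\<close>

lemma quad_diff_Z:
  assumes "0 < \<epsilon>" and ball: "\<And>\<nu>. dist \<nu> \<mu> < \<epsilon> \<Longrightarrow> admissible \<nu>"
  obtains D where "continuous_on {0..1} D" "quad_diff Z D \<mu>"
proof -
  have \<mu>: "admissible \<mu>"
    using ball[of \<mu>] \<open>0 < \<epsilon>\<close> by simp
  then have im: "- r \<le> Im \<mu>"
    by (simp add: admissible_def)
  note cZ = continuous_Z[OF \<mu>]
  obtain D where D: "continuous_on {0..1} D" and D_eq: "\<And>x. x \<in> {0..1} \<Longrightarrow> D x + K \<mu> D x = - K' \<mu> (Z \<mu>) x"
    using K_solution_exists[OF \<mu>, of "\<lambda>x. - K' \<mu> (Z \<mu>) x"] continuous_K'[OF cZ] continuous_on_minus by blast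
  obtain BD where BD: "0 \<le> BD" "\<And>x. x \<in> {0..1} \<Longrightarrow> norm (D x) \<le> BD"
    using continuous_on_norm_bound[OF D] by blast
  obtain BK where BK: "0 \<le> BK" "\<And>x. x \<in> {0..1} \<Longrightarrow> norm (K' \<mu> D x) \<le> BK"
    using continuous_on_norm_bound[OF continuous_K'[OF D]] by blast
  let ?A = "\<lambda>B. N * (C\<^sub>V * (N * B))"
  let ?C = "?A L + BK + ?A BD"
  have A: "0 \<le> ?A B" if "0 \<le> B" for B
    using that N_nonneg C\<^sub>V_pos by auto
  have "quad_diff Z D \<mu>"
  proof (rule quad_diffI[of "min 1 \<epsilon>" _ _ _ "L * ?C"])
    fix \<nu> x assume \<nu>: "dist \<nu> \<mu> < min 1 \<epsilon>" and x: "x \<in> {0..1::real}"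
    let ?h = "\<nu> - \<mu>"
    let ?q = "\<lambda>x. (Z \<nu> x - Z \<mu> x) - ?h * D x"
    have h: "norm ?h \<le> 1" and ad: "admissible \<nu>"
      using \<nu> ball by (auto simp: dist_norm)
    note cZ' = continuous_Z[OF ad]
    have q: "continuous_on {0..1} ?q"
      by (intro continuous_intros cZ cZ' D)
    have "norm (?q x) \<le> L * (?C * (norm ?h)\<^sup>2)"
    proof (rule K_stability[OF ad q _ refl _ x])
      show "continuous_on {0..1} (\<lambda>x. ?q x + K \<nu> ?q x)"
        by (rule continuous_on_add[OF q continuous_K[OF q]])
      fix t :: real assume t: "t \<in> {0..1}"
      have hD: "continuous_on {0..1} (\<lambda>x. ?h * D x)" and dZ: "continuous_on {0..1} (\<lambda>x. Z \<nu> x - Z \<mu> x)"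
        by (intro continuous_intros D cZ cZ')+
      have "K \<nu> ?q t = K \<nu> (Z \<nu>) t - K \<nu> (Z \<mu>) t - ?h * K \<nu> D t"
        unfolding K_diff[OF dZ hD t] K_diff[OF cZ' cZ t] K_cmult ..
      \<comment> \<open>The integral equations at \<open>\<nu>\<close> and \<open>\<mu>\<close> and
        the equation for \<open>D\<close> eliminate all terms of order 0 and 1. What remains is the
        expansion error of \<open>K\<close> on \<open>Z \<mu>\<close>, a term with the square of
        \<open>?h\<close>, and \<open>?h\<close> times the expansion error on
        \<open>D\<close>.\<close>
      then have "?q t + K \<nu> ?q t = - (K \<nu> (Z \<mu>) t - K \<mu> (Z \<mu>) t - ?h * K' \<mu> (Z \<mu>) t)
          - ?h * (?h * K' \<mu> D t) - ?h * (K \<nu> D t - K \<mu> D t - ?h * K' \<mu> D t)"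
        using Z_eq[OF ad t] Z_eq[OF \<mu> t] D_eq[OF t] by algebra
      also have "norm \<dots> \<le> N * (C\<^sub>V * (N * L) * (norm ?h)\<^sup>2) + (norm ?h)\<^sup>2 * BK +
          1 * (N * (C\<^sub>V * (N * BD) * (norm ?h)\<^sup>2))"
      proof (intro norm_triangle_le_diff add_mono)
        show "norm (- (K \<nu> (Z \<mu>) t - K \<mu> (Z \<mu>) t - ?h * K' \<mu> (Z \<mu>) t)) \<le> N * (C\<^sub>V * (N * L) * (norm ?h)\<^sup>2)"
          unfolding norm_minus_cancel using L_pos norm_Z_le[OF \<mu>] by (intro K_expansion im h cZ t) auto
        show "norm (?h * (?h * K' \<mu> D t)) \<le> (norm ?h)\<^sup>2 * BK"
          using BK(2)[OF t] by (simp add: norm_mult power2_eq_square mult.assoc mult_left_mono)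
        have "norm (K \<nu> D t - K \<mu> D t - ?h * K' \<mu> D t) \<le> N * (C\<^sub>V * (N * BD) * (norm ?h)\<^sup>2)"
          using BD by (intro K_expansion im h D t)
        then show "norm (?h * (K \<nu> D t - K \<mu> D t - ?h * K' \<mu> D t)) \<le> 1 * (N * (C\<^sub>V * (N * BD) * (norm ?h)\<^sup>2))"
          unfolding norm_mult using h by (intro mult_mono) auto
      qed
      finally show "norm (?q t + K \<nu> ?q t) \<le> ?C * (norm ?h)\<^sup>2"
        by (simp add: algebra_simps)
    qed
    then show "norm (Z \<nu> x - Z \<mu> x - ?h * D x) \<le> L * ?C * (norm ?h)\<^sup>2"
      by (simp add: mult.assoc)
  qed (use \<open>0 < \<epsilon>\<close> A[of L] A[of BD] BD BK L_pos in auto)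
  with D show thesis
    by (rule that)
qed

text \<open>Both the operator and its argument vary. The variation of the argument is handled by
  \<open>V \<nu>\<close>, whose bound \<open>\<kappa> * N\<close> is uniform in
  \<open>\<nu>\<close>; the variation of the operator by \<open>V_expansion\<close> on the fixed
  functions \<open>Z \<mu>\<close> and \<open>D\<close>.\<close>

lemma quad_diff_V_Z:
  assumes "0 < \<epsilon>" and ball: "\<And>\<nu>. dist \<nu> \<mu> < \<epsilon> \<Longrightarrow> admissible \<nu>"
    and D: "continuous_on {0..1} D" "quad_diff Z D \<mu>"
  shows "quad_diff (\<lambda>\<nu>. V \<nu> (Z \<nu>)) (\<lambda>x. V' \<mu> (Z \<mu>) x + V \<mu> D x) \<mu>"
proof -
  have \<mu>: "admissible \<mu>"
    using ball[of \<mu>] \<open>0 < \<epsilon>\<close> by simp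
  then have im: "- r \<le> Im \<mu>"
    by (simp add: admissible_def)
  note cZ = continuous_Z[OF \<mu>]
  obtain C \<delta> where "0 \<le> C" "0 < \<delta>" and C: "\<And>\<nu> x. dist \<nu> \<mu> < \<delta> \<Longrightarrow> x \<in> {0..1} \<Longrightarrow>
     norm (Z \<nu> x - Z \<mu> x - (\<nu> - \<mu>) * D x) \<le> C * (norm (\<nu> - \<mu>))\<^sup>2"
    using D(2) unfolding quad_diff_def by blast
  obtain BD where BD: "0 \<le> BD" "\<And>x. x \<in> {0..1} \<Longrightarrow> norm (D x) \<le> BD"
    using continuous_on_norm_bound[OF D(1)] by blast
  obtain BV where BV: "0 \<le> BV" "\<And>x. x \<in> {0..1} \<Longrightarrow> norm (V' \<mu> D x) \<le> BV"
    using continuous_on_norm_bound[OF continuous_V'[OF D(1)]] by blast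
  let ?C = "\<kappa> * N * C + C\<^sub>V * (N * L) + BV + C\<^sub>V * (N * BD)"
  show ?thesis
  proof (rule quad_diffI[of "min 1 (min \<delta> \<epsilon>)" _ _ _ ?C])
    fix \<nu> x assume \<nu>: "dist \<nu> \<mu> < min 1 (min \<delta> \<epsilon>)" and x: "x \<in> {0..1::real}"
    let ?h = "\<nu> - \<mu>"
    let ?q = "\<lambda>x. (Z \<nu> x - Z \<mu> x) - ?h * D x"
    have h: "norm ?h \<le> 1" and ad: "admissible \<nu>" and \<nu>\<delta>: "dist \<nu> \<mu> < \<delta>"
      using \<nu> ball by (auto simp: dist_norm)
    note cZ' = continuous_Z[OF ad]
    have hD: "continuous_on {0..1} (\<lambda>x. ?h * D x)" and dZ: "continuous_on {0..1} (\<lambda>x. Z \<nu> x - Z \<mu> x)"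
      by (intro continuous_intros D cZ cZ')+
    have "V \<nu> ?q x = V \<nu> (Z \<nu>) x - V \<nu> (Z \<mu>) x - ?h * V \<nu> D x"
      unfolding V_diff[OF dZ hD x] V_diff[OF cZ' cZ x] V_cmult ..
    then have eq: "V \<nu> (Z \<nu>) x - V \<mu> (Z \<mu>) x - ?h * (V' \<mu> (Z \<mu>) x + V \<mu> D x) =
        V \<nu> ?q x + (V \<nu> (Z \<mu>) x - V \<mu> (Z \<mu>) x - ?h * V' \<mu> (Z \<mu>) x) + ?h * (?h * V' \<mu> D x) +
        ?h * (V \<nu> D x - V \<mu> D x - ?h * V' \<mu> D x)"
      by algebra
    have "norm (V \<nu> ?q x + (V \<nu> (Z \<mu>) x - V \<mu> (Z \<mu>) x - ?h * V' \<mu> (Z \<mu>) x) + ?h * (?h * V' \<mu> D x) +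
        ?h * (V \<nu> D x - V \<mu> D x - ?h * V' \<mu> D x)) \<le> \<kappa> * N * (C * (norm ?h)\<^sup>2) + C\<^sub>V * (N * L) * (norm ?h)\<^sup>2 + (norm ?h)\<^sup>2 * BV +
        1 * (C\<^sub>V * (N * BD) * (norm ?h)\<^sup>2)"
    proof (intro norm_triangle_le add_mono)
      show "norm (V \<nu> ?q x) \<le> \<kappa> * N * (C * (norm ?h)\<^sup>2)"
        using ad C[OF \<nu>\<delta>] \<open>0 \<le> C\<close>
        by (intro norm_V_le_sup x continuous_intros cZ cZ' D) (auto simp: admissible_def)
      show "norm (V \<nu> (Z \<mu>) x - V \<mu> (Z \<mu>) x - ?h * V' \<mu> (Z \<mu>) x) \<le> C\<^sub>V * (N * L) * (norm ?h)\<^sup>2"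
        using L_pos norm_Z_le[OF \<mu>] by (intro V_expansion im h cZ x) auto
      show "norm (?h * (?h * V' \<mu> D x)) \<le> (norm ?h)\<^sup>2 * BV"
        using BV(2)[OF x] by (simp add: norm_mult power2_eq_square mult.assoc mult_left_mono)
      have "norm (V \<nu> D x - V \<mu> D x - ?h * V' \<mu> D x) \<le> C\<^sub>V * (N * BD) * (norm ?h)\<^sup>2"
        using BD by (intro V_expansion im h D x)
      then show "norm (?h * (V \<nu> D x - V \<mu> D x - ?h * V' \<mu> D x)) \<le> 1 * (C\<^sub>V * (N * BD) * (norm ?h)\<^sup>2)"
        unfolding norm_mult using h by (intro mult_mono) auto
    qed
    also have "\<dots> = ?C * (norm ?h)\<^sup>2"
      by (simp add: algebra_simps)
    finally show "norm (V \<nu> (Z \<nu>) x - V \<mu> (Z \<mu>) x - ?h * (V' \<mu> (Z \<mu>) x + V \<mu> D x)) \<le> ?C * (norm ?h)\<^sup>2"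
      unfolding eq .
  qed (use \<open>0 < \<epsilon>\<close> \<open>0 < \<delta>\<close> \<open>0 \<le> C\<close> BD BV L_pos C\<^sub>V_pos N_nonneg \<kappa>_ge_1 in auto)
qed

lemma continuous_W:
  assumes "admissible \<mu>"
  shows "continuous_on {0..1} (W1 \<mu>)" "continuous_on {0..1} (W2 \<mu>)"
  unfolding W1_def[abs_def] W2_def[abs_def]
  by (intro continuous_intros continuous_V continuous_Z assms)+

lemma W_analytic:
  assumes "open S" and S: "\<And>\<mu>. \<mu> \<in> S \<Longrightarrow> admissible \<mu>"
  shows "C01_pair_analytic_on W1 W2 S"
  unfolding C01_pair_analytic_on_def
proof
  fix \<mu>0 assume "\<mu>0 \<in> S"
  then obtain \<epsilon> where "\<epsilon> > 0" and \<epsilon>: "ball \<mu>0 \<epsilon> \<subseteq> S"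
    using \<open>open S\<close> open_contains_ball by blast
  have "C01_pair_holomorphic_on W1 W2 (ball \<mu>0 \<epsilon>)"
    unfolding C01_pair_holomorphic_on_def
  proof (intro conjI ballI)
    fix \<mu> assume "\<mu> \<in> ball \<mu>0 \<epsilon>"
    then obtain \<eta> where "\<eta> > 0" and \<eta>: "\<And>\<nu>. dist \<nu> \<mu> < \<eta> \<Longrightarrow> admissible \<nu>"
      using S \<epsilon> \<open>open S\<close> by (metis dist_commute mem_ball open_contains_ball subsetD)
    have \<mu>: "admissible \<mu>"
      using \<eta>[of \<mu>] \<open>\<eta> > 0\<close> by simp
    then show "continuous_on {0..1} (W1 \<mu>)" "continuous_on {0..1} (W2 \<mu>)"
      by (rule continuous_W)+
    obtain D where D: "continuous_on {0..1} D" "quad_diff Z D \<mu>"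
      using quad_diff_Z[OF \<open>\<eta> > 0\<close> \<eta>] by blast
    let ?E = "\<lambda>x. exp (\<i> * \<mu> * of_real x)"
    let ?E' = "\<lambda>x. \<i> * of_real x * ?E x"
    let ?v = "\<lambda>x. V' \<mu> (Z \<mu>) x + V \<mu> D x"
    let ?d1 = "\<lambda>x. ?E' x * Z \<mu> x + ?E x * D x"
    let ?d2 = "\<lambda>x. ?E' x * V \<mu> (Z \<mu>) x + ?E x * ?v x"
    have E: "continuous_on {0..1} ?E" "continuous_on {0..1} ?E'"
      by (intro continuous_intros)+
    have v: "continuous_on {0..1} ?v"
      by (intro continuous_intros continuous_V continuous_V' continuous_Z[OF \<mu>] D)
    have "quad_diff W1 ?d1 \<mu>"
      unfolding W1_def[abs_def]
      by (intro quad_diff_mult quad_diff_exp D E continuous_Z[OF \<mu>])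
    moreover have "quad_diff W2 ?d2 \<mu>"
      unfolding W2_def[abs_def]
      by (intro quad_diff_mult quad_diff_exp quad_diff_V_Z[OF \<open>\<eta> > 0\<close> \<eta> D] E v continuous_V continuous_Z[OF \<mu>])
    moreover have "continuous_on {0..1} ?d1" "continuous_on {0..1} ?d2"
      by (intro continuous_intros continuous_V continuous_Z[OF \<mu>] D v)+
    ultimately show "\<exists>d1 d2. continuous_on {0..1} d1 \<and> continuous_on {0..1} d2 \<and>
        uniform_limit {0..1} (\<lambda>\<nu> x. (W1 \<nu> x - W1 \<mu> x) / (\<nu> - \<mu>)) d1 (at \<mu> within ball \<mu>0 \<epsilon>) \<and>
        uniform_limit {0..1} (\<lambda>\<nu> x. (W2 \<nu> x - W2 \<mu> x) / (\<nu> - \<mu>)) d2 (at \<mu> within ball \<mu>0 \<epsilon>)"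
      by (intro exI[of _ ?d1] exI[of _ ?d2] conjI quad_diff_imp_uniform_limit)
  qed
  then show "\<exists>\<epsilon>>0. C01_pair_holomorphic_on W1 W2 (ball \<mu>0 \<epsilon>)"
    using \<open>\<epsilon> > 0\<close> by blast
qed

end

section \<open>The asymptotic representations\<close>

text \<open>In the extended nonnegative reals \<open>1 / \<infinity>\<close> is 0, which forces
  \<open>p = 1\<close>, whereas \<open>q = 0\<close> would make \<open>1 / q\<close>
  infinite.\<close>

lemma conjugate_exponent_cases:
  assumes "1 \<le> p" "1 / ennreal p + 1 / q = 1"
  obtains "p = 1" "q = \<infinity>"
  | q' where "1 < p" "q = ennreal q'" "1 < q'" "1 / p + 1 / q' = 1"
proof (cases q)
  case (real q')
  have "q' \<noteq> 0"
    using assms(2) real by (auto simp: ennreal_divide_zero)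
  then have "0 < q'"
    using real by simp
  then have "ennreal (1 / p + 1 / q') = ennreal 1"
    using assms real divide_ennreal[of 1 p] divide_ennreal[of 1 q'] by (simp add: ennreal_plus)
  then have pq: "1 / p + 1 / q' = 1"
    using assms(1) \<open>0 < q'\<close> by (subst (asm) ennreal_inj) auto
  have "1 / q' < 1"
    using pq assms(1) by (smt (verit) zero_less_divide_1_iff)
  moreover have "1 / p < 1"
    using pq \<open>0 < q'\<close> by (smt (verit) zero_less_divide_1_iff)
  ultimately show thesis
    using that(2)[of q'] pq real \<open>0 < q'\<close> assms(1) by (simp add: divide_less_eq split: if_splits)
next
  case top
  have "ennreal (1 / p) = ennreal 1"
    using assms top divide_ennreal[of 1 p] by simp
  then have "p = 1"
    using assms(1) by (subst (asm) ennreal_inj) auto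
  then show thesis
    using that(1) top by simp
qed

section \<open>Hoelder's inequality and integrability of L^p potentials\<close>

lemma sup_norm_upper:
  fixes g :: "real \<Rightarrow> real"
  assumes "continuous_on {0..1} g" "x \<in> {0..1}"
  shows "\<bar>g x\<bar> \<le> sup_norm g"
proof -
  have "bdd_above ((\<lambda>x. norm (g x)) ` {0..1})"
    using assms(1) by (intro bounded_imp_bdd_above compact_imp_bounded compact_continuous_image continuous_on_norm) auto
  then show ?thesis
    unfolding sup_norm_def using assms(2) cSUP_upper[of x "{0..1}" "\<lambda>x. norm (g x)"] by simp
qed

lemma Lq_norm_nonneg:
  assumes "continuous_on {0..1} g"
  shows "0 \<le> Lq_norm q g"
  using sup_norm_upper[OF assms, of 0] abs_ge_zero[of "g 0"]
  by (auto simp: Lq_norm_def Lp_norm_def intro: order_trans)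

lemma Lp_norm_eq_integral:
  assumes "(\<lambda>x. \<bar>f x\<bar> powr p) absolutely_integrable_on {0..1}"
  shows "Lp_norm p f = integral {0..1} (\<lambda>x. \<bar>f x\<bar> powr p) powr (1 / p)"
  unfolding Lp_norm_def using set_lebesgue_integral_eq_integral(2)[OF assms] by simp

text \<open>For \<open>p = 1\<close> the factor \<open>g\<close> is replaced by its supremum.
  Otherwise Young's inequality is integrated for \<open>s / A\<close> and \<open>g / B\<close>,
  where \<open>A\<close> and \<open>B\<close> exceed the two norms, and the conjugacy of the
  exponents turns the right-hand side into 1.\<close>

lemma Holder_inequality_01:
  fixes s g :: "real \<Rightarrow> real"
  assumes p: "1 \<le> p" and q: "1 / ennreal p + 1 / q = 1"
    and s: "s absolutely_integrable_on {0..1}" "\<And>x. 0 \<le> s x"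
    and sp: "(\<lambda>x. s x powr p) absolutely_integrable_on {0..1}"
    and g: "continuous_on {0..1} g" "\<And>x. x \<in> {0..1} \<Longrightarrow> 0 \<le> g x"
  shows "integral {0..1} (\<lambda>x. g x * s x) \<le> Lp_norm p s * Lq_norm q g"
proof -
  have gs: "(\<lambda>x. g x * s x) integrable_on {0..1}"
    using absolutely_integrable_continuous_mult[OF g(1) s(1)] set_lebesgue_integral_eq_integral(1) by blast
  have si: "s integrable_on {0..1}" and spi: "(\<lambda>x. s x powr p) integrable_on {0..1}"
    using s sp set_lebesgue_integral_eq_integral(1) by blast+
  have Lp: "Lp_norm p s = integral {0..1} (\<lambda>x. s x powr p) powr (1 / p)"
    using Lp_norm_eq_integral[of s p] sp s(2) by simp
  show ?thesis
    using p q
  proof (cases rule: conjugate_exponent_cases)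
    case 1
    have "integral {0..1} (\<lambda>x. g x * s x) \<le> integral {0..1} (\<lambda>x. sup_norm g * s x)"
    proof (rule integral_le[OF gs])
      show "g x * s x \<le> sup_norm g * s x" if "x \<in> {0..1}" for x
        using sup_norm_upper[OF g(1) that] s(2)[of x] by (intro mult_right_mono) auto
    qed (use si in \<open>intro integrable_on_mult_right\<close>)
    also have "\<dots> = sup_norm g * integral {0..1} s"
      by simp
    also have "integral {0..1} s = Lp_norm p s"
      unfolding Lp using 1 s(2) Henstock_Kurzweil_Integration.integral_nonneg[OF si] by simp
    finally show ?thesis
      using 1 by (simp add: Lq_norm_def mult.commute)
  next
    case (2 q')
    define \<alpha> where "\<alpha> = integral {0..1} (\<lambda>x. s x powr p)"
    define \<beta> where "\<beta> = integral {0..1} (\<lambda>x. g x powr q')"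
    have "(\<lambda>x. \<bar>g x\<bar> powr q') absolutely_integrable_on {0..1}"
      using g 2 by (intro absolutely_integrable_continuous_real continuous_on_powr' continuous_intros) auto
    moreover have "integral {0..1} (\<lambda>x. \<bar>g x\<bar> powr q') = \<beta>"
      unfolding \<beta>_def using g(2) by (intro integral_cong) auto
    ultimately have Lq: "Lq_norm q g = \<beta> powr (1 / q')"
      using 2 Lp_norm_eq_integral[of g q'] by (simp add: Lq_norm_def)
    have gq: "(\<lambda>x. g x powr q') integrable_on {0..1}"
      using g 2 by (intro integrable_continuous_real continuous_on_powr' continuous_intros) auto
    have nn: "0 \<le> \<alpha>" "0 \<le> \<beta>"
      unfolding \<alpha>_def \<beta>_def by (intro Henstock_Kurzweil_Integration.integral_nonneg spi gq; simp)+
    text \<open>Enlarging both norms by \<open>e\<close> avoids normalising by a norm that may vanish.\<close>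
    have bound: "integral {0..1} (\<lambda>x. g x * s x) \<le> (\<alpha> powr (1 / p) + e) * (\<beta> powr (1 / q') + e)"
      if "e > 0" for e
    proof -
      define A where "A = \<alpha> powr (1 / p) + e"
      define B where "B = \<beta> powr (1 / q') + e"
      have AB: "A > 0" "B > 0"
        unfolding A_def B_def using \<open>e > 0\<close> by (simp_all add: add_nonneg_pos)
      have "(\<alpha> powr (1 / p)) powr p \<le> A powr p" "(\<beta> powr (1 / q')) powr q' \<le> B powr q'"
        using \<open>e > 0\<close> 2 by (intro powr_mono2; simp add: A_def B_def)+
      then have le: "\<alpha> \<le> A powr p" "\<beta> \<le> B powr q'"
        using nn 2 by (simp_all add: powr_powr)
      have "integral {0..1} (\<lambda>x. 1 / (A * B) * (g x * s x)) \<le>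
          integral {0..1} (\<lambda>x. 1 / (A powr p * p) * s x powr p + 1 / (B powr q' * q') * g x powr q')"
      proof (rule integral_le)
        show "(\<lambda>x. 1 / (A * B) * (g x * s x)) integrable_on {0..1}"
          using gs by (rule integrable_on_mult_right)
        show "(\<lambda>x. 1 / (A powr p * p) * s x powr p + 1 / (B powr q' * q') * g x powr q') integrable_on {0..1}"
          using spi gq by (intro integrable_add integrable_on_mult_right)
        fix x :: real assume x: "x \<in> {0..1}"
        have "s x / A * (g x / B) \<le> (s x / A) powr p / p + (g x / B) powr q' / q'"
          using 2 AB s(2) g(2)[OF x] by (intro Youngs_inequality) auto
        then show "1 / (A * B) * (g x * s x) \<le>
            1 / (A powr p * p) * s x powr p + 1 / (B powr q' * q') * g x powr q'"
          using AB s(2) g(2)[OF x] by (simp add: powr_divide mult.commute)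
      qed
      also have "\<dots> = \<alpha> / (A powr p) / p + \<beta> / (B powr q') / q'"
        unfolding \<alpha>_def \<beta>_def Henstock_Kurzweil_Integration.integral_add[OF
            integrable_on_mult_right[OF spi] integrable_on_mult_right[OF gq]] integral_mult_right
        by simp
      also have "\<dots> \<le> 1 / p + 1 / q'"
        using le AB 2 by (intro add_mono divide_right_mono) (auto simp: divide_le_eq)
      finally have "1 / (A * B) * integral {0..1} (\<lambda>x. g x * s x) \<le> 1"
        using 2 by (simp only: integral_mult_right)
      then show ?thesis
        using AB by (simp add: divide_le_eq A_def[symmetric] B_def[symmetric])
    qed
    \<comment> \<open>The enlargement \<open>e\<close> is sent to 0 from the right, the side on
      which \<open>bound\<close> holds.\<close>
    have "((\<lambda>e. (\<alpha> powr (1 / p) + e) * (\<beta> powr (1 / q') + e)) \<longlongrightarrow>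
        (\<alpha> powr (1 / p) + 0) * (\<beta> powr (1 / q') + 0)) (at_right 0)"
      by (intro tendsto_intros)
    then have "integral {0..1} (\<lambda>x. g x * s x) \<le> (\<alpha> powr (1 / p) + 0) * (\<beta> powr (1 / q') + 0)"
      by (rule tendsto_lowerbound) (auto simp: eventually_at_filter bound intro!: always_eventually)
    then show ?thesis
      by (simp add: Lp Lq \<alpha>_def)
  qed
qed

lemma sup_norm_le:
  "(\<And>x. x \<in> {0..1} \<Longrightarrow> norm (f x) \<le> B) \<Longrightarrow> sup_norm f \<le> B"
  unfolding sup_norm_def by (intro cSUP_least) auto

text \<open>On an interval of finite length the majorant \<open>1 + norm (\<sigma> x) powr p\<close>
  is integrable and dominates \<open>norm (\<sigma> x)\<close>, as \<open>p\<close> is at least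
  1.\<close>

lemma Lp_space_imp_absolutely_integrable:
  assumes "\<sigma> \<in> Lp_space p" "1 \<le> p"
  shows "\<sigma> absolutely_integrable_on {0..1}"
    "(\<lambda>x. norm (\<sigma> x) powr p) absolutely_integrable_on {0..1}"
proof -
  have m: "\<sigma> \<in> borel_measurable (lebesgue_on {0..1})"
    and i: "integrable (lebesgue_on {0..1}) (\<lambda>x. norm (\<sigma> x) powr p)"
    using assms(1) by (auto simp: Lp_space_def)
  show ai: "(\<lambda>x. norm (\<sigma> x) powr p) absolutely_integrable_on {0..1}"
    using i by (simp add: integrable_restrict_space set_integrable_def)
  have int: "(\<lambda>x. 1 + norm (\<sigma> x) powr p) integrable_on {0..1}"
    using ai set_lebesgue_integral_eq_integral(1) by (intro integrable_add) auto
  show "\<sigma> absolutely_integrable_on {0..1}"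
  proof (rule measurable_bounded_by_integrable_imp_absolutely_integrable[OF m _ int])
    show "norm (\<sigma> x) \<le> 1 + norm (\<sigma> x) powr p" for x
    proof (cases "norm (\<sigma> x) \<le> 1")
      case False
      then have "norm (\<sigma> x) powr 1 \<le> norm (\<sigma> x) powr p"
        using assms(2) by (intro powr_mono) auto
      then show ?thesis
        by simp
    qed (auto intro: add_increasing2)
  qed simp
qed

lemma \<sigma>0_integrable:
  assumes "\<sigma>1 \<in> Lp_space p" "\<sigma>2 \<in> Lp_space p" "1 \<le> p"
  shows "\<sigma>0 \<sigma>1 \<sigma>2 absolutely_integrable_on {0..1}"
    "(\<lambda>x. \<sigma>0 \<sigma>1 \<sigma>2 x powr p) absolutely_integrable_on {0..1}"
proof -
  have m: "\<sigma>1 \<in> borel_measurable (lebesgue_on {0..1})" "\<sigma>2 \<in> borel_measurable (lebesgue_on {0..1})"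
    using assms by (auto simp: Lp_space_def)
  have m0: "\<sigma>0 \<sigma>1 \<sigma>2 \<in> borel_measurable (lebesgue_on {0..1})"
    unfolding \<sigma>0_def[abs_def] using m by measurable
  then have mp: "(\<lambda>x. \<sigma>0 \<sigma>1 \<sigma>2 x powr p) \<in> borel_measurable (lebesgue_on {0..1})"
    by measurable
  note 1 = Lp_space_imp_absolutely_integrable[OF assms(1,3)]
  note 2 = Lp_space_imp_absolutely_integrable[OF assms(2,3)]
  have "(\<lambda>x. norm (\<sigma>1 x) + norm (\<sigma>2 x)) integrable_on {0..1}"
    using 1(1) 2(1) by (intro integrable_add) (auto simp: absolutely_integrable_on_def)
  then show "\<sigma>0 \<sigma>1 \<sigma>2 absolutely_integrable_on {0..1}"
    by (rule measurable_bounded_by_integrable_imp_absolutely_integrable[OF m0, rotated]) (auto simp: \<sigma>0_def max_def)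
  have "(\<lambda>x. norm (\<sigma>1 x) powr p + norm (\<sigma>2 x) powr p) integrable_on {0..1}"
    using 1(2) 2(2) set_lebesgue_integral_eq_integral(1) by (intro integrable_add) auto
  then show "(\<lambda>x. \<sigma>0 \<sigma>1 \<sigma>2 x powr p) absolutely_integrable_on {0..1}"
    by (rule measurable_bounded_by_integrable_imp_absolutely_integrable[OF mp, rotated])
      (auto simp: \<sigma>0_def max_def)
qed

section \<open>Lebesgue integrals of the statement as gauge integrals\<close>

context dirac_potential
begin

lemma LINT_V:
  assumes "continuous_on {0..1} f" "x \<in> {0..1}"
  shows "(LINT s:{x..1}|lebesgue. exp (2 * \<i> * \<mu> * of_real (s - x)) * \<sigma>2 s * f s) = V \<mu> f x"
  unfolding V_def using assms
  by (intro set_lebesgue_integral_eq_integral(2) absolutely_integrable_on_subinterval_real(1)[OF integrable_V]) auto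

lemma LINT_g2:
  "x \<in> {0..1} \<Longrightarrow> (LINT t:{x..1}|lebesgue. exp (2 * \<i> * \<mu> * of_real (t - x)) * \<sigma>2 t) = g2 \<mu> x"
  using LINT_V[of "\<lambda>_. 1" x \<mu>] by (simp add: g2_def)

lemma K1_eq:
  assumes f: "continuous_on {0..1} f" and x: "x \<in> {0..1}"
  shows "K1 \<sigma>1 \<sigma>2 \<mu> f x = K \<mu> f x"
proof -
  have "K1 \<sigma>1 \<sigma>2 \<mu> f x = (LINT t:{0..x}|lebesgue. \<sigma>1 t * V \<mu> f t)"
    unfolding K1_def using x
    by (intro set_lebesgue_integral_cong) (auto simp: LINT_V[OF f] simp del: of_real_diff)
  also have "\<dots> = K \<mu> f x"
    unfolding K_def using x
    by (intro set_lebesgue_integral_eq_integral(2)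
        absolutely_integrable_on_subinterval_real(1)[OF primitive01_imp_integrable[OF primitive01_K[OF f]]]) auto
  finally show ?thesis .
qed

lemma \<gamma>01_eq:
  assumes "x \<in> {0..1}"
  shows "\<gamma>01 \<sigma>1 \<mu> x = norm (g1 \<mu> x)"
proof -
  have "(\<lambda>t. exp (2 * \<i> * \<mu> * of_real (x - t)) * \<sigma>1 t) absolutely_integrable_on {0..1}"
    by (intro absolutely_integrable_continuous_mult \<sigma>1 continuous_intros)
  then show ?thesis
    unfolding \<gamma>01_def g1_def using assms
    by (intro arg_cong[where f = norm] set_lebesgue_integral_eq_integral(2))
      (auto intro: absolutely_integrable_on_subinterval_real(1))
qed

lemma \<gamma>02_eq: "x \<in> {0..1} \<Longrightarrow> \<gamma>02 \<sigma>2 \<mu> x = norm (g2 \<mu> x)"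
  unfolding \<gamma>02_def by (simp only: LINT_g2)

lemma continuous_\<gamma>: "continuous_on {0..1} (\<gamma>01 \<sigma>1 \<mu>)" "continuous_on {0..1} (\<gamma>02 \<sigma>2 \<mu>)"
  using continuous_on_norm[OF continuous_g1[of \<mu>]] continuous_on_norm[OF continuous_g2[of \<mu>]]
  by (auto elim: continuous_on_eq simp: \<gamma>01_eq \<gamma>02_eq)

lemma \<Gamma>2_le_\<gamma>_tilde: "\<Gamma>2 \<mu> \<le> \<gamma>_tilde \<sigma>1 \<sigma>2 \<mu>"
proof -
  have "(LINT s:{0..1}|lebesgue. norm (\<sigma>1 s) * (\<gamma>02 \<sigma>2 \<mu> s)\<^sup>2) =
      (LINT s:{0..1}|lebesgue. norm (\<sigma>1 s) * (norm (g2 \<mu> s))\<^sup>2)"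
    by (intro set_lebesgue_integral_cong) (auto simp: \<gamma>02_eq)
  also have "\<dots> = \<Gamma>2 \<mu>"
    unfolding \<Gamma>2_def by (intro set_lebesgue_integral_eq_integral(2) integrable_\<Gamma>2)
  finally have "(LINT s:{0..1}|lebesgue. norm (\<sigma>1 s) * (\<gamma>02 \<sigma>2 \<mu> s)\<^sup>2) = \<Gamma>2 \<mu>" .
  moreover have "0 \<le> (LINT s:{0..1}|lebesgue. norm (\<sigma>2 s) * (\<gamma>01 \<sigma>1 \<mu> s)\<^sup>2)"
    unfolding set_lebesgue_integral_def by (intro Bochner_Integration.integral_nonneg) simp
  ultimately show ?thesis
    by (simp add: \<gamma>_tilde_def)
qed

end

text \<open>The remainders are \<open>R1\<close> and \<open>V R1\<close> in (i); in (ii) the term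
  \<open>V (K 1)\<close> is moved into the second remainder; in (iii) they are \<open>Z - 1\<close>
  and \<open>V Z\<close>. All constants are built from \<open>N\<close>, \<open>\<kappa>\<close> and
  \<open>L\<close>, and every bound holds at each admissible parameter, so \<open>M = R\<close>
  serves throughout.\<close>

theorem theorem3p2:
  fixes p r R a :: real and q :: ennreal and \<sigma>\<^sub>1 \<sigma>\<^sub>2 :: "real \<Rightarrow> complex"
  assumes p: "1 \<le> p" "p \<le> 2"
    and q: "1 / ennreal p + 1 / q = 1"
    and \<sigma>: "\<sigma>\<^sub>1 \<in> Lp_space p" "\<sigma>\<^sub>2 \<in> Lp_space p"
    and r: "r \<ge> 0"
    and a: "a = 2 * exp (4 * r) * Lp_norm p (\<sigma>0 \<sigma>\<^sub>1 \<sigma>\<^sub>2) ^ 3"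
    and R: "R > 0" "\<forall>\<mu>\<in>\<Sigma>_outer r R. \<gamma>1 \<sigma>\<^sub>1 q \<mu> \<le> 1 / (2 * a)"
  shows "\<exists>w\<^sub>1 w\<^sub>2 :: complex \<Rightarrow> real \<Rightarrow> complex.
    (\<forall>\<mu>\<in>\<Sigma>_outer r R.
       Dirac_solution \<sigma>\<^sub>1 \<sigma>\<^sub>2 \<mu> (w\<^sub>1 \<mu>) (w\<^sub>2 \<mu>) \<and> w\<^sub>1 \<mu> 0 = 1 \<and> w\<^sub>2 \<mu> 1 = 0 \<and>
       (\<forall>y\<^sub>1 y\<^sub>2. Dirac_solution \<sigma>\<^sub>1 \<sigma>\<^sub>2 \<mu> y\<^sub>1 y\<^sub>2 \<and> y\<^sub>1 0 = 1 \<and> y\<^sub>2 1 = 0 \<longrightarrow>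
          (\<forall>x\<in>{0..1}. y\<^sub>1 x = w\<^sub>1 \<mu> x \<and> y\<^sub>2 x = w\<^sub>2 \<mu> x))) \<and>
    C01_pair_analytic_on w\<^sub>1 w\<^sub>2 (\<Sigma>_outer r R) \<and>
    (\<exists>R\<^sub>1 R\<^sub>2 :: real \<Rightarrow> complex \<Rightarrow> complex. \<exists>C\<^sub>1>0. \<exists>C\<^sub>2>0. \<exists>M\<ge>R. \<forall>\<mu>\<in>\<Sigma>_outer r M.
       (\<forall>x\<in>{0..1}.
          w\<^sub>1 \<mu> x = exp (\<i> * \<mu> * x) * (1 - K1 \<sigma>\<^sub>1 \<sigma>\<^sub>2 \<mu> (\<lambda>_. 1) x) + exp (\<i> * \<mu> * x) * R\<^sub>1 x \<mu> \<and>
          w\<^sub>2 \<mu> x = exp (\<i> * \<mu> * x) *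
              ((LINT t:{x..1}|lebesgue. exp (2 * \<i> * \<mu> * of_real (t - x)) * \<sigma>\<^sub>2 t) -
               (LINT t:{x..1}|lebesgue. exp (2 * \<i> * \<mu> * of_real (t - x)) * \<sigma>\<^sub>2 t *
                  K1 \<sigma>\<^sub>1 \<sigma>\<^sub>2 \<mu> (\<lambda>_. 1) t)) + exp (\<i> * \<mu> * x) * R\<^sub>2 x \<mu>) \<and>
       continuous_on {0..1} (\<lambda>x. R\<^sub>1 x \<mu>) \<and> continuous_on {0..1} (\<lambda>x. R\<^sub>2 x \<mu>) \<and>
       sup_norm (\<lambda>x. R\<^sub>1 x \<mu>) \<le> C\<^sub>1 * \<gamma>_tilde \<sigma>\<^sub>1 \<sigma>\<^sub>2 \<mu> \<and>
       sup_norm (\<lambda>x. R\<^sub>2 x \<mu>) \<le> C\<^sub>2 * \<gamma>_tilde \<sigma>\<^sub>1 \<sigma>\<^sub>2 \<mu>) \<and>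
    (\<exists>S\<^sub>1 S\<^sub>2 :: real \<Rightarrow> complex \<Rightarrow> complex. \<exists>C\<^sub>1>0. \<exists>C\<^sub>2>0. \<exists>M\<ge>R. \<forall>\<mu>\<in>\<Sigma>_outer r M. \<forall>x\<in>{0..1}.
       w\<^sub>1 \<mu> x = exp (\<i> * \<mu> * x) * (1 - K1 \<sigma>\<^sub>1 \<sigma>\<^sub>2 \<mu> (\<lambda>_. 1) x) + exp (\<i> * \<mu> * x) * S\<^sub>1 x \<mu> \<and>
       w\<^sub>2 \<mu> x = exp (\<i> * \<mu> * x) *
           (LINT t:{x..1}|lebesgue. exp (2 * \<i> * \<mu> * of_real (t - x)) * \<sigma>\<^sub>2 t) +
         exp (\<i> * \<mu> * x) * S\<^sub>2 x \<mu> \<and>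
       norm (S\<^sub>1 x \<mu>) \<le> C\<^sub>1 * \<Lambda> \<sigma>\<^sub>1 \<sigma>\<^sub>2 q x \<mu> \<and>
       norm (S\<^sub>2 x \<mu>) \<le> C\<^sub>2 * \<Lambda> \<sigma>\<^sub>1 \<sigma>\<^sub>2 q x \<mu>) \<and>
    (\<exists>T\<^sub>1 T\<^sub>2 :: real \<Rightarrow> complex \<Rightarrow> complex. \<exists>C\<^sub>1>0. \<exists>C\<^sub>2>0. \<exists>M\<ge>R. \<forall>\<mu>\<in>\<Sigma>_outer r M. \<forall>x\<in>{0..1}.
       w\<^sub>1 \<mu> x = exp (\<i> * \<mu> * x) + exp (\<i> * \<mu> * x) * T\<^sub>1 x \<mu> \<and>
       w\<^sub>2 \<mu> x = exp (\<i> * \<mu> * x) * T\<^sub>2 x \<mu> \<and>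
       norm (T\<^sub>1 x \<mu>) \<le> C\<^sub>1 * \<Xi> \<sigma>\<^sub>1 \<sigma>\<^sub>2 q x \<mu> \<and>
       norm (T\<^sub>2 x \<mu>) \<le> C\<^sub>2 * \<Xi> \<sigma>\<^sub>1 \<sigma>\<^sub>2 q x \<mu>)"
proof -
  define N where "N = Lp_norm p (\<sigma>0 \<sigma>\<^sub>1 \<sigma>\<^sub>2)"
  note \<sigma>0 = \<sigma>0_integrable[OF \<sigma> p(1)]
  have \<sigma>0_nn: "0 \<le> \<sigma>0 \<sigma>\<^sub>1 \<sigma>\<^sub>2 x" for x
    by (simp add: \<sigma>0_def le_max_iff_disj)
  note ai1 = Lp_space_imp_absolutely_integrable(1)[OF \<sigma>(1) p(1)]
  note ai2 = Lp_space_imp_absolutely_integrable(1)[OF \<sigma>(2) p(1)]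
  have weighted: "integral {0..1} (\<lambda>x. g x * norm (s x)) \<le> N * Lq_norm q g"
    if g: "continuous_on {0..1} g" "\<And>x. x \<in> {0..1} \<Longrightarrow> 0 \<le> g x"
      and s: "s absolutely_integrable_on {0..1}" "\<And>x. norm (s x) \<le> \<sigma>0 \<sigma>\<^sub>1 \<sigma>\<^sub>2 x"
    for g :: "real \<Rightarrow> real" and s :: "real \<Rightarrow> complex"
  proof -
    have "integral {0..1} (\<lambda>x. g x * norm (s x)) \<le> integral {0..1} (\<lambda>x. g x * \<sigma>0 \<sigma>\<^sub>1 \<sigma>\<^sub>2 x)"
      using g s \<sigma>0(1)
      by (intro integral_le set_lebesgue_integral_eq_integral(1) absolutely_integrable_continuous_mult
          set_integrable_norm mult_left_mono) auto
    also have "\<dots> \<le> N * Lq_norm q g"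
      unfolding N_def using \<sigma>0 \<sigma>0_nn g by (intro Holder_inequality_01[OF p(1) q])
    finally show ?thesis .
  qed
  have le\<sigma>0: "norm (\<sigma>\<^sub>1 x) \<le> \<sigma>0 \<sigma>\<^sub>1 \<sigma>\<^sub>2 x" "norm (\<sigma>\<^sub>2 x) \<le> \<sigma>0 \<sigma>\<^sub>1 \<sigma>\<^sub>2 x" for x
    by (simp_all add: \<sigma>0_def)
  \<comment> \<open>The interval has length one, so Hoelder's inequality with \<open>g = 1\<close>
    bounds the L1 norms of both potentials by \<open>N\<close>, as the locale requires.\<close>
  have one: "Lq_norm q (\<lambda>_. 1) = 1"
    by (simp add: Lq_norm_def sup_norm_def Lp_norm_def set_lebesgue_integral_def)
  interpret dirac_potential \<sigma>\<^sub>1 \<sigma>\<^sub>2 r N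
  proof
    show "integral {0..1} (\<lambda>x. norm (\<sigma>\<^sub>1 x)) \<le> N" "integral {0..1} (\<lambda>x. norm (\<sigma>\<^sub>2 x)) \<le> N"
      using weighted[of "\<lambda>_. 1", OF _ _ ai1 le\<sigma>0(1)] weighted[of "\<lambda>_. 1", OF _ _ ai2 le\<sigma>0(2)] one by simp_all
  qed (use ai1 ai2 r in auto)
  have I1_g2: "I1 (g2 \<mu>) \<le> N * \<gamma>2 \<sigma>\<^sub>2 q \<mu>" for \<mu>
  proof -
    have "I1 (g2 \<mu>) = integral {0..1} (\<lambda>x. \<gamma>02 \<sigma>\<^sub>2 \<mu> x * norm (\<sigma>\<^sub>1 x))"
      unfolding I1_def by (intro integral_cong) (simp add: \<gamma>02_eq)
    also have "\<dots> \<le> N * Lq_norm q (\<gamma>02 \<sigma>\<^sub>2 \<mu>)"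
      by (intro weighted continuous_\<gamma> ai1 le\<sigma>0) (simp add: \<gamma>02_def)
    finally show ?thesis
      by (simp add: \<gamma>2_def)
  qed
  have I2_g1: "I2 (g1 \<mu>) \<le> N * \<gamma>1 \<sigma>\<^sub>1 q \<mu>" for \<mu>
  proof -
    have "I2 (g1 \<mu>) = integral {0..1} (\<lambda>x. \<gamma>01 \<sigma>\<^sub>1 \<mu> x * norm (\<sigma>\<^sub>2 x))"
      unfolding I2_def by (intro integral_cong) (simp add: \<gamma>01_eq)
    also have "\<dots> \<le> N * Lq_norm q (\<gamma>01 \<sigma>\<^sub>1 \<mu>)"
      by (intro weighted continuous_\<gamma> ai2 le\<sigma>0) (simp add: \<gamma>01_def)
    finally show ?thesis
      by (simp add: \<gamma>1_def)
  qed
  \<comment> \<open>The square of \<open>\<kappa>\<close> is \<open>exp (4 * r)\<close>; thus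
    \<open>a\<close> is the constant of \<open>norm_K_K_le\<close> with the third factor
    \<open>N\<close> supplied by \<open>I2_g1\<close>.\<close>
  have a: "a = 2 * \<kappa>\<^sup>2 * N ^ 3"
    by (simp add: a N_def \<kappa>_def exp_double[symmetric])
  have adm: "admissible \<mu>" if \<mu>: "\<mu> \<in> \<Sigma>_outer r R" for \<mu>
  proof -
    have "4 * \<kappa>\<^sup>2 * N\<^sup>2 * I2 (g1 \<mu>) \<le> 4 * \<kappa>\<^sup>2 * N\<^sup>2 * (N * \<gamma>1 \<sigma>\<^sub>1 q \<mu>)"
      using I2_g1 by (intro mult_left_mono) auto
    also have "\<dots> = 2 * a * \<gamma>1 \<sigma>\<^sub>1 q \<mu>"
      by (simp add: a power2_eq_square power3_eq_cube)
    also have "\<dots> \<le> 2 * a * (1 / (2 * a))"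
      using R(2) \<mu> N_nonneg by (intro mult_left_mono) (auto simp: a)
    \<comment> \<open>Not an equality in general: for \<open>a = 0\<close> the quotient
      \<open>1 / (2 * a)\<close> is 0, and so is the product.\<close>
    also have "\<dots> \<le> 1"
      by simp
    finally show ?thesis
      using \<mu> by (simp add: admissible_def \<Sigma>_outer_def \<Sigma>_region_def)
  qed
  have im: "- r \<le> Im \<mu>" if "\<mu> \<in> \<Sigma>_outer r R" for \<mu>
    using adm[OF that] by (simp add: admissible_def)
  have "open (\<Sigma>_outer r R)"
    unfolding \<Sigma>_outer_def \<Sigma>_region_def
    by (simp add: Collect_conj_eq[symmetric] open_Collect_conj open_Collect_less continuous_on_Im continuous_on_norm)
  then have analytic: "C01_pair_analytic_on W1 W2 (\<Sigma>_outer r R)"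
    using adm by (rule W_analytic)
  define CR where "CR = L * ((N + 1) / 2 + N * \<kappa>)"
  have CR: "0 < CR"
    unfolding CR_def using L_pos N_nonneg \<kappa>_ge_1 by (intro mult_pos_pos add_pos_nonneg) auto
  have \<kappa>N: "0 \<le> \<kappa> * N"
    using N_nonneg \<kappa>_ge_1 by simp
  \<comment> \<open>The summand 1 keeps the constant positive when \<open>N = 0\<close>.\<close>
  then have CR2: "0 < \<kappa> * N * CR + 1"
    using CR by (simp add: add_nonneg_pos)
  have \<gamma>t: "0 \<le> \<gamma>_tilde \<sigma>\<^sub>1 \<sigma>\<^sub>2 \<mu>" for \<mu>
    using \<Gamma>2_nonneg[of \<mu>] \<Gamma>2_le_\<gamma>_tilde[of \<mu>] by simp
  have R1_le: "norm (R1 \<mu> x) \<le> CR * \<gamma>_tilde \<sigma>\<^sub>1 \<sigma>\<^sub>2 \<mu>" if "\<mu> \<in> \<Sigma>_outer r R" "x \<in> {0..1}" for \<mu> x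
    using norm_R1_le[OF adm[OF that(1)] that(2)] mult_left_mono[OF \<Gamma>2_le_\<gamma>_tilde[of \<mu>], of CR] CR
    by (simp add: CR_def mult.assoc)
  have VR1_le: "norm (V \<mu> (R1 \<mu>) x) \<le> \<kappa> * N * CR * \<gamma>_tilde \<sigma>\<^sub>1 \<sigma>\<^sub>2 \<mu>"
    if "\<mu> \<in> \<Sigma>_outer r R" "x \<in> {0..1}" for \<mu> x
    using norm_V_R1_le[OF adm[OF that(1)] that(2)] mult_left_mono[OF \<Gamma>2_le_\<gamma>_tilde[of \<mu>], of "\<kappa> * N * CR"] mult_nonneg_nonneg[OF \<kappa>N less_imp_le[OF CR]]
    by (simp add: CR_def mult.assoc)
  have \<gamma>_nn: "0 \<le> \<gamma>1 \<sigma>\<^sub>1 q \<mu>" "0 \<le> \<gamma>2 \<sigma>\<^sub>2 q \<mu>" "0 \<le> \<gamma>01 \<sigma>\<^sub>1 \<mu> x" "0 \<le> \<gamma>02 \<sigma>\<^sub>2 \<mu> x" for \<mu> x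
    by (auto simp: \<gamma>1_def \<gamma>2_def \<gamma>01_def \<gamma>02_def intro!: Lq_norm_nonneg continuous_\<gamma>)
  have K1: "K1 \<sigma>\<^sub>1 \<sigma>\<^sub>2 \<mu> (\<lambda>_. 1) x = K \<mu> (\<lambda>_. 1) x" if "x \<in> {0..1}" for \<mu> x
    using that by (intro K1_eq) auto
  have W1_eq: "W1 \<mu> x = exp (\<i> * \<mu> * x) * (1 - K1 \<sigma>\<^sub>1 \<sigma>\<^sub>2 \<mu> (\<lambda>_. 1) x) + exp (\<i> * \<mu> * x) * R1 \<mu> x"
    if "x \<in> {0..1}" for \<mu> x
    using that by (simp add: W1_def R1_def K1 algebra_simps)
  have W2_eq: "W2 \<mu> x = exp (\<i> * \<mu> * x) *
              ((LINT t:{x..1}|lebesgue. exp (2 * \<i> * \<mu> * of_real (t - x)) * \<sigma>\<^sub>2 t) -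
               (LINT t:{x..1}|lebesgue. exp (2 * \<i> * \<mu> * of_real (t - x)) * \<sigma>\<^sub>2 t *
                  K1 \<sigma>\<^sub>1 \<sigma>\<^sub>2 \<mu> (\<lambda>_. 1) t)) + exp (\<i> * \<mu> * x) * V \<mu> (R1 \<mu>) x"
    if \<mu>: "\<mu> \<in> \<Sigma>_outer r R" and x: "x \<in> {0..1}" for \<mu> x
  proof -
    have "(LINT t:{x..1}|lebesgue. exp (2 * \<i> * \<mu> * of_real (t - x)) * \<sigma>\<^sub>2 t * K1 \<sigma>\<^sub>1 \<sigma>\<^sub>2 \<mu> (\<lambda>_. 1) t) =
        (LINT t:{x..1}|lebesgue. exp (2 * \<i> * \<mu> * of_real (t - x)) * \<sigma>\<^sub>2 t * K \<mu> (\<lambda>_. 1) t)"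
      using x by (intro set_lebesgue_integral_cong) (auto simp: K1)
    also have "\<dots> = V \<mu> (K \<mu> (\<lambda>_. 1)) x"
      by (rule LINT_V[OF continuous_K_one x])
    finally show ?thesis
      unfolding W2_def V_Z_eq[OF adm[OF \<mu>] x] LINT_g2[OF x] by (simp only: distrib_left)
  qed
  have part1: "\<exists>R\<^sub>1 R\<^sub>2 :: real \<Rightarrow> complex \<Rightarrow> complex. \<exists>C\<^sub>1>0. \<exists>C\<^sub>2>0. \<exists>M\<ge>R. \<forall>\<mu>\<in>\<Sigma>_outer r M.
       (\<forall>x\<in>{0..1}.
          W1 \<mu> x = exp (\<i> * \<mu> * x) * (1 - K1 \<sigma>\<^sub>1 \<sigma>\<^sub>2 \<mu> (\<lambda>_. 1) x) + exp (\<i> * \<mu> * x) * R\<^sub>1 x \<mu> \<and>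
          W2 \<mu> x = exp (\<i> * \<mu> * x) *
              ((LINT t:{x..1}|lebesgue. exp (2 * \<i> * \<mu> * of_real (t - x)) * \<sigma>\<^sub>2 t) -
               (LINT t:{x..1}|lebesgue. exp (2 * \<i> * \<mu> * of_real (t - x)) * \<sigma>\<^sub>2 t *
                  K1 \<sigma>\<^sub>1 \<sigma>\<^sub>2 \<mu> (\<lambda>_. 1) t)) + exp (\<i> * \<mu> * x) * R\<^sub>2 x \<mu>) \<and>
       continuous_on {0..1} (\<lambda>x. R\<^sub>1 x \<mu>) \<and> continuous_on {0..1} (\<lambda>x. R\<^sub>2 x \<mu>) \<and>
       sup_norm (\<lambda>x. R\<^sub>1 x \<mu>) \<le> C\<^sub>1 * \<gamma>_tilde \<sigma>\<^sub>1 \<sigma>\<^sub>2 \<mu> \<and>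
       sup_norm (\<lambda>x. R\<^sub>2 x \<mu>) \<le> C\<^sub>2 * \<gamma>_tilde \<sigma>\<^sub>1 \<sigma>\<^sub>2 \<mu>"
  proof (rule exI[of _ "\<lambda>x \<mu>. R1 \<mu> x"], rule exI[of _ "\<lambda>x \<mu>. V \<mu> (R1 \<mu>) x"],
      rule exI[of _ CR], rule conjI[OF CR], rule exI[of _ "\<kappa> * N * CR + 1"], rule conjI[OF CR2],
      rule exI[of _ R], rule conjI[OF order_refl], intro ballI conjI, goal_cases)
    case (1 \<mu> x)
    then show ?case by (intro W1_eq)
  next
    case (2 \<mu> x)
    then show ?case by (intro W2_eq)
  next
    case (3 \<mu>)
    then show ?case by (intro continuous_R1 adm)
  next
    case (4 \<mu>)
    then show ?case by (intro continuous_V continuous_R1 adm)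
  next
    case (5 \<mu>)
    then show ?case by (intro sup_norm_le R1_le)
  next
    case (6 \<mu>)
    then show ?case
      using VR1_le[OF 6] \<gamma>t[of \<mu>] by (intro sup_norm_le) (simp add: distrib_right add_increasing2)
  qed
  \<comment> \<open>Collects the coefficients of \<open>\<gamma>_tilde\<close> from
    \<open>V R1\<close> and \<open>V (K 1)\<close>; the result also exceeds 1/2, the coefficient of
    the square of \<open>\<gamma>02\<close>.\<close>
  define CS where "CS = \<kappa> * N * CR + (N + 1) / 2 + \<kappa> + 1"
  have CS: "0 < CS"
    unfolding CS_def using \<kappa>N CR N_nonneg \<kappa>_ge_1 by (simp add: add_nonneg_pos)
  have \<Lambda>: "\<gamma>_tilde \<sigma>\<^sub>1 \<sigma>\<^sub>2 \<mu> + (\<gamma>02 \<sigma>\<^sub>2 \<mu> x)\<^sup>2 \<le> \<Lambda> \<sigma>\<^sub>1 \<sigma>\<^sub>2 q x \<mu>" for \<mu> x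
    by (simp add: \<Lambda>_def)
  have S1_le: "norm (R1 \<mu> x) \<le> CR * \<Lambda> \<sigma>\<^sub>1 \<sigma>\<^sub>2 q x \<mu>" if "\<mu> \<in> \<Sigma>_outer r R" "x \<in> {0..1}" for \<mu> x
  proof -
    have "\<gamma>_tilde \<sigma>\<^sub>1 \<sigma>\<^sub>2 \<mu> \<le> \<Lambda> \<sigma>\<^sub>1 \<sigma>\<^sub>2 q x \<mu>"
      by (simp add: \<Lambda>_def)
    then show ?thesis
      using R1_le[OF that] mult_left_mono[of _ _ CR] CR by (meson less_imp_le order_trans)
  qed
  have S2_le: "norm (V \<mu> (R1 \<mu>) x - V \<mu> (K \<mu> (\<lambda>_. 1)) x) \<le> CS * \<Lambda> \<sigma>\<^sub>1 \<sigma>\<^sub>2 q x \<mu>"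
    if \<mu>: "\<mu> \<in> \<Sigma>_outer r R" and x: "x \<in> {0..1}" for \<mu> x
  proof -
    let ?t = "\<gamma>_tilde \<sigma>\<^sub>1 \<sigma>\<^sub>2 \<mu>" and ?s = "(\<gamma>02 \<sigma>\<^sub>2 \<mu> x)\<^sup>2"
    have "((N + 1) / 2 + \<kappa>) * \<Gamma>2 \<mu> \<le> ((N + 1) / 2 + \<kappa>) * ?t"
      using \<Gamma>2_le_\<gamma>_tilde N_nonneg \<kappa>_ge_1 by (intro mult_left_mono) auto
    then have "norm (V \<mu> (K \<mu> (\<lambda>_. 1)) x) \<le> ?s / 2 + ((N + 1) / 2 + \<kappa>) * ?t"
      using norm_V_K_one_le[OF im[OF \<mu>] x] unfolding \<gamma>02_eq[OF x] by linarith
    then have "norm (V \<mu> (R1 \<mu>) x - V \<mu> (K \<mu> (\<lambda>_. 1)) x) \<le>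
        \<kappa> * N * CR * ?t + (?s / 2 + ((N + 1) / 2 + \<kappa>) * ?t)"
      using VR1_le[OF \<mu> x] by (intro norm_triangle_le_diff add_mono)
    also have "\<dots> = (CS - 1) * ?t + 1 / 2 * ?s"
      by (simp add: CS_def algebra_simps)
    also have "\<dots> \<le> CS * ?t + CS * ?s"
    proof (intro add_mono mult_right_mono)
      have "0 \<le> \<kappa> * N * CR + (N + 1) / 2"
        using \<kappa>N CR N_nonneg by (intro add_nonneg_nonneg) auto
      then show "1 / 2 \<le> CS"
        unfolding CS_def using \<kappa>_ge_1 by linarith
    qed (use \<gamma>t in auto)
    also have "\<dots> \<le> CS * \<Lambda> \<sigma>\<^sub>1 \<sigma>\<^sub>2 q x \<mu>"
      unfolding distrib_left[symmetric] using CS \<Lambda> by (intro mult_left_mono) auto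
    finally show ?thesis .
  qed
  have part2: "\<exists>S\<^sub>1 S\<^sub>2 :: real \<Rightarrow> complex \<Rightarrow> complex. \<exists>C\<^sub>1>0. \<exists>C\<^sub>2>0. \<exists>M\<ge>R. \<forall>\<mu>\<in>\<Sigma>_outer r M. \<forall>x\<in>{0..1}.
       W1 \<mu> x = exp (\<i> * \<mu> * x) * (1 - K1 \<sigma>\<^sub>1 \<sigma>\<^sub>2 \<mu> (\<lambda>_. 1) x) + exp (\<i> * \<mu> * x) * S\<^sub>1 x \<mu> \<and>
       W2 \<mu> x = exp (\<i> * \<mu> * x) *
           (LINT t:{x..1}|lebesgue. exp (2 * \<i> * \<mu> * of_real (t - x)) * \<sigma>\<^sub>2 t) +
         exp (\<i> * \<mu> * x) * S\<^sub>2 x \<mu> \<and>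
       norm (S\<^sub>1 x \<mu>) \<le> C\<^sub>1 * \<Lambda> \<sigma>\<^sub>1 \<sigma>\<^sub>2 q x \<mu> \<and>
       norm (S\<^sub>2 x \<mu>) \<le> C\<^sub>2 * \<Lambda> \<sigma>\<^sub>1 \<sigma>\<^sub>2 q x \<mu>"
  proof (rule exI[of _ "\<lambda>x \<mu>. R1 \<mu> x"], rule exI[of _ "\<lambda>x \<mu>. V \<mu> (R1 \<mu>) x - V \<mu> (K \<mu> (\<lambda>_. 1)) x"],
      rule exI[of _ CR], rule conjI[OF CR], rule exI[of _ CS], rule conjI[OF CS],
      rule exI[of _ R], rule conjI[OF order_refl], intro ballI conjI, goal_cases)
    case (1 \<mu> x)
    then show ?case by (intro W1_eq)
  next
    case (2 \<mu> x)
    then show ?case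
      unfolding W2_def V_Z_eq[OF adm[OF 2(1)] 2(2)] LINT_g2[OF 2(2)] distrib_left[symmetric] by simp
  next
    case (3 \<mu> x)
    then show ?case by (rule S1_le)
  next
    case (4 \<mu> x)
    then show ?case by (rule S2_le)
  qed
  \<comment> \<open>In the first constant the summand 1 ensures positivity for \<open>N = 0\<close>;
    in the second it accounts for the leading term
    \<open>\<gamma>02 \<sigma>\<^sub>2 \<mu> x\<close> itself.\<close>
  have T1_le: "norm (Z \<mu> x - 1) \<le> (L * N + 1) * \<Xi> \<sigma>\<^sub>1 \<sigma>\<^sub>2 q x \<mu>"
    and T2_le: "norm (V \<mu> (Z \<mu>) x) \<le> (\<kappa> * N * L * N + 1) * \<Xi> \<sigma>\<^sub>1 \<sigma>\<^sub>2 q x \<mu>"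
    if \<mu>: "\<mu> \<in> \<Sigma>_outer r R" and x: "x \<in> {0..1}" for \<mu> x
  proof -
    have LN: "0 \<le> L * N"
      using L_pos N_nonneg by simp
    have \<Xi>: "0 \<le> \<Xi> \<sigma>\<^sub>1 \<sigma>\<^sub>2 q x \<mu>" "\<gamma>2 \<sigma>\<^sub>2 q \<mu> \<le> \<Xi> \<sigma>\<^sub>1 \<sigma>\<^sub>2 q x \<mu>" "\<gamma>02 \<sigma>\<^sub>2 \<mu> x \<le> \<Xi> \<sigma>\<^sub>1 \<sigma>\<^sub>2 q x \<mu>"
      using \<gamma>_nn(1,2)[of \<mu>] \<gamma>_nn(3,4)[of \<mu> x] by (simp_all add: \<Xi>_def)
    have "L * I1 (g2 \<mu>) \<le> L * (N * \<gamma>2 \<sigma>\<^sub>2 q \<mu>)"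
      using I1_g2 L_pos by (intro mult_left_mono) auto
    also have "\<dots> \<le> L * N * \<Xi> \<sigma>\<^sub>1 \<sigma>\<^sub>2 q x \<mu>"
      unfolding mult.assoc[symmetric] using \<Xi> LN by (intro mult_left_mono)
    finally have le: "L * I1 (g2 \<mu>) \<le> L * N * \<Xi> \<sigma>\<^sub>1 \<sigma>\<^sub>2 q x \<mu>" .
    then show "norm (Z \<mu> x - 1) \<le> (L * N + 1) * \<Xi> \<sigma>\<^sub>1 \<sigma>\<^sub>2 q x \<mu>"
      using norm_Z_minus_one_le[OF adm[OF \<mu>] x] \<Xi> by (simp add: distrib_right)
    have "\<kappa> * N * (L * I1 (g2 \<mu>)) \<le> \<kappa> * N * (L * N * \<Xi> \<sigma>\<^sub>1 \<sigma>\<^sub>2 q x \<mu>)"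
      using le \<kappa>N by (rule mult_left_mono)
    then show "norm (V \<mu> (Z \<mu>) x) \<le> (\<kappa> * N * L * N + 1) * \<Xi> \<sigma>\<^sub>1 \<sigma>\<^sub>2 q x \<mu>"
      using norm_V_Z_le[OF adm[OF \<mu>] x] \<Xi>(3) by (simp add: distrib_right mult.assoc \<gamma>02_eq[OF x])
  qed
  have C1: "0 < L * N + 1" and C2: "0 < \<kappa> * N * L * N + 1"
    using L_pos N_nonneg \<kappa>_ge_1 by (simp_all add: add_nonneg_pos)
  have part3: "\<exists>T\<^sub>1 T\<^sub>2 :: real \<Rightarrow> complex \<Rightarrow> complex. \<exists>C\<^sub>1>0. \<exists>C\<^sub>2>0. \<exists>M\<ge>R. \<forall>\<mu>\<in>\<Sigma>_outer r M. \<forall>x\<in>{0..1}.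
       W1 \<mu> x = exp (\<i> * \<mu> * x) + exp (\<i> * \<mu> * x) * T\<^sub>1 x \<mu> \<and>
       W2 \<mu> x = exp (\<i> * \<mu> * x) * T\<^sub>2 x \<mu> \<and>
       norm (T\<^sub>1 x \<mu>) \<le> C\<^sub>1 * \<Xi> \<sigma>\<^sub>1 \<sigma>\<^sub>2 q x \<mu> \<and>
       norm (T\<^sub>2 x \<mu>) \<le> C\<^sub>2 * \<Xi> \<sigma>\<^sub>1 \<sigma>\<^sub>2 q x \<mu>"
  proof (rule exI[of _ "\<lambda>x \<mu>. Z \<mu> x - 1"], rule exI[of _ "\<lambda>x \<mu>. V \<mu> (Z \<mu>) x"],
      rule exI[of _ "L * N + 1"], rule conjI[OF C1], rule exI[of _ "\<kappa> * N * L * N + 1"], rule conjI[OF C2],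
      rule exI[of _ R], rule conjI[OF order_refl], intro ballI conjI, goal_cases)
    case (1 \<mu> x)
    then show ?case by (simp add: W1_def algebra_simps)
  next
    case (2 \<mu> x)
    then show ?case by (simp add: W2_def)
  next
    case (3 \<mu> x)
    then show ?case by (rule T1_le)
  next
    case (4 \<mu> x)
    then show ?case by (rule T2_le)
  qed
  show ?thesis
    by (intro exI[of _ W1] exI[of _ W2] conjI ballI allI impI analytic part1 part2 part3)
      (use adm W_solution W_unique in auto)
qed

end
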